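(* Let $m$ be a positive even integer, $\tau=u+iv\in\mathbb{H}$, $q=e^{2\pi i\tau}$, $\zeta=e^{2\pi i z}$, and $$\varphi(z;\tau):=\left(\frac{\vartheta\left(z+\frac12;\tau\right)}{\vartheta(z;\tau)}\right)^m.$$ Let $D_0,D_2,\dots,D_m$ be defined by the Laurent expansion at $z=0$: $\varphi(z;\tau)=\sum_{j=0}^{m/2}\frac{D_{2j}(\tau)}{(2\pi i z)^{2j}}+O(z^2)$. Define $$\varphi^F(\tau):=D_0(\tau)+\sum_{j=1}^{m/2}\frac{B_{2j}}{(2j)!}D_{2j}(\tau)E_{2j}(\tau),\qquad \varphi^P(z;\tau):=\sum_{j=1}^{m/2}\frac{D_{2j}(\tau)}{(2j-1)!}\sum_{r\ne0}\frac{r^{2j-1}}{1-q^r}\zeta^r,$$ $$\widehat{\varphi}^F(\tau):=\varphi^F(\tau)-\frac{D_2(\tau)}{4\pi v},\qquad \widehat{\varphi}^P(z;\tau):=\varphi^P(z;\tau)+\frac{D_2(\tau)}{4\pi v}.$$ Then $\varphi(z;\tau)=\widehat{\varphi}^F(\tau)+\widehat{\varphi}^P(z;\tau)$ (for $0<\operatorname{Im}(z)<\operatorname{Im}(\tau)$), where (1) $\widehat{\varphi}^F$ is an almost holomorphic modular form of weight $0$ on $\Gamma_0(2)$ with Nebentypus character $\psi$; (2) $\widehat{\varphi}^P(z;\tau)$ is a (non-holomorphic) Jacobi form of weight $0$ on $\Gamma_0(2)$ with Nebentypus character $\psi$.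
   Context: Jacobi's theta function is $\vartheta(z;\tau):=\sum_{\nu\in\frac12+\mathbb{Z}}e^{\pi i\nu^2\tau+2\pi i\nu\left(z+\frac12\right)}$. Bernoulli numbers: $\frac{t}{e^t-1}=\sum_{r\ge0}B_r\frac{t^r}{r!}$. For $j\ge1$, $E_{2j}(\tau):=1-\frac{4j}{B_{2j}}\sum_{\ell\ge1}\sigma_{2j-1}(\ell)q^\ell$, $\sigma_s(\ell)=\sum_{d\mid\ell}d^s$. For $\gamma=\begin{pmatrix}a&b\\c&d\end{pmatrix}\in\Gamma_0(2)$, $\psi(\gamma):=(-1)^{\frac{mc}{4}}$. An almost holomorphic modular form (Kaneko–Zagier) of weight $k$ with character $\psi$ is a function on $\mathbb{H}$ that is a polynomial in $1/v$ with coefficients holomorphic on $\mathbb{H}$ (poles allowed at cusps) and satisfies $f(\gamma\tau)=\psi(\gamma)(c\tau+d)^kf(\tau)$ for $\gamma\in\Gamma_0(2)$. A (non-holomorphic) Jacobi form of weight $0$ (and index $0$) on $\Gamma_0(2)$ with character $\psi$ here means a function $\phi(z;\tau)$ with $\phi\left(\frac{z}{c\tau+d};\gamma\tau\right)=\psi(\gamma)\phi(z;\tau)$ for $\gamma\in\Gamma_0(2)$ and $\phi(z+\lambda\tau+\mu;\tau)=\phi(z;\tau)$ for $\lambda,\mu\in\mathbb{Z}$. *)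

theory Defs
  imports "HOL-Complex_Analysis.Complex_Analysis" "HOL-Library.Landau_Symbols"
begin

section \<open>The upper half-plane and modular groups\<close>

definition upper_half_plane :: "complex set" where
  "upper_half_plane = {\<tau>. Im \<tau> > 0}"

text \<open>The tuple \<open>(a, b, c, d)\<close> stands for the matrix with rows \<open>(a, b)\<close> and \<open>(c, d)\<close>.\<close>

type_synonym mat2 = "int \<times> int \<times> int \<times> int"

definition SL2Z :: "mat2 set" where
  "SL2Z = {(a, b, c, d). a * d - b * c = 1}"

definition Gamma0 :: "nat \<Rightarrow> mat2 set" where
  "Gamma0 N = {(a, b, c, d). a * d - b * c = 1 \<and> int N dvd c}"

definition mob :: "mat2 \<Rightarrow> complex \<Rightarrow> complex" where
  "mob = (\<lambda>(a, b, c, d) \<tau>. (of_int a * \<tau> + of_int b) / (of_int c * \<tau> + of_int d))"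

definition autfac :: "mat2 \<Rightarrow> complex \<Rightarrow> complex" where
  "autfac = (\<lambda>(a, b, c, d) \<tau>. of_int c * \<tau> + of_int d)"

text \<open>The division below is exact for even \<open>m\<close> on \<open>Gamma0 2\<close>, where \<open>c\<close> is even.\<close>

definition psi :: "nat \<Rightarrow> mat2 \<Rightarrow> complex" where
  "psi m = (\<lambda>(a, b, c, d). (-1) powi ((int m * c) div 4))"


section \<open>Almost holomorphic modular forms and Jacobi forms\<close>

text \<open>
  ``Poles allowed at cusps'': for every \<open>\<gamma>\<close> in \<open>SL2Z\<close>, the function \<open>g\<close> slashed with \<open>\<gamma>\<close> in
  weight \<open>k\<close> grows at most like a fixed power of \<open>1/|q|\<close> as \<open>Im \<tau>\<close> tends to infinity, uniformly
  in \<open>Re \<tau>\<close>. For a function that is holomorphic in \<open>q^(1/h)\<close> on the punctured disc this says that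
  its singularity at \<open>q = 0\<close> is at most a pole.
\<close>

definition at_most_poles_at_cusps :: "int \<Rightarrow> (complex \<Rightarrow> complex) \<Rightarrow> bool" where
  "at_most_poles_at_cusps k g \<longleftrightarrow>
     (\<forall>\<gamma>\<in>SL2Z. \<exists>A C :: real. \<forall>\<tau>. Im \<tau> \<ge> 1 \<longrightarrow>
        norm (autfac \<gamma> \<tau> powi (-k) * g (mob \<gamma> \<tau>)) \<le> A * exp (C * Im \<tau>))"

text \<open>
  The coefficient of \<open>v^(-j)\<close> in a form of weight \<open>k\<close> has (quasimodular) weight \<open>k - 2 j\<close>,
  which is therefore the weight used in its cusp condition.
\<close>

definition almost_holomorphic_modular_form ::
    "int \<Rightarrow> mat2 set \<Rightarrow> (mat2 \<Rightarrow> complex) \<Rightarrow> (complex \<Rightarrow> complex) \<Rightarrow> bool" where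
  "almost_holomorphic_modular_form k \<Gamma> \<rho> f \<longleftrightarrow>
     (\<exists>(n :: nat) (g :: nat \<Rightarrow> complex \<Rightarrow> complex).
        (\<forall>j\<le>n. g j holomorphic_on upper_half_plane \<and>
                at_most_poles_at_cusps (k - 2 * int j) (g j)) \<and>
        (\<forall>\<tau>\<in>upper_half_plane. f \<tau> = (\<Sum>j\<le>n. g j \<tau> * (1 / complex_of_real (Im \<tau>)) ^ j))) \<and>
     (\<forall>\<gamma>\<in>\<Gamma>. \<forall>\<tau>\<in>upper_half_plane. f (mob \<gamma> \<tau>) = \<rho> \<gamma> * autfac \<gamma> \<tau> powi k * f \<tau>)"

text \<open>Weight 0 and index 0; no analyticity in \<open>\<tau>\<close> is required (non-holomorphic forms).\<close>

definition jacobi_form_weight0 ::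
    "mat2 set \<Rightarrow> (mat2 \<Rightarrow> complex) \<Rightarrow> (complex \<Rightarrow> complex \<Rightarrow> complex) \<Rightarrow> bool" where
  "jacobi_form_weight0 \<Gamma> \<rho> \<phi> \<longleftrightarrow>
     (\<forall>\<gamma>\<in>\<Gamma>. \<forall>\<tau>\<in>upper_half_plane. \<forall>z. \<phi> (z / autfac \<gamma> \<tau>) (mob \<gamma> \<tau>) = \<rho> \<gamma> * \<phi> z \<tau>) \<and>
     (\<forall>\<tau>\<in>upper_half_plane. \<forall>z. \<forall>l \<mu> :: int. \<phi> (z + of_int l * \<tau> + of_int \<mu>) \<tau> = \<phi> z \<tau>)"


section \<open>Bernoulli numbers, Eisenstein series and the theta function\<close>

definition bernoulli_num :: "nat \<Rightarrow> complex" where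
  "bernoulli_num r = fact r * fps_nth (fps_X / (fps_exp 1 - 1)) r"

definition divisor_sigma :: "nat \<Rightarrow> nat \<Rightarrow> nat" where
  "divisor_sigma s l = (\<Sum>d | d dvd l. d ^ s)"

text \<open>\<open>eisenstein k\<close> is the series of weight \<open>k = 2 j\<close>; then \<open>2 * k = 4 * j\<close>.\<close>

definition eisenstein :: "nat \<Rightarrow> complex \<Rightarrow> complex" where
  "eisenstein k \<tau> = 1 - of_nat (2 * k) / bernoulli_num k *
     (\<Sum>\<^sub>\<infinity>l\<in>{1..}. of_nat (divisor_sigma (k - 1) l) * exp (2 * of_real pi * \<i> * \<tau>) ^ l)"

definition jtheta :: "complex \<Rightarrow> complex \<Rightarrow> complex" where
  "jtheta z \<tau> = (\<Sum>\<^sub>\<infinity>n::int. let \<nu> = 1/2 + of_int n in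
     exp (of_real pi * \<i> * \<nu>^2 * \<tau> + 2 * of_real pi * \<i> * \<nu> * (z + 1/2)))"


section \<open>The function \<open>phi\<close> and its decomposition\<close>

definition phi :: "nat \<Rightarrow> complex \<Rightarrow> complex \<Rightarrow> complex" where
  "phi m z \<tau> = (jtheta (z + 1/2) \<tau> / jtheta z \<tau>) ^ m"

text \<open>
  \<open>Dcoeff m k\<close> is \<open>D\<^sub>k\<close>: the coefficient of \<open>(2 * pi * i * z)^(-k)\<close> (rather than of \<open>z^(-k)\<close>)
  in the Laurent expansion at 0.
\<close>

definition Dcoeff :: "nat \<Rightarrow> nat \<Rightarrow> complex \<Rightarrow> complex" where
  "Dcoeff m k \<tau> =
     (2 * of_real pi * \<i>) ^ k * fls_nth (laurent_expansion (\<lambda>z. phi m z \<tau>) 0) (- int k)"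

definition phiF :: "nat \<Rightarrow> complex \<Rightarrow> complex" where
  "phiF m \<tau> = Dcoeff m 0 \<tau> +
     (\<Sum>j=1..m div 2. bernoulli_num (2*j) / fact (2*j) * Dcoeff m (2*j) \<tau> * eisenstein (2*j) \<tau>)"

text \<open>The series converges only for \<open>0 < Im z < Im \<tau>\<close>.\<close>

definition phiP :: "nat \<Rightarrow> complex \<Rightarrow> complex \<Rightarrow> complex" where
  "phiP m z \<tau> = (\<Sum>j=1..m div 2. Dcoeff m (2*j) \<tau> / fact (2*j - 1) *
     (\<Sum>\<^sub>\<infinity>r\<in>UNIV - {0::int}. of_int r ^ (2*j - 1) / (1 - exp (2 * of_real pi * \<i> * \<tau>) powi r) *
        exp (2 * of_real pi * \<i> * z) powi r))"

definition phiF_hat :: "nat \<Rightarrow> complex \<Rightarrow> complex" where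
  "phiF_hat m \<tau> = phiF m \<tau> - Dcoeff m 2 \<tau> / of_real (4 * pi * Im \<tau>)"

definition phiP_hat :: "nat \<Rightarrow> complex \<Rightarrow> complex \<Rightarrow> complex" where
  "phiP_hat m z \<tau> = phiP m z \<tau> + Dcoeff m 2 \<tau> / of_real (4 * pi * Im \<tau>)"

text \<open>
  \<open>P\<close> is the meromorphic continuation in \<open>z\<close> of \<open>f\<close> from the strip \<open>0 < Im z < Im \<tau>\<close> to the whole
  plane, for every \<open>\<tau>\<close>. It is unique by the identity theorem: \<^const>\<open>nicely_meromorphic_on\<close> fixes the
  value 0 at poles and removes removable singularities.
\<close>

definition strip_continuation ::
    "(complex \<Rightarrow> complex \<Rightarrow> complex) \<Rightarrow> (complex \<Rightarrow> complex \<Rightarrow> complex) \<Rightarrow> bool" where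
  "strip_continuation f P \<longleftrightarrow>
     (\<forall>\<tau>\<in>upper_half_plane. (\<lambda>z. P z \<tau>) nicely_meromorphic_on UNIV \<and>
        (\<forall>z. 0 < Im z \<and> Im z < Im \<tau> \<longrightarrow> P z \<tau> = f z \<tau>))"

end

theory Submission
  imports Defs
begin

text \<open>
  All modular behaviour is extracted from theta itself. On the strip \<open>\<bar>Im z\<bar> < Im \<tau>\<close> an elliptic
  function without poles is constant, by the maximum principle. Comparing theta there with the product
  \<open>sin (\<pi> z) exp (-L(z))\<close>, which has the same quasi-periods, shows that its zeros are exactly the lattice
  points; comparing \<open>exp (-\<pi> i c z\<^sup>2 / (c\<tau> + d)) \<vartheta>(z / (c\<tau> + d); \<gamma>\<tau>)\<close> with theta gives the transformation
  law for every \<open>\<gamma>\<close> in \<open>SL\<^sub>2(\<int>)\<close>, up to a factor independent of \<open>z\<close> that cancels in \<open>\<phi>\<close>.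

  The function \<open>\<wp>(z) = - (\<vartheta>' / \<vartheta>)' / (2 \<pi> i)\<^sup>2\<close> is elliptic and satisfies
  \<open>\<wp>(z / (c\<tau> + d); \<gamma>\<tau>) = (c\<tau> + d)\<^sup>2 (\<wp>(z; \<tau>) - c / (2 \<pi> i (c\<tau> + d)))\<close>. Its even derivatives
  have the series \<open>\<Sum> r\<^sup>2\<^sup>j\<^sup>-\<^sup>1 \<zeta>\<^sup>r / (1 - q\<^sup>r)\<close> as Fourier expansions, and the Taylor coefficients of its regular
  part at \<open>0\<close> are the Eisenstein series; so the law for \<open>\<wp>\<close> contains the modularity of all \<open>E\<^sub>2\<^sub>j\<close> and the
  quasimodularity of \<open>E\<^sub>2\<close>, whose defect is what \<open>D\<^sub>2 / (4 \<pi> v)\<close> repairs. Subtracting from \<open>\<phi>\<close> the combination of these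
  derivatives with the same principal part leaves an elliptic function without poles, hence the
  constant \<open>\<phi>\<^sup>F\<close>.
\<close>

text \<open>The choice of strip shapes the proof: it contains a compact period parallelogram, its
  only lattice points are the integers, and the logarithm of the product converges on it. Its height
  2 Im \<tau> leaves room for both z and z + \<tau>, so each comparison of quasi-periods takes place
  there with the integers as sole possible singularities; the identity theorem or lattice
  translation then reaches the whole plane.

  Two constants have to be nonzero: the factor between theta and the product, which is why theta
  must first be shown not to vanish identically, and the Bernoulli numbers of even index, by which
  \<open>eisenstein\<close> divides.

  The cusp condition ranges over all of SL_2(Z), whereas \<phi> acquires a mere character only under
  \<Gamma>_0(2). For other \<gamma> the numerator becomes theta shifted by (c\<tau> + d)/2. No
  expansion at those cusps is computed: growth alone matters, and an upper bound for theta on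
  horizontal bands together with a lower bound on a fixed small circle is enough.\<close>

abbreviation tpi :: complex where
  "tpi \<equiv> 2 * of_real pi * \<i>"

section \<open>Termwise differentiation and sums over the integers\<close>

lemma
  fixes f :: "'a \<Rightarrow> complex \<Rightarrow> complex"
  assumes "open S" and hol: "\<And>i. i \<in> X \<Longrightarrow> f i holomorphic_on S"
    and bd: "\<And>i z. i \<in> X \<Longrightarrow> z \<in> S \<Longrightarrow> norm (f i z) \<le> M i" and M: "M summable_on X"
  shows holomorphic_on_infsum: "(\<lambda>z. \<Sum>\<^sub>\<infinity>i\<in>X. f i z) holomorphic_on S"
    and has_sum_higher_deriv:
      "z \<in> S \<Longrightarrow> ((\<lambda>i. (deriv ^^ m) (f i) z) has_sum (deriv ^^ m) (\<lambda>z. \<Sum>\<^sub>\<infinity>i\<in>X. f i z) z) X"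
proof -
  define g where "g = (\<lambda>z. \<Sum>\<^sub>\<infinity>i\<in>X. f i z)"
  \<comment> \<open>The limit runs over the finite subsets of the index set, so a single M-test
    serves sums over natural numbers and integers alike and gives unconditional sums.\<close>
  have ulim: "uniform_limit S (\<lambda>A z. \<Sum>i\<in>A. f i z) g (finite_subsets_at_top X)"
    unfolding g_def using bd M by (rule Weierstrass_m_test_general)
  have fin: "eventually (\<lambda>A. finite A \<and> A \<subseteq> X) (finite_subsets_at_top X)"
    by (simp add: eventually_finite_subsets_at_top_weakI)
  have hol': "eventually (\<lambda>A. (\<lambda>z. \<Sum>i\<in>A. f i z) holomorphic_on S) (finite_subsets_at_top X)"
    using fin by eventually_elim (auto intro!: holomorphic_intros hol)
  show "g holomorphic_on S"
  proof (subst holomorphic_on_open[OF \<open>open S\<close>], intro ballI)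
    fix z assume "z \<in> S"
    then obtain r where r: "r > 0" "cball z r \<subseteq> S"
      using \<open>open S\<close> open_contains_cball by blast
    have "uniform_limit (cball z r) (\<lambda>A z. \<Sum>i\<in>A. f i z) g (finite_subsets_at_top X)"
      using ulim r(2) uniform_limit_on_subset by blast
    moreover have "eventually (\<lambda>A. continuous_on (cball z r) (\<lambda>z. \<Sum>i\<in>A. f i z) \<and>
        (\<lambda>z. \<Sum>i\<in>A. f i z) holomorphic_on ball z r) (finite_subsets_at_top X)"
      using hol' by eventually_elim
        (use r ball_subset_cball in \<open>blast intro: holomorphic_on_imp_continuous_on holomorphic_on_subset\<close>)
    ultimately have "g holomorphic_on ball z r"
      using holomorphic_uniform_limit[of z r "\<lambda>A z. \<Sum>i\<in>A. f i z" "finite_subsets_at_top X" g]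
      by auto
    thus "\<exists>f'. (g has_field_derivative f') (at z)"
      using r holomorphic_derivI[of g "ball z r" z] by auto
  qed
  show "((\<lambda>i. (deriv ^^ m) (f i) z) has_sum (deriv ^^ m) g z) X" if z: "z \<in> S"
  proof -
    have "((\<lambda>A. (deriv ^^ m) (\<lambda>z. \<Sum>i\<in>A. f i z) z) \<longlongrightarrow> (deriv ^^ m) g z) (finite_subsets_at_top X)"
      by (rule higher_deriv_complex_uniform_limit[OF ulim hol' _ \<open>open S\<close> z]) auto
    moreover have "eventually (\<lambda>A. (deriv ^^ m) (\<lambda>z. \<Sum>i\<in>A. f i z) z = (\<Sum>i\<in>A. (deriv ^^ m) (f i) z))
        (finite_subsets_at_top X)"
      using fin
    proof eventually_elim
      case (elim A)
      hence "finite A" "A \<subseteq> X" by auto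
      thus ?case
      proof (induction A rule: finite_induct)
        case empty
        thus ?case by simp
      next
        case (insert a A)
        have "(deriv ^^ m) (\<lambda>z. f a z + (\<Sum>i\<in>A. f i z)) z =
            (deriv ^^ m) (f a) z + (deriv ^^ m) (\<lambda>z. \<Sum>i\<in>A. f i z) z"
          by (rule higher_deriv_add[OF _ _ \<open>open S\<close> z])
            (use insert.prems in \<open>auto intro!: holomorphic_intros hol\<close>)
        with insert show ?case by simp
      qed
    qed
    ultimately show ?thesis
      unfolding has_sum_def by (rule Lim_transform_eventually)
  qed
qed


lemma higher_deriv_exp_linear:
  "(deriv ^^ m) (\<lambda>z. exp (a + b * z)) z = b ^ m * exp (a + b * z :: complex)"
proof (induction m arbitrary: z)
  case (Suc m)
  have "(deriv ^^ m) (\<lambda>z. exp (a + b * z)) = (\<lambda>z. b ^ m * exp (a + b * z))"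
    using Suc by blast
  hence "(deriv ^^ Suc m) (\<lambda>z. exp (a + b * z)) z = deriv (\<lambda>z. b ^ m * exp (a + b * z)) z"
    by simp
  also have "\<dots> = b ^ Suc m * exp (a + b * z)"
    by (rule DERIV_imp_deriv) (auto intro!: derivative_eq_intros)
  finally show ?case .
qed auto


text \<open>Counting the negative integers as -1 - n matches \<nu> \<mapsto> -\<nu> for \<nu> = 1/2
  + n, so the two halves of the theta series become mirror images of each other.\<close>

lemma int_UNIV_split: "(UNIV :: int set) = range int \<union> range (\<lambda>n. -1 - int n)"
proof -
  have "x \<in> range int \<union> range (\<lambda>n. -1 - int n)" for x :: int
  proof (cases "x \<ge> 0")
    case True
    hence "x = int (nat x)" by simp
    thus ?thesis by blast
  next
    case False
    hence "x = -1 - int (nat (-1 - x))" by simp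
    thus ?thesis by blast
  qed
  thus ?thesis by blast
qed

lemma
  fixes f :: "int \<Rightarrow> 'a :: {topological_comm_monoid_add, t2_space}"
  assumes "(\<lambda>n::nat. f (int n)) summable_on UNIV" "(\<lambda>n::nat. f (-1 - int n)) summable_on UNIV"
  shows summable_on_int_split: "f summable_on UNIV"
    and infsum_int_split: "(\<Sum>\<^sub>\<infinity>n. f n) = (\<Sum>\<^sub>\<infinity>n. f (int n)) + (\<Sum>\<^sub>\<infinity>n. f (-1 - int n))"
proof -
  have inj: "inj int" "inj (\<lambda>n. -1 - int n)" by (auto simp: inj_def)
  have 1: "f summable_on range int" "f summable_on range (\<lambda>n. -1 - int n)"
    using assms by (simp_all add: summable_on_reindex inj o_def)
  have disj: "range int \<inter> range (\<lambda>n. -1 - int n) = {}" by auto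
  show "f summable_on UNIV"
    using summable_on_Un_disjoint[OF 1 disj] by (simp add: int_UNIV_split)
  show "(\<Sum>\<^sub>\<infinity>n. f n) = (\<Sum>\<^sub>\<infinity>n. f (int n)) + (\<Sum>\<^sub>\<infinity>n. f (-1 - int n))"
    using infsum_Un_disjoint[OF 1 disj] by (simp add: int_UNIV_split infsum_reindex inj o_def)
qed

text \<open>From y \<le> exp y at y = x/k, raised to the k-th power. This is how polynomial factors
  are absorbed into exponential decay below.\<close>

lemma power_le_exp_mult:
  assumes "x \<ge> (0::real)"
  shows "x ^ k \<le> of_nat k ^ k * exp x"
proof (cases "k = 0")
  case False
  have "(x / k) ^ k \<le> exp (x / k) ^ k"
    using assms order.trans[OF _ exp_ge_add_one_self[of "x / k"], of "x / k"]
    by (intro power_mono) auto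
  also have "\<dots> = exp x"
    using False by (simp flip: exp_of_nat_mult)
  finally show ?thesis using False by (simp add: power_divide field_simps)
qed (use assms in auto)

section \<open>The theta series\<close>

text \<open>The factor |\<nu>|^k comes from the k-th derivative in z. The rest bounds a theta term
  for all Im \<tau> \<ge> \<epsilon> and |Im z| \<le> B at once, so one majorant serves holomorphy
  in z as well as in \<tau>.\<close>

definition theta_maj :: "nat \<Rightarrow> real \<Rightarrow> real \<Rightarrow> int \<Rightarrow> real" where
  "theta_maj k \<epsilon> B n = \<bar>1/2 + of_int n\<bar> ^ k *
     exp (2 * pi * B * \<bar>1/2 + of_int n\<bar> - pi * \<epsilon> * (1/2 + of_int n)\<^sup>2)"

lemma theta_maj_summable:
  assumes "\<epsilon> > 0"
  shows "theta_maj k \<epsilon> B summable_on UNIV"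
proof -
  \<comment> \<open>The fraction is the maximum over x of (2 pi B + 2) x - pi \<epsilon> x^2. Of the
    added 2 x, one x absorbs the power x^k and the other leaves the decay exp (-x).\<close>
  define K where "K = real k ^ k * exp ((2 * pi * B + 2)\<^sup>2 / (4 * pi * \<epsilon>))"
  have bd: "theta_maj k \<epsilon> B n \<le> K * exp (-\<bar>1/2 + of_int n\<bar>)" for n
  proof -
    define x where "x = \<bar>1/2 + real_of_int n\<bar>"
    have x: "x \<ge> 0" "x\<^sup>2 = (1/2 + real_of_int n)\<^sup>2" by (auto simp: x_def)
    have "2 * pi * B * x - pi * \<epsilon> * x\<^sup>2 + 2 * x \<le> (2 * pi * B + 2)\<^sup>2 / (4 * pi * \<epsilon>)"
    proof -
      have "0 \<le> (2 * pi * \<epsilon> * x - (2 * pi * B + 2))\<^sup>2" by simp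
      also have "\<dots> = (2 * pi * B + 2)\<^sup>2 - (4 * pi * \<epsilon>) * (2 * pi * B * x - pi * \<epsilon> * x\<^sup>2 + 2 * x)"
        by (simp add: power2_eq_square algebra_simps)
      finally show ?thesis using assms by (simp add: field_simps)
    qed
    hence "exp (2 * pi * B * x - pi * \<epsilon> * x\<^sup>2) \<le> exp ((2 * pi * B + 2)\<^sup>2 / (4 * pi * \<epsilon>) - 2 * x)"
      by simp
    hence "x ^ k * exp (2 * pi * B * x - pi * \<epsilon> * x\<^sup>2) \<le>
        (real k ^ k * exp x) * exp ((2 * pi * B + 2)\<^sup>2 / (4 * pi * \<epsilon>) - 2 * x)"
      using power_le_exp_mult[OF x(1), of k] by (intro mult_mono) auto
    also have "\<dots> = K * exp (-x)"
      by (simp add: K_def mult_ac flip: exp_add)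
    finally show ?thesis
      using x by (simp add: theta_maj_def x_def[symmetric])
  qed
  have geo: "(\<lambda>n::nat. K * exp (-(real n + 1/2))) summable_on UNIV"
  proof -
    have "summable (\<lambda>n. exp (-1 :: real) ^ n)" by (intro summable_geometric) auto
    hence "(\<lambda>n. exp (-1 :: real) ^ n) summable_on UNIV"
      by (intro norm_summable_imp_summable_on) auto
    hence "(\<lambda>n. (K * exp (-1/2)) * exp (-1 :: real) ^ n) summable_on UNIV"
      by (rule summable_on_cmult_right)
    also have "(\<lambda>n. (K * exp (-1/2)) * exp (-1 :: real) ^ n) = (\<lambda>n::nat. K * exp (-(real n + 1/2)))"
      by (simp add: fun_eq_iff mult_ac flip: exp_of_nat_mult exp_add)
    finally show ?thesis .
  qed
  have "(\<lambda>n::int. K * exp (-\<bar>1/2 + real_of_int n\<bar>)) summable_on UNIV"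
    by (rule summable_on_int_split, rule summable_on_cong[THEN iffD1, OF _ geo], simp add: algebra_simps,
        rule summable_on_cong[THEN iffD1, OF _ geo], simp add: algebra_simps)
  thus ?thesis
    by (rule summable_on_comparison_test) (use bd in \<open>auto simp: theta_maj_def\<close>)
qed

definition theta_term :: "int \<Rightarrow> complex \<Rightarrow> complex \<Rightarrow> complex" where
  "theta_term n z \<tau> = exp (of_real pi * \<i> * (1/2 + of_int n)\<^sup>2 * \<tau> +
     tpi * (1/2 + of_int n) * (z + 1/2))"

lemma jtheta_altdef: "jtheta z \<tau> = (\<Sum>\<^sub>\<infinity>n. theta_term n z \<tau>)"
  by (simp add: jtheta_def theta_term_def Let_def)

lemma norm_theta_term:
  "norm (theta_term n z \<tau>) =
     exp (-pi * (1/2 + of_int n)\<^sup>2 * Im \<tau> - 2 * pi * (1/2 + of_int n) * Im z)"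
proof -
  define x where "x = 1/2 + real_of_int n"
  have x: "1/2 + of_int n = (of_real x :: complex)" by (simp add: x_def)
  have "of_real pi * \<i> * (of_real x)\<^sup>2 * \<tau> + tpi * of_real x * (z + 1/2) =
      \<i> * (of_real (pi * x\<^sup>2) * \<tau>) + \<i> * (of_real (2 * pi * x) * (z + 1/2))"
    by (simp add: algebra_simps)
  thus ?thesis
    unfolding theta_term_def norm_exp_eq_Re x x_def[symmetric] by simp
qed

lemma norm_theta_term_le:
  assumes "Im \<tau> \<ge> \<epsilon>" "\<bar>Im z\<bar> \<le> B"
  shows "\<bar>1/2 + of_int n\<bar> ^ k * norm (theta_term n z \<tau>) \<le> theta_maj k \<epsilon> B n"
proof -
  define x where "x = 1/2 + real_of_int n"
  have "x\<^sup>2 * \<epsilon> \<le> x\<^sup>2 * Im \<tau>" using assms by (intro mult_left_mono) auto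
  moreover have "- (x * Im z) \<le> \<bar>x\<bar> * B"
    using mult_left_mono[OF assms(2), of "\<bar>x\<bar>"] by (simp flip: abs_mult)
  ultimately have "0 \<le> pi * (x\<^sup>2 * Im \<tau> - x\<^sup>2 * \<epsilon>)" "0 \<le> 2 * pi * (\<bar>x\<bar> * B + x * Im z)"
    by (auto intro!: mult_nonneg_nonneg)
  moreover have "(2 * pi * B * \<bar>x\<bar> - pi * \<epsilon> * x\<^sup>2) - (-pi * x\<^sup>2 * Im \<tau> - 2 * pi * x * Im z) =
      pi * (x\<^sup>2 * Im \<tau> - x\<^sup>2 * \<epsilon>) + 2 * pi * (\<bar>x\<bar> * B + x * Im z)"
    by (simp add: algebra_simps)
  ultimately have "-pi * x\<^sup>2 * Im \<tau> - 2 * pi * x * Im z \<le> 2 * pi * B * \<bar>x\<bar> - pi * \<epsilon> * x\<^sup>2"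
    by linarith
  thus ?thesis
    unfolding theta_maj_def norm_theta_term x_def[symmetric] by (intro mult_left_mono) auto
qed

lemma theta_term_abs_summable:
  assumes "Im \<tau> > 0"
  shows "(\<lambda>n. norm (theta_term n z \<tau>)) summable_on UNIV"
  by (rule summable_on_comparison_test[OF theta_maj_summable[OF assms, of 0 "\<bar>Im z\<bar>"]])
    (use norm_theta_term_le[of "Im \<tau>" \<tau> z "\<bar>Im z\<bar>" _ 0] in auto)

lemma theta_term_summable: "Im \<tau> > 0 \<Longrightarrow> (\<lambda>n. theta_term n z \<tau>) summable_on UNIV"
  by (rule abs_summable_summable[OF theta_term_abs_summable])

lemma theta_term_as_exp:
  "(\<lambda>z. theta_term n z \<tau>) = (\<lambda>z. exp ((of_real pi * \<i> * (1/2 + of_int n)\<^sup>2 * \<tau> +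
     of_real pi * \<i> * (1/2 + of_int n)) + tpi * (1/2 + of_int n) * z))"
  by (rule ext) (simp add: theta_term_def algebra_simps)

lemma higher_deriv_theta_term:
  "(deriv ^^ k) (\<lambda>z. theta_term n z \<tau>) z = (tpi * (1/2 + of_int n)) ^ k * theta_term n z \<tau>"
  using fun_cong[OF theta_term_as_exp[of n \<tau>], of z]
  by (simp only: theta_term_as_exp higher_deriv_exp_linear)

lemma
  assumes "Im \<tau> > 0"
  shows jtheta_holomorphic: "(\<lambda>z. jtheta z \<tau>) holomorphic_on UNIV"
    and jtheta_higher_deriv: "((\<lambda>n. (tpi * (1/2 + of_int n)) ^ k * theta_term n z \<tau>) has_sum
          (deriv ^^ k) (\<lambda>z. jtheta z \<tau>) z) UNIV"
proof -
  define S where "S = (\<lambda>B::real. {z. Im z < B} \<inter> {z. Im z > -B})"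
  have S: "open (S B)" for B
    unfolding S_def by (intro open_Int open_halfspace_Im_lt open_halfspace_Im_gt)
  have bd: "norm (theta_term n z \<tau>) \<le> theta_maj 0 (Im \<tau>) B n" if "z \<in> S B" for n z B
    using norm_theta_term_le[of "Im \<tau>" \<tau> z B n 0] that by (auto simp: S_def)
  note maj = theta_maj_summable[OF assms, of 0]
  have hol: "(\<lambda>z. theta_term n z \<tau>) holomorphic_on S B" for n B
    unfolding theta_term_def by (intro holomorphic_intros)
  have zS: "z \<in> S (\<bar>Im z\<bar> + 1)" for z by (auto simp: S_def)
  show "(\<lambda>z. jtheta z \<tau>) holomorphic_on UNIV"
  proof (subst holomorphic_on_open[OF open_UNIV], intro ballI)
    fix z
    have "(\<lambda>z. jtheta z \<tau>) holomorphic_on S (\<bar>Im z\<bar> + 1)"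
      unfolding jtheta_altdef using holomorphic_on_infsum[OF S hol bd maj] by simp
    thus "\<exists>f'. ((\<lambda>z. jtheta z \<tau>) has_field_derivative f') (at z)"
      using holomorphic_derivI[OF _ S zS] by blast
  qed
  show "((\<lambda>n. (tpi * (1/2 + of_int n)) ^ k * theta_term n z \<tau>) has_sum
          (deriv ^^ k) (\<lambda>z. jtheta z \<tau>) z) UNIV"
    using has_sum_higher_deriv[OF S hol bd maj zS, where m = k]
    unfolding jtheta_altdef higher_deriv_theta_term by simp
qed

lemma holomorphic_on_upper_half_planeI:
  assumes "\<And>\<epsilon>. \<epsilon> > 0 \<Longrightarrow> f holomorphic_on {\<tau>. Im \<tau> > \<epsilon>}"
  shows "f holomorphic_on upper_half_plane"
proof -
  have "\<exists>f'. (f has_field_derivative f') (at \<tau>)" if "\<tau> \<in> upper_half_plane" for \<tau>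
  proof -
    have "Im \<tau> / 2 > 0" "\<tau> \<in> {\<sigma>. Im \<sigma> > Im \<tau> / 2}" using that by (auto simp: upper_half_plane_def)
    thus ?thesis using holomorphic_derivI[OF assms open_halfspace_Im_gt] by blast
  qed
  thus ?thesis by (auto simp: upper_half_plane_def holomorphic_on_open open_halfspace_Im_gt)
qed

text \<open>Holomorphy in \<tau> of the coefficients D_k rests on this: they are built algebraically
  from the Taylor coefficients of theta at 0 and 1/2, which are again dominated theta-like
  series.\<close>

lemma jtheta_taylor_holomorphic:
  "(\<lambda>\<tau>. (deriv ^^ k) (\<lambda>z. jtheta z \<tau>) z) holomorphic_on upper_half_plane"
proof -
  let ?t = "\<lambda>n \<tau>. (tpi * (1/2 + of_int n)) ^ k * theta_term n z \<tau>"
  have hol: "(\<lambda>\<tau>. \<Sum>\<^sub>\<infinity>n. ?t n \<tau>) holomorphic_on {\<tau>. Im \<tau> > \<epsilon>}" if "\<epsilon> > 0" for \<epsilon>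
  proof (rule holomorphic_on_infsum)
    show "(\<lambda>n. (2 * pi) ^ k * theta_maj k \<epsilon> \<bar>Im z\<bar> n) summable_on UNIV"
      by (intro summable_on_cmult_right theta_maj_summable that)
    fix n \<tau> assume "\<tau> \<in> {\<tau>. Im \<tau> > \<epsilon>}"
    hence "\<bar>1/2 + of_int n\<bar> ^ k * norm (theta_term n z \<tau>) \<le> theta_maj k \<epsilon> \<bar>Im z\<bar> n"
      by (intro norm_theta_term_le) auto
    hence "(2 * pi) ^ k * (\<bar>1/2 + of_int n\<bar> ^ k * norm (theta_term n z \<tau>)) \<le> (2 * pi) ^ k * theta_maj k \<epsilon> \<bar>Im z\<bar> n"
      by (intro mult_left_mono) auto
    moreover have "norm (?t n \<tau>) = (2 * pi) ^ k * (\<bar>1/2 + of_int n\<bar> ^ k * norm (theta_term n z \<tau>))"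
    proof -
      define x where "x = 1/2 + real_of_int n"
      have x: "1/2 + of_int n = (of_real x :: complex)" by (simp add: x_def)
      have "norm (tpi * of_real x) = 2 * pi * \<bar>x\<bar>"
        unfolding norm_mult by simp
      thus ?thesis unfolding x x_def[symmetric] norm_mult norm_power
        by (simp only: power_mult_distrib mult.assoc)
    qed
    ultimately show "norm (?t n \<tau>) \<le> (2 * pi) ^ k * theta_maj k \<epsilon> \<bar>Im z\<bar> n"
      by (simp only:)
  qed (auto simp: theta_term_def open_halfspace_Im_gt intro!: holomorphic_intros)
  define g where "g = (\<lambda>\<tau>. (deriv ^^ k) (\<lambda>z. jtheta z \<tau>) z)"
  have g: "infsum (\<lambda>n. ?t n \<tau>) UNIV = g \<tau>" if "Im \<tau> > 0" for \<tau>
    unfolding g_def by (rule infsumI[OF jtheta_higher_deriv[OF that, of k z]])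
  have hol_g: "g holomorphic_on {\<tau>. Im \<tau> > \<epsilon>}" if "\<epsilon> > 0" for \<epsilon>
    by (rule holomorphic_transform[OF hol[OF that]]) (use that in \<open>auto intro!: g\<close>)
  have "g holomorphic_on upper_half_plane"
    by (rule holomorphic_on_upper_half_planeI[OF hol_g])
  thus ?thesis by (simp only: g_def)
qed

section \<open>Quasi-periods, oddness and nonvanishing of theta\<close>

lemma exp_mult_of_int: "exp (x * of_int n) = exp (x :: complex) powi n"
proof (cases n)
  case (nonneg m)
  thus ?thesis by (simp add: exp_of_nat2_mult)
next
  case (neg m)
  have "exp (x * of_int n) = inverse (exp (x * of_nat (Suc m)))"
    unfolding neg by (simp only: of_int_minus of_int_of_nat_eq mult_minus_right exp_minus)
  also have "\<dots> = exp x powi n"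
    unfolding neg power_int_minus power_int_of_nat exp_of_nat2_mult ..
  finally show ?thesis .
qed

lemma exp_pi_i_int: "exp (of_real pi * \<i> * of_int n) = (-1) powi n"
  by (simp add: exp_mult_of_int)

lemma jtheta_lattice_shift:
  "jtheta (z + of_int l * \<tau> + of_int k) \<tau> =
     (-1) powi (l + k) * exp (-of_real pi * \<i> * (of_int l ^ 2 * \<tau> + 2 * of_int l * z)) * jtheta z \<tau>"
proof -
  define c where "c = (-1) powi (l + k) * exp (-of_real pi * \<i> * (of_int l ^ 2 * \<tau> + 2 * of_int l * z))"
  have "theta_term n (z + of_int l * \<tau> + of_int k) \<tau> = c * theta_term (n + l) z \<tau>" for n
  proof -
    \<comment> \<open>Completing the square turns \<nu> into \<nu> + l and leaves the phase exp (pi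
      i (2 n k + k - l)), whose value does not depend on n.\<close>
    have "even (l + k) \<longleftrightarrow> even (2 * n * k + k - l)" by auto
    hence "(-1 :: complex) powi (l + k) = (-1) powi (2 * n * k + k - l)"
      by (simp add: power_int_minus_left)
    also have "\<dots> = exp (of_real pi * \<i> * of_int (2 * n * k + k - l))"
      by (rule exp_pi_i_int[symmetric])
    finally show ?thesis
      unfolding c_def theta_term_def
      by (simp only: exp_add[symmetric]) (rule arg_cong[where f = exp],
          simp add: field_simps power2_eq_square)
  qed
  hence "jtheta (z + of_int l * \<tau> + of_int k) \<tau> = c * (\<Sum>\<^sub>\<infinity>n. theta_term (n + l) z \<tau>)"
    unfolding jtheta_altdef by (simp add: infsum_cmult_right')
  also have "(\<Sum>\<^sub>\<infinity>n. theta_term (n + l) z \<tau>) = jtheta z \<tau>"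
    unfolding jtheta_altdef
    by (rule infsum_reindex_bij_betw) (auto intro!: bij_betwI[of _ _ _ "\<lambda>n. n - l"])
  finally show ?thesis by (simp add: c_def)
qed

lemma jtheta_plus_1: "jtheta (z + 1) \<tau> = -jtheta z \<tau>"
  using jtheta_lattice_shift[of z 0 \<tau> 1] by simp

lemma jtheta_plus_tau:
  "jtheta (z + \<tau>) \<tau> = -exp (-of_real pi * \<i> * \<tau> - tpi * z) * jtheta z \<tau>"
  using jtheta_lattice_shift[of z 1 \<tau> 0] by (simp add: algebra_simps)

text \<open>The index -1 - n negates \<nu>, and the 1/2 added to z in the definition then
  contributes exp (-2 pi i \<nu>) = -1.\<close>

lemma theta_term_reflect: "theta_term (-1 - n) z \<tau> = -theta_term n (-z) \<tau>"
proof -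
  have "exp (of_real pi * \<i>) * exp (of_real pi * \<i> * of_int (2 * n)) = (-1 :: complex)"
    by (simp only: exp_pi_i_int) (simp add: power_int_mult)
  hence e: "exp (of_real pi * \<i> * of_int (2 * n + 1)) = (-1::complex)"
    by (simp add: algebra_simps exp_add)
  have "- theta_term n (-z) \<tau> = theta_term n (-z) \<tau> / exp (of_real pi * \<i> * of_int (2 * n + 1))"
    by (simp only: e) simp
  also have "\<dots> = theta_term (-1 - n) z \<tau>"
    unfolding theta_term_def exp_diff[symmetric]
    by (rule arg_cong[where f = exp]) (simp add: field_simps power2_eq_square)
  finally show ?thesis by simp
qed

lemma jtheta_minus: "jtheta (-z) \<tau> = -jtheta z \<tau>"
proof -
  have "jtheta z \<tau> = (\<Sum>\<^sub>\<infinity>n. theta_term (-1 - n) z \<tau>)"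
    unfolding jtheta_altdef
    by (rule infsum_reindex_bij_betw[symmetric]) (auto intro!: bij_betwI[of _ _ _ "\<lambda>n. -1 - n"])
  thus ?thesis
    by (simp add: theta_term_reflect infsum_uminus flip: jtheta_altdef)
qed

lemma jtheta_0 [simp]: "jtheta 0 \<tau> = 0"
  using jtheta_minus[of 0 \<tau>] by simp

lemma jtheta_nat_split:
  assumes "Im \<tau> > 0"
  shows "(\<lambda>n. theta_term (int n) z \<tau>) summable_on UNIV"
    and "jtheta z \<tau> = (\<Sum>\<^sub>\<infinity>n. theta_term (int n) z \<tau>) - (\<Sum>\<^sub>\<infinity>n. theta_term (int n) (-z) \<tau>)"
proof -
  have *: "(\<lambda>n. theta_term (int n) z \<tau>) summable_on UNIV" for z
    using summable_on_subset_banach[OF theta_term_summable[OF assms, of z], of "range int"]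
    by (simp add: summable_on_reindex inj_def o_def)
  show "(\<lambda>n. theta_term (int n) z \<tau>) summable_on UNIV" by (rule *)
  have "(\<lambda>n. theta_term (-1 - int n) z \<tau>) summable_on UNIV"
    unfolding theta_term_reflect using *[of "-z"] by (simp only: summable_on_uminus)
  from infsum_int_split[OF * this] show "jtheta z \<tau> = (\<Sum>\<^sub>\<infinity>n. theta_term (int n) z \<tau>) -
      (\<Sum>\<^sub>\<infinity>n. theta_term (int n) (-z) \<tau>)"
    by (simp add: jtheta_altdef theta_term_reflect infsum_uminus)
qed

text \<open>
  If theta vanished identically, its Laurent series in \<open>\<zeta> = exp (2 \<pi> i z)\<close> would express the entire part
  through the principal part, so the entire part would tend to \<open>0\<close> at infinity and vanish by Liouville.
\<close>

lemma jtheta_nontrivial: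
  assumes "Im \<tau> > 0"
  obtains z where "jtheta z \<tau> \<noteq> 0"
proof (rule ccontr)
  assume "\<not> thesis"
  hence zero: "jtheta z \<tau> = 0" for z using that by blast
  define a :: "nat \<Rightarrow> complex" where "a = (\<lambda>n. theta_term (int n) 0 \<tau>)"
  have term_eq: "theta_term (int n) z \<tau> = exp (of_real pi * \<i> * z) * (a n * exp (tpi * z) ^ n)" for n z
  proof -
    have "exp (tpi * z) ^ n = exp (tpi * z * of_nat n)"
      by (simp add: exp_of_nat2_mult)
    thus ?thesis
      unfolding a_def theta_term_def
      by (simp only: exp_add[symmetric]) (rule arg_cong[where f = exp], simp add: field_simps)
  qed
  have ex_log: "\<exists>z. exp (tpi * z) = \<zeta>" if "\<zeta> \<noteq> 0" for \<zeta>
    by (rule exI[of _ "Ln \<zeta> / (tpi)"]) (use that in auto)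
  have summ: "(\<lambda>n. a n * \<zeta> ^ n) summable_on UNIV" if nz: "\<zeta> \<noteq> 0" for \<zeta>
  proof -
    obtain z where z: "exp (tpi * z) = \<zeta>" using ex_log[OF nz] by blast
    have "(\<lambda>n. exp (of_real pi * \<i> * z) * (a n * \<zeta> ^ n)) summable_on UNIV"
      using jtheta_nat_split(1)[OF assms, of z] by (simp only: term_eq z)
    thus ?thesis by (subst (asm) summable_on_cmult_right') auto
  qed
  define F where "F = Abs_fps a"
  have conv: "fps_conv_radius F = \<infinity>"
  proof -
    have "conv_radius a \<ge> \<infinity>"
    proof (rule conv_radius_geI_ex')
      fix r :: real assume "r > 0"
      thus "summable (\<lambda>n. a n * of_real r ^ n)"
        by (intro summable_on_imp_summable summ) auto
    qed
    thus ?thesis by (simp add: F_def fps_conv_radius_def)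
  qed
  have eval: "eval_fps F \<zeta> = (\<Sum>\<^sub>\<infinity>n. a n * \<zeta> ^ n)" if "\<zeta> \<noteq> 0" for \<zeta>
    using has_sum_imp_sums[OF has_sum_infsum[OF summ[OF that]]]
    by (simp add: eval_fps_def F_def sums_iff)
  have hol: "eval_fps F holomorphic_on UNIV"
    by (intro holomorphic_intros) (simp add: conv)
  \<comment> \<open>With w a square root of \<zeta>, vanishing of theta reads w F(\<zeta>) =
    F(1/\<zeta>) / w. Here F is entire in \<zeta>, so the right-hand side controls F at
    infinity.\<close>
  have refl: "eval_fps F \<zeta> = eval_fps F (inverse \<zeta>) * inverse \<zeta>" if nz: "\<zeta> \<noteq> 0" for \<zeta>
  proof -
    obtain z where z: "exp (tpi * z) = \<zeta>" using ex_log[OF nz] by blast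
    have z': "exp (tpi * (-z)) = inverse \<zeta>"
      using z by (simp add: exp_minus)
    define w where "w = exp (of_real pi * \<i> * z)"
    have w: "w \<noteq> 0" "exp (of_real pi * \<i> * (-z)) = inverse w" "\<zeta> = w\<^sup>2"
      by (simp_all add: w_def exp_minus z[symmetric] mult_ac flip: exp_double)
    have "0 = jtheta z \<tau>" by (simp add: zero)
    also have "\<dots> = w * eval_fps F \<zeta> - inverse w * eval_fps F (inverse \<zeta>)"
      unfolding jtheta_nat_split(2)[OF assms] term_eq infsum_cmult_right' z z' w_def[symmetric] w(2)
      using nz by (simp add: eval)
    finally have *: "0 = w * eval_fps F \<zeta> - inverse w * eval_fps F (inverse \<zeta>)" .
    have "A = B * inverse (w\<^sup>2)" if "0 = w * A - inverse w * B" for A B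
    proof -
      have "A = inverse w * (w * A)" using w(1) by simp
      also have "w * A = inverse w * B" using that by simp
      finally show ?thesis by (simp add: power2_eq_square)
    qed
    from this[OF *] show ?thesis unfolding w(3) .
  qed
  have "(eval_fps F \<longlongrightarrow> 0) at_infinity"
  proof (rule Lim_transform_eventually)
    have "isCont (eval_fps F) 0"
      using hol holomorphic_on_imp_continuous_on continuous_on_eq_continuous_at by blast
    hence "((\<lambda>\<zeta>. eval_fps F (inverse \<zeta>)) \<longlongrightarrow> eval_fps F 0) at_infinity"
      using isCont_tendsto_compose tendsto_inverse_0 by blast
    from tendsto_mult[OF this tendsto_inverse_0]
    show "((\<lambda>\<zeta>. eval_fps F (inverse \<zeta>) * inverse \<zeta>) \<longlongrightarrow> 0) at_infinity" by simp
    show "\<forall>\<^sub>F \<zeta> in at_infinity. eval_fps F (inverse \<zeta>) * inverse \<zeta> = eval_fps F \<zeta>"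
      using eventually_not_equal_at_infinity[of 0] by eventually_elim (rule refl[symmetric])
  qed
  hence "eval_fps F 0 = 0" by (rule Liouville_weak_0[OF hol])
  hence "a 0 = 0" by (simp add: eval_fps_at_0 F_def)
  thus False by (simp add: a_def theta_term_def)
qed

section \<open>Elliptic functions on a strip\<close>

definition strip :: "complex \<Rightarrow> complex set" where
  "strip \<tau> = {z. \<bar>Im z\<bar> < Im \<tau>}"

lemma strip_altdef: "strip \<tau> = {z. Im z < Im \<tau>} \<inter> {z. Im z > -Im \<tau>}"
  by (auto simp: strip_def)

lemma open_strip [simp]: "open (strip \<tau>)"
  unfolding strip_altdef by (intro open_Int open_halfspace_Im_lt open_halfspace_Im_gt)

lemma connected_strip: "connected (strip \<tau>)"
  unfolding strip_altdef
  by (intro convex_connected convex_Int convex_halfspace_Im_lt convex_halfspace_Im_gt)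

lemma open_strip_minus_Ints [simp]: "open (strip \<tau> - \<int>)"
  by (intro open_Diff open_strip closed_Ints)

lemma periodic_of_int:
  assumes "\<And>z. z \<in> A \<Longrightarrow> z + 1 \<in> A \<and> z - 1 \<in> A \<and> f (z + 1) = f (z :: complex)" "z \<in> A"
  shows "z + of_int n \<in> A \<and> f (z + of_int n) = f z"
proof (induction n rule: int_induct[of _ 0])
  case base
  show ?case using assms by simp
next
  case (step1 i)
  with assms(1)[of "z + of_int i"] show ?case by (simp add: add_ac)
next
  case (step2 i)
  hence *: "z + of_int i \<in> A" "f (z + of_int i) = f z" by auto
  from assms(1)[OF *(1)] have "z + of_int (i - 1) \<in> A" by (simp add: algebra_simps)
  moreover from assms(1)[OF this] have "f (z + of_int i) = f (z + of_int (i - 1))"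
    by (simp add: algebra_simps)
  ultimately show ?case using * by simp
qed

text \<open>The parallelogram K of points s + t \<tau> with 0 \<le> s \<le> 1 and |t| \<le> 1/2 is
  compact and lies in the open strip. An integer shift and at most one shift by \<plusminus>\<tau>
  bring any point of the strip into K, so the maximum of |h| over K is attained at an interior point
  of the strip and is global there.\<close>

lemma elliptic_on_strip_constant:
  assumes \<tau>: "Im \<tau> > 0" and hol: "h holomorphic_on strip \<tau>"
    and per1: "\<And>z. z \<in> strip \<tau> \<Longrightarrow> h (z + 1) = h z"
    and per\<tau>: "\<And>z. z \<in> strip \<tau> \<Longrightarrow> z + \<tau> \<in> strip \<tau> \<Longrightarrow> h (z + \<tau>) = h z"
  shows "h constant_on strip \<tau>"
proof -
  define p where "p = (\<lambda>(s::real, t::real). of_real s + of_real t * \<tau>)"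
  define K where "K = p ` ({0..1} \<times> {-1/2..1/2})"
  have "compact K"
    unfolding K_def p_def case_prod_unfold
    by (intro compact_continuous_image continuous_intros compact_Times) auto
  have Im_p: "Im (p (s, t)) = t * Im \<tau>" for s t by (simp add: p_def)
  have sub: "K \<subseteq> strip \<tau>"
  proof
    fix z assume "z \<in> K"
    then obtain s t where st: "z = p (s, t)" "\<bar>t\<bar> \<le> 1/2"
      by (auto simp: K_def)
    have "\<bar>Im z\<bar> = \<bar>t\<bar> * Im \<tau>" using \<tau> by (simp add: st Im_p abs_mult)
    also have "\<dots> \<le> 1/2 * Im \<tau>" using \<tau> st by (intro mult_right_mono) auto
    also have "\<dots> < Im \<tau>" using \<tau> by simp
    finally show "z \<in> strip \<tau>" by (simp add: strip_def)
  qed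
  have K_eq: "z \<in> K" if "0 \<le> Re z - Im z / Im \<tau> * Re \<tau>" "Re z - Im z / Im \<tau> * Re \<tau> \<le> 1"
      "\<bar>Im z\<bar> \<le> Im \<tau> / 2" for z
  proof -
    have "z = p (Re z - Im z / Im \<tau> * Re \<tau>, Im z / Im \<tau>)"
      using \<tau> by (simp add: p_def complex_eq_iff)
    moreover have "Im z / Im \<tau> \<in> {-1/2..1/2}" using that(3) \<tau> by (auto simp: field_simps)
    ultimately show ?thesis using that unfolding K_def by (intro image_eqI) auto
  qed
  have "K \<noteq> {}" unfolding K_def by auto
  moreover have "continuous_on K (\<lambda>z. norm (h z))"
    using hol sub by (intro continuous_on_norm) (meson holomorphic_on_imp_continuous_on continuous_on_subset)
  ultimately obtain \<xi> where \<xi>: "\<xi> \<in> K" "\<And>z. z \<in> K \<Longrightarrow> norm (h z) \<le> norm (h \<xi>)"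
    using continuous_attains_sup[OF \<open>compact K\<close>] by blast
  have int: "z + of_int n \<in> strip \<tau> \<and> h (z + of_int n) = h z" if "z \<in> strip \<tau>" for z n
    by (rule periodic_of_int[of "strip \<tau>"]) (use per1 that in \<open>auto simp: strip_def\<close>)
  have half: "norm (h z) \<le> norm (h \<xi>)" if z: "\<bar>Im z\<bar> \<le> Im \<tau> / 2" for z
  proof -
    define x where "x = Re z - Im z / Im \<tau> * Re \<tau>"
    have "z \<in> strip \<tau>" using z \<tau> by (simp add: strip_def)
    from int[OF this, of "-\<lfloor>x\<rfloor>"] have "h z = h (z - of_int \<lfloor>x\<rfloor>)" by simp
    moreover have "z - of_int \<lfloor>x\<rfloor> \<in> K"
      by (rule K_eq) (use z in \<open>simp_all add: x_def, linarith+\<close>)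
    ultimately show ?thesis using \<xi>(2) by simp
  qed
  have all: "norm (h z) \<le> norm (h \<xi>)" if z: "z \<in> strip \<tau>" for z
  proof -
    consider "\<bar>Im z\<bar> \<le> Im \<tau> / 2" | "Im z > Im \<tau> / 2" | "Im z < -Im \<tau> / 2" by linarith
    thus ?thesis
    proof cases
      case 1
      thus ?thesis by (rule half)
    next
      case 2
      hence "z - \<tau> \<in> strip \<tau>" "\<bar>Im (z - \<tau>)\<bar> \<le> Im \<tau> / 2" using z by (auto simp: strip_def)
      thus ?thesis using half[of "z - \<tau>"] per\<tau>[of "z - \<tau>"] z by simp
    next
      case 3
      hence "z + \<tau> \<in> strip \<tau>" "\<bar>Im (z + \<tau>)\<bar> \<le> Im \<tau> / 2" using z by (auto simp: strip_def)
      thus ?thesis using half[of "z + \<tau>"] per\<tau>[of z] z by simp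
    qed
  qed
  show ?thesis
    by (rule maximum_modulus_principle[OF hol open_strip connected_strip open_strip order_refl])
      (use \<xi>(1) sub all in auto)
qed

lemma punctured_ball_subset_strip:
  assumes "w \<in> \<int>" "r \<le> 1" "r \<le> Im \<tau>"
  shows "ball w r - {w} \<subseteq> strip \<tau> - \<int>"
proof
  fix x assume x: "x \<in> ball w r - {w}"
  obtain n where n: "w = of_int n" using \<open>w \<in> \<int>\<close> by (auto elim: Ints_cases)
  have d: "dist w x < 1" "dist w x < Im \<tau>" using x assms by auto
  have "\<bar>Im (x - w)\<bar> < Im \<tau>"
    using abs_Im_le_cmod[of "x - w"] d by (simp add: dist_norm norm_minus_commute)
  hence "x \<in> strip \<tau>" by (simp add: strip_def n)
  moreover have "x \<notin> \<int>"
  proof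
    assume "x \<in> \<int>"
    then obtain k where k: "x = of_int k" by (auto elim: Ints_cases)
    hence "\<bar>real_of_int (n - k)\<bar> < 1" using d(1)
      by (simp add: n dist_norm flip: of_int_diff)
    hence "n = k" by linarith
    thus False using x k n by simp
  qed
  ultimately show "x \<in> strip \<tau> - \<int>" by simp
qed

text \<open>Periodicity copies the limit at 0 to every integer, so extending g by l gives a
  continuous function, which has no isolated singularities. The constant is thereby identified as
  the limit at 0.\<close>

lemma elliptic_removable_constant:
  assumes \<tau>: "Im \<tau> > 0" and ana: "g holomorphic_on strip \<tau> - \<int>" and lim: "g \<midarrow>0\<rightarrow> l"
    and per1: "\<And>z. z \<in> strip \<tau> - \<int> \<Longrightarrow> g (z + 1) = g z"
    and per\<tau>: "\<And>z. z \<in> strip \<tau> - \<int> \<Longrightarrow> z + \<tau> \<in> strip \<tau> - \<int> \<Longrightarrow> g (z + \<tau>) = g z"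
    and z: "z \<in> strip \<tau> - \<int>"
  shows "g z = l"
proof -
  let ?S = "strip \<tau>"
  define h where "h = (\<lambda>z. if z \<in> \<int> then l else g z)"
  have int_shift: "w + of_int n \<in> strip \<tau> - \<int> \<and> g (w + of_int n) = g w" if "w \<in> strip \<tau> - \<int>" for w n
    by (rule periodic_of_int[of "strip \<tau> - \<int>"]) (use per1 that in \<open>auto simp: strip_def\<close>)
  have holh': "h holomorphic_on ?S - \<int>"
    by (rule holomorphic_transform[OF ana]) (auto simp: h_def)
  have cont: "isCont h w" if "w \<in> \<int>" for w
  proof -
    obtain n where n: "w = of_int n" using \<open>w \<in> \<int>\<close> by (auto elim: Ints_cases)
    define B where "B = ball w (min 1 (Im \<tau>))"
    have B: "x \<in> ?S - \<int>" if "x \<in> B - {w}" for x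
      using punctured_ball_subset_strip[OF \<open>w \<in> \<int>\<close>, of "min 1 (Im \<tau>)" \<tau>] that by (auto simp: B_def)
    have ev: "eventually (\<lambda>x. x \<in> B - {w}) (at w)"
      using \<tau> by (intro eventually_at_in_open) (auto simp: B_def)
    have "(\<lambda>x. g (x - of_int n)) \<midarrow>w\<rightarrow> l"
      using lim unfolding n by (subst LIM_offset_zero_iff) auto
    moreover have "eventually (\<lambda>x. g (x - of_int n) = h x) (at w)"
      using ev
    proof eventually_elim
      case (elim x)
      from int_shift[OF B[OF elim], of "-n"] B[OF elim] show ?case by (simp add: h_def)
    qed
    ultimately have "h \<midarrow>w\<rightarrow> l" by (rule Lim_transform_eventually)
    thus ?thesis using \<open>w \<in> \<int>\<close> by (simp add: isCont_def h_def)
  qed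
  have holh: "h holomorphic_on ?S"
  proof -
    have isol: "h holomorphic_on ball w r" if "w \<in> \<int>" "r \<le> 1" "r \<le> Im \<tau>" "r > 0" for w r
    proof -
      have *: "ball w r - {w} \<subseteq> ?S - \<int>"
        by (rule punctured_ball_subset_strip) (use that in auto)
      show ?thesis
      proof (rule no_isolated_singularity)
        show "h holomorphic_on ball w r - {w}"
          by (rule holomorphic_on_subset[OF holh' *])
        have "isCont h x" if "x \<in> ball w r" for x
        proof (cases "x = w")
          case False
          hence "x \<in> ?S - \<int>" using * that by auto
          thus ?thesis
            using holh' open_strip_minus_Ints holomorphic_on_imp_continuous_on
              continuous_on_eq_continuous_at by blast
        qed (use cont \<open>w \<in> \<int>\<close> in auto)
        thus "continuous_on (ball w r) h" by (simp add: continuous_at_imp_continuous_on)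
      qed auto
    qed
    show ?thesis
    proof (subst holomorphic_on_open[OF open_strip], intro ballI)
      fix w assume w: "w \<in> ?S"
      show "\<exists>h'. (h has_field_derivative h') (at w)"
      proof (cases "w \<in> \<int>")
        case True
        from isol[OF this, of "min 1 (Im \<tau>)"] \<tau> show ?thesis
          using holomorphic_derivI[of h "ball w (min 1 (Im \<tau>))" w] by auto
      next
        case False
        thus ?thesis using holomorphic_derivI[OF holh' open_strip_minus_Ints] w by blast
      qed
    qed
  qed
  have "h constant_on ?S"
  proof (rule elliptic_on_strip_constant[OF \<tau> holh])
    fix z assume "z \<in> ?S"
    thus "h (z + 1) = h z" using per1[of z] by (auto simp: h_def)
  next
    fix z assume "z \<in> ?S" "z + \<tau> \<in> ?S"
    \<comment> \<open>If z and z + \<tau> both lie in the strip, then -Im \<tau> < Im z < 0, so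
      neither is real and the values inserted at integers do not enter.\<close>
    moreover have "Im w = 0" if "w \<in> \<int>" for w using that by (auto elim!: Ints_cases)
    hence "z \<notin> \<int>" "z + \<tau> \<notin> \<int>"
      using \<open>z \<in> ?S\<close> \<open>z + \<tau> \<in> ?S\<close> \<tau> by (fastforce simp: strip_def)+
    ultimately show "h (z + \<tau>) = h z" using per\<tau>[of z] by (auto simp: h_def)
  qed
  then obtain c where c: "\<And>z. z \<in> ?S \<Longrightarrow> h z = c" by (auto simp: constant_on_def)
  have "0 \<in> ?S" using \<tau> by (simp add: strip_def)
  thus ?thesis using c[of 0] c[of z] z by (simp add: h_def)
qed

section \<open>The product formula\<close>

lemma norm_exp_2pi: "norm (exp (tpi * z)) = exp (-2 * pi * Im z)"
  by (simp add: norm_exp_eq_Re)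

lemma exp_2pi_of_nat: "exp (tpi * of_nat r * z) = exp (tpi * z) ^ r"
  by (simp add: exp_of_nat_mult[symmetric] mult_ac)

definition lambert_coeff :: "nat \<Rightarrow> complex \<Rightarrow> complex" where
  "lambert_coeff r \<tau> = exp (tpi * \<tau>) ^ r / (of_nat r * (1 - exp (tpi * \<tau>) ^ r))"

definition theta_log_term :: "nat \<Rightarrow> complex \<Rightarrow> complex \<Rightarrow> complex" where
  "theta_log_term r z \<tau> = lambert_coeff r \<tau> *
     (exp (tpi * of_nat r * z) + exp (-(tpi * of_nat r) * z))"

text \<open>
  Minus the logarithm of the product of \<open>(1 - q\<^sup>n \<zeta>) (1 - q\<^sup>n / \<zeta>)\<close> over \<open>n \<ge> 1\<close>, with both logarithms
  expanded and the sum over \<open>n\<close> carried out. The term for \<open>r = 0\<close> is \<open>0\<close> because of division by zero.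
\<close>

definition theta_log :: "complex \<Rightarrow> complex \<Rightarrow> complex" where
  "theta_log z \<tau> = (\<Sum>\<^sub>\<infinity>r. theta_log_term r z \<tau>)"

lemma norm_q_less_1: "Im \<tau> > 0 \<Longrightarrow> norm (exp (tpi * \<tau>)) < 1"
  by (simp add: norm_exp_2pi)

lemma norm_one_minus_q_power:
  assumes "norm (q :: complex) < 1" "r > 0"
  shows "1 - norm q \<le> norm (1 - q ^ r)"
proof -
  have "norm (q ^ r) \<le> norm q ^ 1"
    unfolding norm_power by (rule power_decreasing) (use assms in auto)
  thus ?thesis using norm_triangle_ineq2[of 1 "q ^ r"] by simp
qed

lemma norm_lambert_coeff:
  assumes "Im \<tau> > 0"
  shows "norm (lambert_coeff r \<tau>) \<le>
    norm (exp (tpi * \<tau>)) ^ r / (1 - norm (exp (tpi * \<tau>)))"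
proof (cases "r = 0")
  case True
  thus ?thesis using norm_q_less_1[OF assms] by (simp add: lambert_coeff_def)
next
  case False
  define q where "q = exp (tpi * \<tau>)"
  have q: "norm q < 1" using norm_q_less_1[OF assms] by (simp add: q_def)
  have "1 * (1 - norm q) \<le> real r * norm (1 - q ^ r)"
    using norm_one_minus_q_power[OF q, of r] False q by (intro mult_mono) auto
  hence "norm q ^ r / (real r * norm (1 - q ^ r)) \<le> norm q ^ r / (1 - norm q)"
    using q by (intro divide_left_mono) auto
  thus ?thesis unfolding lambert_coeff_def q_def[symmetric]
    by (simp add: norm_divide norm_mult norm_power)
qed

text \<open>The ratio is |q| exp (2 pi B), which is below 1 precisely for B < Im \<tau>; this fixes
  the height of the strip.\<close>

lemma norm_theta_log_term:
  assumes "Im \<tau> > 0" "\<bar>Im z\<bar> \<le> B"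
  shows "norm (theta_log_term r z \<tau>) \<le>
    2 / (1 - exp (-2 * pi * Im \<tau>)) * exp (-2 * pi * (Im \<tau> - B)) ^ r"
proof -
  define q where "q = exp (tpi * \<tau>)"
  have nq: "norm q = exp (-2 * pi * Im \<tau>)" by (simp add: q_def norm_exp_2pi)
  have "pi * (-Im z) \<le> pi * B" "pi * Im z \<le> pi * B"
    using assms(2) by (intro mult_left_mono; simp)+
  hence h: "exp (-2 * pi * Im z) \<le> exp (2 * pi * B)" "exp (-2 * pi * Im (-z)) \<le> exp (2 * pi * B)"
    by (simp_all add: algebra_simps)
  have 1: "norm (exp (tpi * of_nat r * z)) \<le> exp (2 * pi * B) ^ r"
    unfolding exp_2pi_of_nat norm_power norm_exp_2pi by (intro power_mono h) auto
  have "exp (-(tpi * of_nat r) * z) = exp (tpi * of_nat r * (-z))"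
    by simp
  hence 2: "norm (exp (-(tpi * of_nat r) * z)) \<le> exp (2 * pi * B) ^ r"
    by (simp only: exp_2pi_of_nat norm_power norm_exp_2pi) (intro power_mono h exp_ge_zero)
  have "norm (theta_log_term r z \<tau>) \<le> (norm q ^ r / (1 - norm q)) * (exp (2 * pi * B) ^ r + exp (2 * pi * B) ^ r)"
    unfolding theta_log_term_def norm_mult q_def
    using norm_triangle_mono[OF 1 2] norm_lambert_coeff[OF assms(1), of r] norm_q_less_1[OF assms(1)]
    by (intro mult_mono) auto
  also have "\<dots> = 2 / (1 - exp (-2 * pi * Im \<tau>)) * (norm q ^ r * exp (2 * pi * B) ^ r)"
    by (simp add: nq)
  also have "norm q ^ r * exp (2 * pi * B) ^ r = exp (-2 * pi * (Im \<tau> - B)) ^ r"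
    unfolding nq by (simp add: algebra_simps flip: power_mult_distrib exp_add)
  finally show ?thesis .
qed

lemma summable_on_geometric:
  assumes "norm (x :: real) < 1"
  shows "(\<lambda>n::nat. c * x ^ n) summable_on UNIV"
proof (intro summable_on_cmult_right norm_summable_imp_summable_on)
  show "summable (\<lambda>n. norm (x ^ n))"
    unfolding norm_power using assms by (intro summable_geometric) simp
qed

lemma theta_log_term_summable:
  assumes "Im \<tau> > 0" "z \<in> strip \<tau>"
  shows "(\<lambda>r. theta_log_term r z \<tau>) summable_on UNIV"
proof (rule abs_summable_summable, rule summable_on_comparison_test)
  show "(\<lambda>r::nat. 2 / (1 - exp (-2 * pi * Im \<tau>)) * exp (-2 * pi * (Im \<tau> - \<bar>Im z\<bar>)) ^ r) summable_on UNIV"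
    using assms by (intro summable_on_geometric) (simp add: strip_def)
qed (use assms norm_theta_log_term[of \<tau> z "\<bar>Im z\<bar>"] in auto)

lemma higher_deriv_theta_log_term:
  "(deriv ^^ m) (\<lambda>z. theta_log_term r z \<tau>) z = lambert_coeff r \<tau> *
     ((tpi * of_nat r) ^ m * exp (tpi * of_nat r * z) +
      (-(tpi * of_nat r)) ^ m * exp (-(tpi * of_nat r) * z))"
proof -
  have e: "(deriv ^^ m) (\<lambda>z. exp (b * z)) z = b ^ m * exp (b * z)" for b :: complex
    using higher_deriv_exp_linear[of m 0 b z] by simp
  have "(deriv ^^ m) (\<lambda>z. theta_log_term r z \<tau>) z = lambert_coeff r \<tau> *
    (deriv ^^ m) (\<lambda>z. exp (tpi * of_nat r * z) + exp (-(tpi * of_nat r) * z)) z"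
    unfolding theta_log_term_def
    by (rule higher_deriv_cmult[where A = UNIV]) (auto intro!: holomorphic_intros)
  also have "(deriv ^^ m) (\<lambda>z. exp (tpi * of_nat r * z) + exp (-(tpi * of_nat r) * z)) z =
      (deriv ^^ m) (\<lambda>z. exp (tpi * of_nat r * z)) z +
      (deriv ^^ m) (\<lambda>z. exp (-(tpi * of_nat r) * z)) z"
    by (rule higher_deriv_add[OF _ _ open_UNIV]) (auto intro!: holomorphic_intros)
  finally show ?thesis by (simp only: e)
qed

lemma
  assumes "Im \<tau> > 0"
  shows theta_log_holomorphic: "(\<lambda>z. theta_log z \<tau>) holomorphic_on strip \<tau>"
    and theta_log_higher_deriv: "z \<in> strip \<tau> \<Longrightarrow> ((\<lambda>r. lambert_coeff r \<tau> *
     ((tpi * of_nat r) ^ m * exp (tpi * of_nat r * z) +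
      (-(tpi * of_nat r)) ^ m * exp (-(tpi * of_nat r) * z)))
     has_sum (deriv ^^ m) (\<lambda>z. theta_log z \<tau>) z) UNIV"
proof -
  define S where "S = (\<lambda>B::real. {z. Im z < B} \<inter> {z. Im z > -B})"
  have S: "open (S B)" for B
    unfolding S_def by (intro open_Int open_halfspace_Im_lt open_halfspace_Im_gt)
  have bd: "norm (theta_log_term r z \<tau>) \<le> 2 / (1 - exp (-2 * pi * Im \<tau>)) * exp (-2 * pi * (Im \<tau> - B)) ^ r"
    if "z \<in> S B" for r z B
    by (rule norm_theta_log_term[OF assms]) (use that in \<open>auto simp: S_def\<close>)
  have summ: "(\<lambda>r::nat. 2 / (1 - exp (-2 * pi * Im \<tau>)) * exp (-2 * pi * (Im \<tau> - B)) ^ r) summable_on UNIV"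
    if "B < Im \<tau>" for B
    using that by (intro summable_on_geometric) simp
  have hol: "(\<lambda>z. theta_log_term r z \<tau>) holomorphic_on S B" for r B
    unfolding theta_log_term_def by (intro holomorphic_intros)
  have ex: "\<exists>B. B < Im \<tau> \<and> z \<in> S B" if "z \<in> strip \<tau>" for z
  proof -
    have "\<bar>Im z\<bar> < Im \<tau>" using that by (simp add: strip_def)
    then obtain B where "\<bar>Im z\<bar> < B" "B < Im \<tau>" using dense by blast
    thus ?thesis by (auto simp: S_def abs_less_iff intro!: exI[of _ B])
  qed
  show "(\<lambda>z. theta_log z \<tau>) holomorphic_on strip \<tau>"
  proof (subst holomorphic_on_open[OF open_strip], intro ballI)
    fix z assume "z \<in> strip \<tau>"
    then obtain B where B: "B < Im \<tau>" "z \<in> S B" using ex by blast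
    have "(\<lambda>z. theta_log z \<tau>) holomorphic_on S B"
      unfolding theta_log_def using holomorphic_on_infsum[OF S hol bd summ[OF B(1)]] by simp
    thus "\<exists>f'. ((\<lambda>z. theta_log z \<tau>) has_field_derivative f') (at z)"
      using holomorphic_derivI[OF _ S B(2)] by blast
  qed
  assume "z \<in> strip \<tau>"
  then obtain B where B: "B < Im \<tau>" "z \<in> S B" using ex by blast
  show "((\<lambda>r. lambert_coeff r \<tau> *
     ((tpi * of_nat r) ^ m * exp (tpi * of_nat r * z) +
      (-(tpi * of_nat r)) ^ m * exp (-(tpi * of_nat r) * z)))
     has_sum (deriv ^^ m) (\<lambda>z. theta_log z \<tau>) z) UNIV"
    using has_sum_higher_deriv[OF S hol bd summ[OF B(1)] B(2), where m = m]
    unfolding higher_deriv_theta_log_term theta_log_def by simp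
qed

lemma theta_log_plus_1: "theta_log (z + 1) \<tau> = theta_log z \<tau>"
proof -
  have e: "exp (tpi * of_nat r) = (1 :: complex)" for r :: nat
    using exp_2pi_of_nat[of r 1] by (simp add: exp_eq_1)
  have "exp (tpi * of_nat r * (z + 1)) = exp (tpi * of_nat r * z) \<and>
      exp (-(tpi * of_nat r) * (z + 1)) = exp (-(tpi * of_nat r) * z)" for r
    using e[of r] by (simp add: ring_distribs exp_add exp_diff exp_minus)
  hence "theta_log_term r (z + 1) \<tau> = theta_log_term r z \<tau>" for r
    unfolding theta_log_term_def by simp
  thus ?thesis by (simp add: theta_log_def)
qed

text \<open>Under z \<mapsto> z + \<tau> the infinite product telescopes. In each term the factor 1
  - q^r cancels the denominator of \<open>lambert_coeff\<close>, leaving the logarithmic series of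
  1/\<zeta> and q \<zeta>. Both converge because the two hypotheses on z force -Im \<tau> < Im z <
  0, hence |1/\<zeta>| < 1 and |q \<zeta>| < 1.\<close>

lemma exp_theta_log_plus_tau:
  assumes \<tau>: "Im \<tau> > 0" and z: "z \<in> strip \<tau>" "z + \<tau> \<in> strip \<tau>"
  shows "exp (theta_log (z + \<tau>) \<tau> - theta_log z \<tau>) =
    (1 - exp (tpi * (z + \<tau>))) / (1 - exp (-2 * of_real pi * \<i> * z))"
    and "exp (tpi * (z + \<tau>)) \<noteq> 1"
proof -
  define q where "q = exp (tpi * \<tau>)"
  define x where "x = exp (tpi * z)"
  have x: "x \<noteq> 0" "q \<noteq> 0" by (simp_all add: x_def q_def)
  have qx: "exp (tpi * (z + \<tau>)) = q * x"
    by (simp add: q_def x_def algebra_simps exp_add)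
  have ix: "exp (-2 * of_real pi * \<i> * z) = inverse x" by (simp add: x_def exp_minus)
  have n1: "norm (q * x) < 1"
    unfolding qx[symmetric] norm_exp_2pi using z by (simp add: strip_def)
  have n2: "norm (inverse x) < 1"
  proof -
    have "Im z < 0" using z by (simp add: strip_def)
    hence "norm (exp (tpi * (-z))) < 1"
      unfolding norm_exp_2pi by (simp add: mult_pos_neg)
    thus ?thesis by (simp add: x_def exp_minus)
  qed
  have term_eq: "theta_log_term r (z + \<tau>) \<tau> - theta_log_term r z \<tau> =
      inverse x ^ r / of_nat r - (q * x) ^ r / of_nat r" for r
  proof (cases "r = 0")
    case True
    thus ?thesis by (simp add: theta_log_term_def)
  next
    case False
    define X where "X = x ^ r"
    define Q where "Q = q ^ r"
    have XQ: "X \<noteq> 0" "Q \<noteq> 0" using x by (simp_all add: X_def Q_def)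
    have "norm q < 1" using norm_q_less_1[OF \<tau>] by (simp add: q_def)
    hence "norm Q < 1" using False by (simp add: Q_def norm_power power_less_one_iff)
    hence Q1: "1 - Q \<noteq> 0" by auto
    have e1: "exp (tpi * of_nat r * z) = X"
      by (simp only: exp_2pi_of_nat X_def x_def)
    have e2: "exp (tpi * of_nat r * (z + \<tau>)) = Q * X"
      by (simp only: exp_2pi_of_nat qx) (simp add: X_def Q_def power_mult_distrib)
    have e3: "exp (-(tpi * of_nat r) * w) = inverse (exp (tpi * of_nat r * w))" for w
      by (simp add: exp_minus)
    have "theta_log_term r (z + \<tau>) \<tau> - theta_log_term r z \<tau> =
        Q / (of_nat r * (1 - Q)) * ((Q * X + inverse (Q * X)) - (X + inverse X))"
      unfolding theta_log_term_def e3 e1 e2 lambert_coeff_def q_def[symmetric] Q_def[symmetric]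
      by (simp only: right_diff_distrib)
    also have "(Q * X + inverse (Q * X)) - (X + inverse X) = (1 - Q) * (inverse X / Q - X)"
      using XQ by (simp add: field_simps)
    also have "Q / (of_nat r * (1 - Q)) * ((1 - Q) * (inverse X / Q - X)) = inverse X / of_nat r - Q * X / of_nat r"
      using XQ Q1 False by (simp add: field_simps)
    finally show ?thesis
      by (simp only: X_def Q_def power_mult_distrib power_inverse)
  qed
  have "((\<lambda>r. theta_log_term r (z + \<tau>) \<tau> - theta_log_term r z \<tau>) has_sum
      (theta_log (z + \<tau>) \<tau> - theta_log z \<tau>)) UNIV"
  proof -
    have h: "((\<lambda>r. theta_log_term r w \<tau>) has_sum theta_log w \<tau>) UNIV" if "w \<in> strip \<tau>" for w
      unfolding theta_log_def by (rule has_sum_infsum[OF theta_log_term_summable[OF \<tau> that]])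
    have "((\<lambda>r. - theta_log_term r z \<tau>) has_sum - theta_log z \<tau>) UNIV"
      using h[OF z(1)] by (simp add: has_sum_uminus)
    from has_sum_add[OF h[OF z(2)] this] show ?thesis by simp
  qed
  hence 1: "(\<lambda>r. inverse x ^ r / of_nat r - (q * x) ^ r / of_nat r) sums (theta_log (z + \<tau>) \<tau> - theta_log z \<tau>)"
    unfolding term_eq by (rule has_sum_imp_sums)
  have "(\<lambda>r. inverse x ^ r / of_nat r - (q * x) ^ r / of_nat r) sums (- ln (1 - inverse x) - (- ln (1 - q * x)))"
    using sums_diff[OF sums_minus[OF Ln_series'[of "-inverse x"]] sums_minus[OF Ln_series'[of "-(q * x)"]]] n1 n2
    by simp
  with 1 have 2: "theta_log (z + \<tau>) \<tau> - theta_log z \<tau> = ln (1 - q * x) - ln (1 - inverse x)"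
    using sums_unique2 by fastforce
  have nz: "1 - q * x \<noteq> 0" "1 - inverse x \<noteq> 0" using n1 n2 by auto
  thus "exp (theta_log (z + \<tau>) \<tau> - theta_log z \<tau>) =
      (1 - exp (tpi * (z + \<tau>))) / (1 - exp (-2 * of_real pi * \<i> * z))"
    unfolding qx ix 2 by (simp add: exp_diff)
  show "exp (tpi * (z + \<tau>)) \<noteq> 1" using nz(1) unfolding qx by simp
qed

text \<open>On the strip this is sin (pi z) times the product of (1 - q^n \<zeta>)(1 - q^n/\<zeta>),
  that is, the product side of Jacobi's triple product up to a factor independent of z. Written with
  an exponential, its zeros are visibly those of the sine.\<close>

definition theta_prod :: "complex \<Rightarrow> complex \<Rightarrow> complex" where
  "theta_prod z \<tau> = sin (of_real pi * z) * exp (-theta_log z \<tau>)"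

lemma theta_prod_holomorphic: "Im \<tau> > 0 \<Longrightarrow> (\<lambda>z. theta_prod z \<tau>) holomorphic_on strip \<tau>"
  unfolding theta_prod_def by (intro holomorphic_intros theta_log_holomorphic)

lemma theta_prod_eq_0_iff: "theta_prod z \<tau> = 0 \<longleftrightarrow> z \<in> \<int>"
proof -
  have "sin (of_real pi * z) = 0 \<longleftrightarrow> (\<exists>n::int. of_real pi * z = of_real pi * of_int n)"
    by (simp add: sin_eq_0 mult.commute)
  also have "\<dots> \<longleftrightarrow> z \<in> \<int>" by (auto simp: Ints_def)
  finally show ?thesis by (simp add: theta_prod_def)
qed

lemma theta_prod_plus_1: "theta_prod (z + 1) \<tau> = -theta_prod z \<tau>"
  by (simp add: theta_prod_def theta_log_plus_1 ring_distribs sin_add)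

lemma theta_prod_plus_tau:
  assumes \<tau>: "Im \<tau> > 0" and z: "z \<in> strip \<tau>" "z + \<tau> \<in> strip \<tau>"
  shows "theta_prod (z + \<tau>) \<tau> = -exp (-of_real pi * \<i> * \<tau> - tpi * z) * theta_prod z \<tau>"
proof -
  \<comment> \<open>X and T are square roots of \<zeta> and q; they turn the sines and all
    multipliers into rational functions.\<close>
  define X where "X = exp (of_real pi * \<i> * z)"
  define T where "T = exp (of_real pi * \<i> * \<tau>)"
  have nz: "X \<noteq> 0" "T \<noteq> 0" by (simp_all add: X_def T_def)
  have s: "sin (of_real pi * w) = (exp (of_real pi * \<i> * w) - inverse (exp (of_real pi * \<i> * w))) / (2 * \<i>)" for w
    by (simp add: sin_exp_eq exp_minus mult_ac)
  have XT: "exp (of_real pi * \<i> * (z + \<tau>)) = X * T"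
    by (simp add: X_def T_def ring_distribs exp_add)
  have e1: "exp (tpi * (z + \<tau>)) = (X * T)\<^sup>2"
    unfolding XT[symmetric] exp_double[symmetric] by (rule arg_cong[where f = exp]) simp
  have e2: "exp (-2 * of_real pi * \<i> * z) = inverse (X\<^sup>2)"
    by (simp add: X_def exp_minus mult_ac flip: exp_double)
  have e3: "exp (-of_real pi * \<i> * \<tau> - tpi * z) = inverse T * inverse (X\<^sup>2)"
    unfolding exp_diff e2[symmetric] by (simp add: T_def exp_minus divide_inverse)
  note L = exp_theta_log_plus_tau[OF assms, unfolded e1 e2]
  have "Im z < 0" using z by (simp add: strip_def)
  hence "z \<notin> \<int>" by (auto elim!: Ints_cases)
  have nz2: "X * X * (T * T) \<noteq> 1" using L(2) by (simp add: power2_eq_square mult_ac)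
  have L': "exp (-theta_log (z + \<tau>) \<tau>) = exp (-theta_log z \<tau>) * (1 - inverse (X\<^sup>2)) / (1 - (X * T)\<^sup>2)"
  proof -
    have "exp (-theta_log (z + \<tau>) \<tau>) = exp (-theta_log z \<tau>) * inverse (exp (theta_log (z + \<tau>) \<tau> - theta_log z \<tau>))"
      by (simp flip: exp_minus exp_add)
    thus ?thesis unfolding L by simp
  qed
  have "(X * T - inverse (X * T)) * ((1 - inverse (X\<^sup>2)) / (1 - (X * T)\<^sup>2)) =
      -(inverse T * inverse (X\<^sup>2)) * (X - inverse X)"
    using nz nz2 by (simp add: field_simps power2_eq_square)
  note key = this
  have "(X * T - inverse (X * T)) / (2 * \<i>) * (E * (1 - inverse (X\<^sup>2)) / (1 - (X * T)\<^sup>2)) =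
      -(inverse T * inverse (X\<^sup>2)) * ((X - inverse X) / (2 * \<i>) * E)" for E
  proof -
    have "A / (2 * \<i>) * (E * N / D) = E / (2 * \<i>) * (A * (N / D))" for A N D by simp
    thus ?thesis by (simp only: key) simp
  qed
  thus ?thesis
    unfolding theta_prod_def L' s XT e3 X_def[symmetric] by blast
qed

lemma theta_prod_deriv_0:
  assumes "Im \<tau> > 0"
  shows "((\<lambda>z. theta_prod z \<tau>) has_field_derivative of_real pi * exp (-theta_log 0 \<tau>)) (at 0)"
proof -
  have "((\<lambda>z. theta_log z \<tau>) has_field_derivative deriv (\<lambda>z. theta_log z \<tau>) 0) (at 0)"
    by (rule holomorphic_derivI[OF theta_log_holomorphic[OF assms] open_strip])
       (use assms in \<open>simp add: strip_def\<close>)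
  thus ?thesis unfolding theta_prod_def
    by (auto intro!: derivative_eq_intros)
qed

text \<open>
  The quotient of such a function by the product is elliptic on the strip, and its only possible
  singularities there, at the integers, are removable.
\<close>

lemma theta_like_eq_theta_prod:
  assumes \<tau>: "Im \<tau> > 0" and hol: "K holomorphic_on UNIV" and K0: "K 0 = 0"
    and K1: "\<And>z. K (z + 1) = -K z"
    and K\<tau>: "\<And>z. K (z + \<tau>) = -exp (-of_real pi * \<i> * \<tau> - tpi * z) * K z"
  shows "\<exists>C. \<forall>z\<in>strip \<tau>. K z = C * theta_prod z \<tau>"
proof -
  define l where "l = deriv K 0 / (of_real pi * exp (-theta_log 0 \<tau>))"
  have ne: "theta_prod z \<tau> \<noteq> 0" if "z \<in> strip \<tau> - \<int>" for z
    using that by (simp add: theta_prod_eq_0_iff)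
  have *: "K z / theta_prod z \<tau> = l" if z: "z \<in> strip \<tau> - \<int>" for z
  proof (rule elliptic_removable_constant[OF \<tau> _ _ _ _ z])
    show "(\<lambda>z. K z / theta_prod z \<tau>) holomorphic_on strip \<tau> - \<int>"
      by (intro holomorphic_intros holomorphic_on_subset[OF hol]
          holomorphic_on_subset[OF theta_prod_holomorphic[OF \<tau>]] ne) auto
    show "(\<lambda>z. K z / theta_prod z \<tau>) \<midarrow>0\<rightarrow> l"
    proof (rule lhopital_complex_simple)
      show "(K has_field_derivative deriv K 0) (at 0)"
        by (rule holomorphic_derivI[OF hol]) auto
      show "theta_prod 0 \<tau> = 0" by (simp add: theta_prod_def)
    qed (use K0 theta_prod_deriv_0[OF \<tau>] in \<open>auto simp: l_def\<close>)
    show "K (z + 1) / theta_prod (z + 1) \<tau> = K z / theta_prod z \<tau>" for z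
      by (simp add: K1 theta_prod_plus_1)
    show "K (z + \<tau>) / theta_prod (z + \<tau>) \<tau> = K z / theta_prod z \<tau>"
      if "z \<in> strip \<tau> - \<int>" "z + \<tau> \<in> strip \<tau> - \<int>" for z
      using that by (simp add: K\<tau> theta_prod_plus_tau[OF \<tau>])
  qed
  have "K z = l * theta_prod z \<tau>" if "z \<in> strip \<tau> - \<int>" for z
    using * [OF that] ne[OF that] by (simp add: divide_eq_eq)
  moreover have "K z = l * theta_prod z \<tau>" if int: "z \<in> \<int>" for z
  proof -
    obtain n where n: "z = of_int n" using int by (auto elim: Ints_cases)
    have K1': "K (z - 1) = -K z" for z using K1[of "z - 1"] by simp
    have "0 + of_int n \<in> {z. K z = 0} \<and> K (0 + of_int n) = K 0"
      by (rule periodic_of_int) (use K0 in \<open>auto simp: K1 K1'\<close>)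
    thus ?thesis using int by (simp add: n K0 theta_prod_eq_0_iff)
  qed
  ultimately show ?thesis by blast
qed

lemma lattice_reduction:
  assumes "Im \<tau> > 0"
  obtains w l where "z = w + of_int l * \<tau>" "0 \<le> Im w" "Im w < Im \<tau>"
proof
  show "z = (z - of_int \<lfloor>Im z / Im \<tau>\<rfloor> * \<tau>) + of_int \<lfloor>Im z / Im \<tau>\<rfloor> * \<tau>" by simp
  have "of_int \<lfloor>Im z / Im \<tau>\<rfloor> * Im \<tau> \<le> Im z" "Im z < (of_int \<lfloor>Im z / Im \<tau>\<rfloor> + 1) * Im \<tau>"
    by (subst pos_le_divide_eq[OF assms, symmetric] pos_divide_less_eq[OF assms, symmetric], linarith)+
  thus "0 \<le> Im (z - of_int \<lfloor>Im z / Im \<tau>\<rfloor> * \<tau>)" "Im (z - of_int \<lfloor>Im z / Im \<tau>\<rfloor> * \<tau>) < Im \<tau>"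
    by (simp_all add: algebra_simps)
qed

text \<open>If C were 0, theta would vanish on the strip, hence by its quasi-periods
  everywhere.\<close>

lemma jtheta_eq_theta_prod:
  assumes \<tau>: "Im \<tau> > 0"
  obtains C where "C \<noteq> 0" "\<And>z. z \<in> strip \<tau> \<Longrightarrow> jtheta z \<tau> = C * theta_prod z \<tau>"
proof -
  obtain C where C: "\<And>z. z \<in> strip \<tau> \<Longrightarrow> jtheta z \<tau> = C * theta_prod z \<tau>"
    using theta_like_eq_theta_prod[OF \<tau> jtheta_holomorphic[OF \<tau>] jtheta_0 jtheta_plus_1 jtheta_plus_tau]
    by blast
  obtain z where z: "jtheta z \<tau> \<noteq> 0" using jtheta_nontrivial[OF \<tau>] .
  obtain w l where wl: "z = w + of_int l * \<tau>" "0 \<le> Im w" "Im w < Im \<tau>"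
    using lattice_reduction[OF \<tau>] .
  have "jtheta w \<tau> \<noteq> 0" using z jtheta_lattice_shift[of w l \<tau> 0] by (auto simp: wl(1))
  moreover have "w \<in> strip \<tau>" using wl by (simp add: strip_def)
  ultimately have "C \<noteq> 0" using C by auto
  thus ?thesis using that C by blast
qed

lemma jtheta_eq_0_iff_strip: "Im \<tau> > 0 \<Longrightarrow> z \<in> strip \<tau> \<Longrightarrow> jtheta z \<tau> = 0 \<longleftrightarrow> z \<in> \<int>"
  by (metis jtheta_eq_theta_prod theta_prod_eq_0_iff mult_eq_0_iff)

lemma jtheta_shift_eq_0_iff:
  "jtheta (z + of_int l * \<tau> + of_int k) \<tau> = 0 \<longleftrightarrow> jtheta z \<tau> = 0"
  by (simp add: jtheta_lattice_shift)

lemma jtheta_eq_0_iff: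
  assumes "Im \<tau> > 0"
  shows "jtheta z \<tau> = 0 \<longleftrightarrow> (\<exists>l k. z = of_int l * \<tau> + of_int k)"
proof
  assume "jtheta z \<tau> = 0"
  obtain w l where wl: "z = w + of_int l * \<tau>" "0 \<le> Im w" "Im w < Im \<tau>"
    using lattice_reduction[OF assms] .
  have "jtheta w \<tau> = 0" using \<open>jtheta z \<tau> = 0\<close> jtheta_shift_eq_0_iff[of w l \<tau> 0] by (simp add: wl(1))
  hence "w \<in> \<int>" using wl jtheta_eq_0_iff_strip[OF assms, of w] by (simp add: strip_def)
  then obtain k where "w = of_int k" by (auto elim: Ints_cases)
  thus "\<exists>l k. z = of_int l * \<tau> + of_int k" using wl(1) by (metis add.commute)
next
  assume "\<exists>l k. z = of_int l * \<tau> + of_int k"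
  thus "jtheta z \<tau> = 0" using jtheta_shift_eq_0_iff[of 0 _ \<tau>] by auto
qed

text \<open>The zeros of numerator and denominator of \<phi> are disjoint since 1/2 is not a lattice
  point. This makes every lattice point a genuine pole of \<phi>, as the meromorphic continuation
  requires.\<close>

lemma jtheta_half_nonzero:
  assumes "Im \<tau> > 0" "jtheta z \<tau> = 0"
  shows "jtheta (z + 1/2) \<tau> \<noteq> 0"
proof
  assume "jtheta (z + 1/2) \<tau> = 0"
  obtain l k where lk: "z = of_int l * \<tau> + of_int k"
    using jtheta_eq_0_iff[OF assms(1)] assms(2) by blast
  have "jtheta (1/2) \<tau> = 0"
    using \<open>jtheta (z + 1/2) \<tau> = 0\<close> jtheta_shift_eq_0_iff[of "1/2" l \<tau> k] by (simp add: lk add_ac)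
  hence "(1/2 :: complex) \<in> \<int>"
    using jtheta_eq_0_iff_strip[OF assms(1), of "1/2"] assms(1) by (simp add: strip_def)
  then obtain n :: int where "1/2 = (of_int n :: complex)" by (auto elim: Ints_cases)
  hence "(of_int (2 * n) :: complex) = of_int 1" by (simp add: field_simps)
  hence "2 * n = 1" by (simp only: of_int_eq_iff)
  thus False by presburger
qed

text \<open>The entire functions with these quasi-periods and a zero at 0 form a line: on the strip
  both K and theta are multiples of the product, and the identity theorem extends the
  proportionality to the plane.\<close>

lemma theta_like_unique:
  assumes \<tau>: "Im \<tau> > 0" and hol: "K holomorphic_on UNIV" and K0: "K 0 = 0"
    and K1: "\<And>z. K (z + 1) = -K z"
    and K\<tau>: "\<And>z. K (z + \<tau>) = -exp (-of_real pi * \<i> * \<tau> - tpi * z) * K z"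
  shows "\<exists>C. \<forall>z. K z = C * jtheta z \<tau>"
proof -
  obtain C where C: "\<And>z. z \<in> strip \<tau> \<Longrightarrow> K z = C * theta_prod z \<tau>"
    using theta_like_eq_theta_prod[OF assms] by blast
  obtain D where D: "D \<noteq> 0" "\<And>z. z \<in> strip \<tau> \<Longrightarrow> jtheta z \<tau> = D * theta_prod z \<tau>"
    using jtheta_eq_theta_prod[OF \<tau>] by blast
  have "K z = (C / D) * jtheta z \<tau>" for z
  proof (rule analytic_continuation_open[of "strip \<tau>" UNIV K "\<lambda>z. C / D * jtheta z \<tau>"])
    show "strip \<tau> \<noteq> {}" using \<tau> by (auto simp: strip_def intro!: exI[of _ 0])
    show "(\<lambda>z. C / D * jtheta z \<tau>) holomorphic_on UNIV"
      by (intro holomorphic_intros jtheta_holomorphic[OF \<tau>])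
    show "K z = C / D * jtheta z \<tau>" if z: "z \<in> strip \<tau>" for z
      using C[OF z] D(1) D(2)[OF z] by simp
  qed (use hol in auto)
  thus ?thesis by blast
qed

section \<open>The modular transformation law of theta\<close>

lemma
  fixes a b c d :: int
  assumes det: "a * d - b * c = 1" and \<tau>: "Im \<tau> > 0"
  shows autfac_nonzero: "of_int c * \<tau> + of_int d \<noteq> 0"
    and Im_moebius: "Im ((of_int a * \<tau> + of_int b) / (of_int c * \<tau> + of_int d)) =
      Im \<tau> / (norm (of_int c * \<tau> + of_int d))\<^sup>2"
proof -
  show "of_int c * \<tau> + of_int d \<noteq> 0"
  proof
    assume *: "of_int c * \<tau> + of_int d = 0"
    from arg_cong[OF *, of Im] \<tau> have "c = 0" by simp
    with * have "d = 0" by simp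
    with \<open>c = 0\<close> det show False by simp
  qed
  have "(of_int a * of_int d - of_int b * of_int c :: real) = 1"
    using arg_cong[OF det, of real_of_int] by simp
  hence "Im \<tau> = Im \<tau> * (of_int a * of_int d - of_int b * of_int c)" by simp
  thus "Im ((of_int a * \<tau> + of_int b) / (of_int c * \<tau> + of_int d)) =
      Im \<tau> / (norm (of_int c * \<tau> + of_int d))\<^sup>2"
    unfolding Im_divide cmod_power2
    by (intro arg_cong2[where f = "(/)"]) (simp_all add: algebra_simps)
qed

lemma jtheta_modular:
  fixes a b c d :: int
  assumes det: "a * d - b * c = 1" and \<tau>: "Im \<tau> > 0"
  defines "s \<equiv> of_int c * \<tau> + of_int d"
  defines "\<tau>' \<equiv> (of_int a * \<tau> + of_int b) / s"
  obtains \<eta> where "\<eta> \<noteq> 0"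
    "\<And>z. jtheta (z / s) \<tau>' = \<eta> * exp (of_real pi * \<i> * of_int c * z\<^sup>2 / s) * jtheta z \<tau>"
proof -
  have s: "s \<noteq> 0" unfolding s_def by (rule autfac_nonzero[OF det \<tau>])
  have \<tau>': "Im \<tau>' > 0"
    unfolding \<tau>'_def s_def Im_moebius[OF det \<tau>] using \<tau> s by (simp add: s_def)
  have detc: "of_int a * of_int d - of_int b * of_int c = (1 :: complex)"
    using arg_cong[OF det, of complex_of_int] by simp
  define y where "y = 1 / s"
  have sy: "(of_int c * \<tau> + of_int d) * y = 1" using s by (simp add: y_def s_def)
  have ts: "\<tau>' * (of_int c * \<tau> + of_int d) = of_int a * \<tau> + of_int b"
    using s by (simp add: \<tau>'_def s_def)
  \<comment> \<open>The inverse of \<gamma> expresses 1/(c\<tau> + d) and \<tau>/(c\<tau> + d) as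
    lattice vectors for \<tau>', so z \<mapsto> z + 1 and z \<mapsto> z + \<tau> become lattice
    shifts of z/(c\<tau> + d).\<close>
  have y1: "y = of_int a - of_int c * \<tau>'"
    using sy ts detc by algebra
  have y2: "\<tau> * y = of_int d * \<tau>' - of_int b"
    using sy ts detc by algebra
  define K where "K = (\<lambda>z. exp (-of_real pi * \<i> * (of_int c * z\<^sup>2 * y)) * jtheta (z * y) \<tau>')"
  have K1: "K (z + 1) = - K z" for z
  proof -
    have "(z + 1) * y = z * y + of_int (-c) * \<tau>' + of_int a"
      using y1 by (simp add: algebra_simps)
    hence "K (z + 1) = exp (-of_real pi * \<i> * (of_int c * (z + 1)\<^sup>2 * y)) * ((-1) powi (-c + a) *
        exp (-of_real pi * \<i> * (of_int (-c) ^ 2 * \<tau>' + 2 * of_int (-c) * (z * y))) * jtheta (z * y) \<tau>')"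
      unfolding K_def by (simp only: jtheta_lattice_shift)
    also have "\<dots> = (-1) powi (-c + a) * (exp (-of_real pi * \<i> * (of_int c * (z + 1)\<^sup>2 * y)) *
        exp (-of_real pi * \<i> * (of_int (-c) ^ 2 * \<tau>' + 2 * of_int (-c) * (z * y)))) * jtheta (z * y) \<tau>'"
      by (simp only: mult_ac)
    also have "exp (-of_real pi * \<i> * (of_int c * (z + 1)\<^sup>2 * y)) *
        exp (-of_real pi * \<i> * (of_int (-c) ^ 2 * \<tau>' + 2 * of_int (-c) * (z * y))) =
        exp (of_real pi * \<i> * of_int (-(a * c))) * exp (-of_real pi * \<i> * (of_int c * z\<^sup>2 * y))"
    proof -
      have "of_int c * (z + 1)\<^sup>2 * y + (of_int (-c) ^ 2 * \<tau>' + 2 * of_int (-c) * (z * y)) =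
          of_int (a * c) + of_int c * z\<^sup>2 * y"
        unfolding y1 by (simp add: power2_eq_square algebra_simps)
      hence "-of_real pi * \<i> * (of_int c * (z + 1)\<^sup>2 * y + (of_int (-c) ^ 2 * \<tau>' + 2 * of_int (-c) * (z * y))) =
          -of_real pi * \<i> * (of_int (a * c) + of_int c * z\<^sup>2 * y)" by (rule arg_cong)
      thus ?thesis
        unfolding exp_add[symmetric] by (intro arg_cong[where f = exp]) (simp add: algebra_simps)
    qed
    also have "(-1) powi (-c + a) * (exp (of_real pi * \<i> * of_int (-(a * c))) *
        exp (-of_real pi * \<i> * (of_int c * z\<^sup>2 * y))) * jtheta (z * y) \<tau>' =
        ((-1) powi (-c + a) * (-1) powi (-(a * c))) * K z"
      unfolding K_def exp_pi_i_int by (simp only: mult_ac)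
    also have "(-1) powi (-c + a) * (-1) powi (-(a * c)) = (-1 :: complex)"
    proof -
      \<comment> \<open>Modulo 2 the exponent is a + c + a c = (1 + a)(1 + c) - 1, which is odd
        unless a and c are both even; the determinant excludes that.\<close>
      have "odd a \<or> odd c" using det by (metis dvd_diff dvd_mult dvd_mult2 odd_one)
      hence "odd ((-c + a) + -(a * c))" by auto
      hence "(-1 :: complex) powi ((-c + a) + -(a * c)) = -1" by simp
      thus ?thesis by (subst (asm) power_int_add) auto
    qed
    finally show ?thesis by simp
  qed
  have K\<tau>: "K (z + \<tau>) = -exp (-of_real pi * \<i> * \<tau> - tpi * z) * K z" for z
  proof -
    have "(z + \<tau>) * y = z * y + of_int d * \<tau>' + of_int (-b)"
      using y2 by (simp add: algebra_simps)
    hence "K (z + \<tau>) = exp (-of_real pi * \<i> * (of_int c * (z + \<tau>)\<^sup>2 * y)) * ((-1) powi (d + -b) *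
        exp (-of_real pi * \<i> * (of_int d ^ 2 * \<tau>' + 2 * of_int d * (z * y))) * jtheta (z * y) \<tau>')"
      unfolding K_def by (simp only: jtheta_lattice_shift)
    also have "\<dots> = (-1) powi (d + -b) * (exp (-of_real pi * \<i> * (of_int c * (z + \<tau>)\<^sup>2 * y)) *
        exp (-of_real pi * \<i> * (of_int d ^ 2 * \<tau>' + 2 * of_int d * (z * y)))) * jtheta (z * y) \<tau>'"
      by (simp only: mult_ac)
    also have "exp (-of_real pi * \<i> * (of_int c * (z + \<tau>)\<^sup>2 * y)) *
        exp (-of_real pi * \<i> * (of_int d ^ 2 * \<tau>' + 2 * of_int d * (z * y))) =
        exp (of_real pi * \<i> * of_int (-(b * d))) * (exp (-of_real pi * \<i> * \<tau> - tpi * z) *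
        exp (-of_real pi * \<i> * (of_int c * z\<^sup>2 * y)))"
    proof -
      have "of_int c * (z + \<tau>)\<^sup>2 * y + (of_int d ^ 2 * \<tau>' + 2 * of_int d * (z * y)) =
          of_int b * of_int d + (\<tau> + 2 * z) + of_int c * z\<^sup>2 * y"
        using sy ts y2 detc by algebra
      hence "-of_real pi * \<i> * (of_int c * (z + \<tau>)\<^sup>2 * y + (of_int d ^ 2 * \<tau>' + 2 * of_int d * (z * y))) =
          -of_real pi * \<i> * (of_int b * of_int d + (\<tau> + 2 * z) + of_int c * z\<^sup>2 * y)" by (rule arg_cong)
      thus ?thesis
        unfolding exp_add[symmetric] by (intro arg_cong[where f = exp]) (simp add: algebra_simps)
    qed
    also have "(-1) powi (d + -b) * (exp (of_real pi * \<i> * of_int (-(b * d))) *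
        (exp (-of_real pi * \<i> * \<tau> - tpi * z) *
        exp (-of_real pi * \<i> * (of_int c * z\<^sup>2 * y)))) * jtheta (z * y) \<tau>' =
        ((-1) powi (d + -b) * (-1) powi (-(b * d))) * (exp (-of_real pi * \<i> * \<tau> - tpi * z) * K z)"
      unfolding K_def exp_pi_i_int by (simp only: mult_ac)
    also have "(-1) powi (d + -b) * (-1) powi (-(b * d)) = (-1 :: complex)"
    proof -
      have "odd b \<or> odd d" using det by (metis dvd_diff dvd_mult dvd_mult2 odd_one)
      hence "odd ((d + -b) + -(b * d))" by auto
      hence "(-1 :: complex) powi ((d + -b) + -(b * d)) = -1" by simp
      thus ?thesis by (subst (asm) power_int_add) auto
    qed
    finally show ?thesis by simp
  qed
  have "K holomorphic_on UNIV"
  proof -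
    have "((\<lambda>z. jtheta z \<tau>') \<circ> (\<lambda>z. z * y)) holomorphic_on UNIV"
      by (rule holomorphic_on_compose_gen[OF _ jtheta_holomorphic[OF \<tau>']]) (auto intro!: holomorphic_intros)
    thus ?thesis unfolding K_def o_def by (intro holomorphic_intros)
  qed
  then obtain \<eta> where \<eta>: "\<And>z. K z = \<eta> * jtheta z \<tau>"
    using theta_like_unique[OF \<tau> _ _ K1 K\<tau>] by (auto simp: K_def)
  have law: "jtheta (z / s) \<tau>' = \<eta> * exp (of_real pi * \<i> * of_int c * z\<^sup>2 / s) * jtheta z \<tau>" for z
  proof -
    have "jtheta (z / s) \<tau>' = exp (of_real pi * \<i> * of_int c * z\<^sup>2 / s) * K z"
      unfolding K_def y_def by (simp add: mult.assoc[symmetric] flip: exp_add)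
    thus ?thesis unfolding \<eta> by simp
  qed
  obtain w where w: "jtheta w \<tau>' \<noteq> 0" using jtheta_nontrivial[OF \<tau>'] .
  have "\<eta> \<noteq> 0" using law[of "w * s"] w s by auto
  thus ?thesis using that law by blast
qed

section \<open>The second logarithmic derivative of theta\<close>

text \<open>This is the Weierstrass function divided by (2 pi i)^2, minus E_2/12. The constant term
  is kept on purpose: it carries the quasimodularity of E_2.\<close>

definition theta_wp :: "complex \<Rightarrow> complex \<Rightarrow> complex" where
  "theta_wp z \<tau> = -deriv (\<lambda>z. deriv (\<lambda>z. jtheta z \<tau>) z / jtheta z \<tau>) z / (tpi)\<^sup>2"

lemma
  assumes "Im \<tau> > 0"
  shows jtheta_has_derivative: "((\<lambda>z. jtheta z \<tau>) has_field_derivative deriv (\<lambda>z. jtheta z \<tau>) z) (at z)"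
    and open_jtheta_nonzero: "open {z. jtheta z \<tau> \<noteq> 0}"
    and jtheta_log_deriv_holomorphic:
      "(\<lambda>z. deriv (\<lambda>z. jtheta z \<tau>) z / jtheta z \<tau>) holomorphic_on {z. jtheta z \<tau> \<noteq> 0}"
    and theta_wp_holomorphic: "(\<lambda>z. theta_wp z \<tau>) holomorphic_on {z. jtheta z \<tau> \<noteq> 0}"
proof -
  note hol = jtheta_holomorphic[OF assms]
  show "((\<lambda>z. jtheta z \<tau>) has_field_derivative deriv (\<lambda>z. jtheta z \<tau>) z) (at z)"
    by (rule holomorphic_derivI[OF hol]) auto
  have hol': "deriv (\<lambda>z. jtheta z \<tau>) holomorphic_on UNIV"
    by (rule holomorphic_deriv[OF hol]) auto
  have "continuous_on UNIV (\<lambda>z. jtheta z \<tau>)"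
    by (rule holomorphic_on_imp_continuous_on[OF hol])
  thus op: "open {z. jtheta z \<tau> \<noteq> 0}"
    by (intro open_Collect_neq continuous_intros)
  show ld: "(\<lambda>z. deriv (\<lambda>z. jtheta z \<tau>) z / jtheta z \<tau>) holomorphic_on {z. jtheta z \<tau> \<noteq> 0}"
    by (intro holomorphic_on_divide holomorphic_on_subset[OF hol] holomorphic_on_subset[OF hol']) auto
  show "(\<lambda>z. theta_wp z \<tau>) holomorphic_on {z. jtheta z \<tau> \<noteq> 0}"
    unfolding theta_wp_def by (intro holomorphic_intros holomorphic_deriv[OF ld op]) auto
qed

text \<open>The logarithmic derivative removes \<kappa> and a second derivative removes r, so of the
  multiplier only the quadratic coefficient p survives. One computation thus covers both periods (p
  = 0) and the modular substitution.\<close>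

lemma theta_wp_transform:
  assumes \<tau>: "Im \<tau> > 0" and \<sigma>: "Im \<sigma> > 0" and \<alpha>: "\<alpha> \<noteq> 0" and \<kappa>: "\<kappa> \<noteq> 0"
    and law: "\<And>z. jtheta (\<alpha> * z + \<beta>) \<sigma> = \<kappa> * exp (p * z\<^sup>2 + r * z) * jtheta z \<tau>"
    and z: "jtheta z \<tau> \<noteq> 0"
  shows "\<alpha>\<^sup>2 * theta_wp (\<alpha> * z + \<beta>) \<sigma> = theta_wp z \<tau> - 2 * p / (tpi)\<^sup>2"
proof -
  define f where "f = (\<lambda>\<tau> z. deriv (\<lambda>z. jtheta z \<tau>) z / jtheta z \<tau>)"
  have f_eq: "\<alpha> * f \<sigma> (\<alpha> * w + \<beta>) = 2 * p * w + r + f \<tau> w" if w: "jtheta w \<tau> \<noteq> 0" for w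
  proof -
    let ?E = "exp (p * w\<^sup>2 + r * w)"
    have "((\<lambda>z. jtheta (\<alpha> * z + \<beta>) \<sigma>) has_field_derivative
        deriv (\<lambda>z. jtheta z \<sigma>) (\<alpha> * w + \<beta>) * \<alpha>) (at w)"
      by (rule DERIV_chain2[OF jtheta_has_derivative[OF \<sigma>]]) (auto intro!: derivative_eq_intros)
    moreover have "((\<lambda>z. \<kappa> * exp (p * z\<^sup>2 + r * z) * jtheta z \<tau>) has_field_derivative
        (\<kappa> * ?E * (2 * p * w + r)) * jtheta w \<tau> + \<kappa> * ?E * deriv (\<lambda>z. jtheta z \<tau>) w) (at w)"
      by (rule derivative_eq_intros refl jtheta_has_derivative[OF \<tau>])+ (simp add: algebra_simps)
    ultimately have "deriv (\<lambda>z. jtheta z \<sigma>) (\<alpha> * w + \<beta>) * \<alpha> =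
        (\<kappa> * ?E * (2 * p * w + r)) * jtheta w \<tau> + \<kappa> * ?E * deriv (\<lambda>z. jtheta z \<tau>) w"
      unfolding law by (rule DERIV_unique)
    also have "\<dots> = (\<kappa> * ?E * jtheta w \<tau>) * (2 * p * w + r + f \<tau> w)"
      using w by (simp add: f_def field_simps)
    finally show ?thesis
      using w \<kappa> unfolding f_def[of ] law by (simp add: field_simps)
  qed
  have nz: "jtheta (\<alpha> * z + \<beta>) \<sigma> \<noteq> 0" using z \<kappa> by (simp add: law)
  have der: "(f \<rho> has_field_derivative deriv (f \<rho>) w) (at w)" if "Im \<rho> > 0" "jtheta w \<rho> \<noteq> 0" for \<rho> w
    unfolding f_def
    by (rule holomorphic_derivI[OF jtheta_log_deriv_holomorphic[OF that(1)] open_jtheta_nonzero[OF that(1)]])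
       (use that in auto)
  have "((\<lambda>w. \<alpha> * f \<sigma> (\<alpha> * w + \<beta>)) has_field_derivative \<alpha> * (deriv (f \<sigma>) (\<alpha> * z + \<beta>) * \<alpha>)) (at z)"
    by (intro DERIV_cmult DERIV_chain2[where f = "f \<sigma>" and g = "\<lambda>w. \<alpha> * w + \<beta>"] der[OF \<sigma> nz])
      (auto intro!: derivative_eq_intros)
  moreover have "((\<lambda>w. \<alpha> * f \<sigma> (\<alpha> * w + \<beta>)) has_field_derivative 2 * p + deriv (f \<tau>) z) (at z)"
  proof (rule has_field_derivative_transform_within_open[OF _ open_jtheta_nonzero[OF \<tau>]])
    show "((\<lambda>w. 2 * p * w + r + f \<tau> w) has_field_derivative 2 * p + deriv (f \<tau>) z) (at z)"
      by (rule derivative_eq_intros refl der[OF \<tau> z])+ simp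
  qed (use z f_eq in auto)
  ultimately have "\<alpha> * (deriv (f \<sigma>) (\<alpha> * z + \<beta>) * \<alpha>) = 2 * p + deriv (f \<tau>) z"
    by (rule DERIV_unique)
  hence "deriv (f \<tau>) z = \<alpha>\<^sup>2 * deriv (f \<sigma>) (\<alpha> * z + \<beta>) - 2 * p" by (simp add: power2_eq_square algebra_simps)
  moreover have "theta_wp w \<rho> = -deriv (f \<rho>) w / (tpi)\<^sup>2" for w \<rho>
    by (simp add: theta_wp_def f_def)
  ultimately show ?thesis by (simp add: add_divide_distrib diff_divide_distrib)
qed

lemma theta_wp_plus_1:
  assumes "Im \<tau> > 0" "jtheta z \<tau> \<noteq> 0"
  shows "theta_wp (z + 1) \<tau> = theta_wp z \<tau>"
  using theta_wp_transform[of \<tau> \<tau> 1 "-1" 1 0 0 z] assms by (simp add: jtheta_plus_1)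

lemma theta_wp_plus_tau:
  assumes "Im \<tau> > 0" "jtheta z \<tau> \<noteq> 0"
  shows "theta_wp (z + \<tau>) \<tau> = theta_wp z \<tau>"
proof -
  have "jtheta (1 * z + \<tau>) \<tau> = -exp (-of_real pi * \<i> * \<tau>) * exp (0 * z\<^sup>2 + (-2 * of_real pi * \<i>) * z) * jtheta z \<tau>" for z
  proof -
    have "exp (-of_real pi * \<i> * \<tau> - tpi * z) =
        exp (-of_real pi * \<i> * \<tau>) * exp (0 * z\<^sup>2 + (-2 * of_real pi * \<i>) * z)"
      unfolding exp_add[symmetric] by simp
    thus ?thesis by (simp only: mult_1_left jtheta_plus_tau mult_minus_left)
  qed
  from theta_wp_transform[OF assms(1) assms(1) _ _ this assms(2)] show ?thesis by simp
qed

lemma theta_wp_modular: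
  fixes a b c d :: int
  assumes det: "a * d - b * c = 1" and \<tau>: "Im \<tau> > 0" and z: "jtheta z \<tau> \<noteq> 0"
  defines "s \<equiv> of_int c * \<tau> + of_int d"
  defines "\<tau>' \<equiv> (of_int a * \<tau> + of_int b) / s"
  shows "theta_wp (z / s) \<tau>' = s\<^sup>2 * (theta_wp z \<tau> - of_int c / (tpi * s))"
proof -
  have s: "s \<noteq> 0" unfolding s_def by (rule autfac_nonzero[OF det \<tau>])
  have \<tau>': "Im \<tau>' > 0"
    unfolding \<tau>'_def s_def Im_moebius[OF det \<tau>] using \<tau> s by (simp add: s_def)
  obtain \<eta> where \<eta>: "\<eta> \<noteq> 0"
    "\<And>z. jtheta (z / s) \<tau>' = \<eta> * exp (of_real pi * \<i> * of_int c * z\<^sup>2 / s) * jtheta z \<tau>"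
    using jtheta_modular[OF det \<tau>] unfolding s_def \<tau>'_def by blast
  have "jtheta (1 / s * z + 0) \<tau>' = \<eta> * exp ((of_real pi * \<i> * of_int c / s) * z\<^sup>2 + 0 * z) * jtheta z \<tau>" for z
    using \<eta>(2)[of z] by simp
  from theta_wp_transform[OF \<tau> \<tau>' _ \<eta>(1) this z] s
  have "(1 / s)\<^sup>2 * theta_wp (z / s) \<tau>' = theta_wp z \<tau> - 2 * (of_real pi * \<i> * of_int c / s) / (tpi)\<^sup>2"
    by simp
  also have "2 * (of_real pi * \<i> * of_int c / s) / (tpi)\<^sup>2 = of_int c / (tpi * s)"
    using s by (simp add: field_simps power2_eq_square)
  finally show ?thesis using s by (simp add: field_simps)
qed

text \<open>Twice differentiating the logarithm of the product removes its constant C and gives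
  pi^2/sin^2 plus the second derivative of \<open>theta_log\<close>; after division by (2 pi i)^2
  the first part is -1/(4 sin^2) = \<zeta>/(1 - \<zeta>)^2.\<close>

lemma theta_wp_strip:
  assumes \<tau>: "Im \<tau> > 0" and z: "z \<in> strip \<tau> - \<int>"
  shows "theta_wp z \<tau> = exp (tpi * z) / (1 - exp (tpi * z))\<^sup>2 +
    (deriv ^^ 2) (\<lambda>z. theta_log z \<tau>) z / (tpi)\<^sup>2"
proof -
  let ?L = "\<lambda>z. theta_log z \<tau>"
  obtain C where C: "C \<noteq> 0" "\<And>z. z \<in> strip \<tau> \<Longrightarrow> jtheta z \<tau> = C * theta_prod z \<tau>"
    using jtheta_eq_theta_prod[OF \<tau>] by blast
  have L: "(?L has_field_derivative deriv ?L w) (at w)" if "w \<in> strip \<tau>" for w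
    by (rule holomorphic_derivI[OF theta_log_holomorphic[OF \<tau>] open_strip that])
  have L2: "(deriv ?L has_field_derivative deriv (deriv ?L) w) (at w)" if "w \<in> strip \<tau>" for w
    by (rule holomorphic_derivI[OF holomorphic_deriv[OF theta_log_holomorphic[OF \<tau>]] open_strip that]) auto
  have sin_nz: "sin (of_real pi * w) \<noteq> 0" if "w \<in> strip \<tau> - \<int>" for w
    using that theta_prod_eq_0_iff[of w \<tau>] by (auto simp: theta_prod_def)
  have f: "deriv (\<lambda>z. jtheta z \<tau>) w / jtheta w \<tau> = of_real pi * cos (of_real pi * w) / sin (of_real pi * w) - deriv ?L w"
    if w: "w \<in> strip \<tau> - \<int>" for w
  proof -
    let ?E = "exp (-?L w)"
    have "((\<lambda>z. C * theta_prod z \<tau>) has_field_derivative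
        C * ((of_real pi * cos (of_real pi * w)) * ?E + sin (of_real pi * w) * (-deriv ?L w * ?E))) (at w)"
      unfolding theta_prod_def
      by (rule derivative_eq_intros refl L | use w in simp)+
    hence "((\<lambda>z. jtheta z \<tau>) has_field_derivative
        C * ((of_real pi * cos (of_real pi * w)) * ?E + sin (of_real pi * w) * (-deriv ?L w * ?E))) (at w)"
      by (rule has_field_derivative_transform_within_open[OF _ open_strip[of \<tau>]]) (use w C in auto)
    hence "deriv (\<lambda>z. jtheta z \<tau>) w = C * ((of_real pi * cos (of_real pi * w)) * ?E + sin (of_real pi * w) * (-deriv ?L w * ?E))"
      by (rule DERIV_imp_deriv)
    moreover have "jtheta w \<tau> = C * (sin (of_real pi * w) * ?E)" using C(2) w by (simp add: theta_prod_def)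
    ultimately show ?thesis using sin_nz[OF w] C(1) by (simp add: field_simps)
  qed
  have "((\<lambda>w. of_real pi * cos (of_real pi * w) / sin (of_real pi * w) - deriv ?L w) has_field_derivative
      -(of_real pi)\<^sup>2 / (sin (of_real pi * z))\<^sup>2 - deriv (deriv ?L) z) (at z)"
  proof -
    have "P * (-S * P) * S - P * C * (C * P) = -P\<^sup>2 * (S\<^sup>2 + C\<^sup>2)" for P S C :: complex
      by (simp add: power2_eq_square algebra_simps)
    hence "(of_real pi * (-sin (of_real pi * z) * of_real pi) * sin (of_real pi * z) -
        of_real pi * cos (of_real pi * z) * (cos (of_real pi * z) * of_real pi)) =
        -(of_real pi)\<^sup>2 * ((sin (of_real pi * z))\<^sup>2 + (cos (of_real pi * z))\<^sup>2)" .
    hence "(of_real pi * (-sin (of_real pi * z) * of_real pi) * sin (of_real pi * z) -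
        of_real pi * cos (of_real pi * z) * (cos (of_real pi * z) * of_real pi)) = -(of_real pi)\<^sup>2"
      by simp
    moreover have "((\<lambda>w. of_real pi * cos (of_real pi * w) / sin (of_real pi * w) - deriv ?L w) has_field_derivative
      (of_real pi * (-sin (of_real pi * z) * of_real pi) * sin (of_real pi * z) -
        of_real pi * cos (of_real pi * z) * (cos (of_real pi * z) * of_real pi)) /
        (sin (of_real pi * z) * sin (of_real pi * z)) - deriv (deriv ?L) z) (at z)"
      by (rule derivative_eq_intros refl L2 | use z sin_nz[OF z] in simp)+
    ultimately show ?thesis by (simp add: power2_eq_square)
  qed
  hence "((\<lambda>w. deriv (\<lambda>z. jtheta z \<tau>) w / jtheta w \<tau>) has_field_derivative
      -(of_real pi)\<^sup>2 / (sin (of_real pi * z))\<^sup>2 - deriv (deriv ?L) z) (at z)"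
    by (rule has_field_derivative_transform_within_open[OF _ open_strip_minus_Ints[of \<tau>]]) (use z f in auto)
  from DERIV_imp_deriv[OF this] have "theta_wp z \<tau> = ((of_real pi)\<^sup>2 / (sin (of_real pi * z))\<^sup>2 + deriv (deriv ?L) z) / (tpi)\<^sup>2"
    unfolding theta_wp_def by simp
  also have "\<dots> = -1 / (4 * (sin (of_real pi * z))\<^sup>2) + deriv (deriv ?L) z / (tpi)\<^sup>2"
    using sin_nz[OF z] by (simp add: field_simps)
  also have "-1 / (4 * (sin (of_real pi * z))\<^sup>2) =
      exp (tpi * z) / (1 - exp (tpi * z))\<^sup>2"
  proof -
    define X where "X = exp (of_real pi * \<i> * z)"
    have X: "X \<noteq> 0" by (simp add: X_def)
    have e: "exp (tpi * z) = X\<^sup>2"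
      unfolding X_def exp_double[symmetric] by (rule arg_cong[where f = exp]) simp
    have s: "sin (of_real pi * z) = (X - inverse X) / (2 * \<i>)"
      by (simp add: sin_exp_eq X_def exp_minus mult_ac)
    have "X - inverse X \<noteq> 0" using sin_nz[OF z] unfolding s by simp
    hence "X\<^sup>2 \<noteq> 1" using X by (auto simp: field_simps power2_eq_square)
    hence nz: "1 - X\<^sup>2 \<noteq> 0" by simp
    have "4 * (sin (of_real pi * z))\<^sup>2 = -((X - inverse X)\<^sup>2)"
      unfolding s by (simp add: power_divide power_mult_distrib)
    also have "X - inverse X = -(1 - X\<^sup>2) / X" using X by (simp add: field_simps power2_eq_square)
    finally have "4 * (sin (of_real pi * z))\<^sup>2 = -((1 - X\<^sup>2)\<^sup>2 / X\<^sup>2)"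
      by (simp add: power_divide power2_commute)
    thus ?thesis unfolding e using X nz by simp
  qed
  finally show ?thesis by (simp add: numeral_2_eq_2)
qed

section \<open>Bernoulli numbers\<close>

definition bernoulli_fps :: "complex fps" where
  "bernoulli_fps = fps_X / (fps_exp 1 - 1)"

lemma bernoulli_num_altdef: "bernoulli_num r = fact r * fps_nth bernoulli_fps r"
  by (simp add: bernoulli_num_def bernoulli_fps_def)

lemma bernoulli_fps_mult: "bernoulli_fps * (fps_exp 1 - 1) = fps_X"
proof -
  have "subdegree (fps_exp 1 - 1 :: complex fps) = 1"
    by (rule subdegreeI) auto
  moreover have "fps_exp 1 - 1 \<noteq> (0 :: complex fps)"
    using calculation by force
  ultimately have "fps_exp 1 - 1 dvd (fps_X :: complex fps)"
    by (subst fps_dvd_iff) auto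
  thus ?thesis unfolding bernoulli_fps_def by (rule dvd_div_mult_self)
qed

lemma bernoulli_fps_nth_0: "fps_nth bernoulli_fps 0 = 1"
proof -
  have "fps_nth (bernoulli_fps * (fps_exp 1 - 1)) 1 = 1"
    unfolding bernoulli_fps_mult by simp
  thus ?thesis by (simp add: fps_mult_nth)
qed

text \<open>
  The series \<open>b\<close> expands \<open>(t/2) coth (t/2)\<close>; its Riccati equation yields the recursion behind the
  alternating signs of the even Bernoulli numbers.
\<close>

lemma bernoulli_fps_riccati:
  defines "b \<equiv> bernoulli_fps + fps_const (1/2) * fps_X"
  shows "fps_X * fps_deriv b = b - b * b + fps_const (1/4) * fps_X ^ 2"
proof -
  let ?B = bernoulli_fps and ?e = "fps_exp 1 :: complex fps" and ?X = "fps_X :: complex fps"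
  have e: "?e - 1 \<noteq> 0"
    using bernoulli_fps_mult by auto
  have "fps_deriv (?B * (?e - 1)) = 1"
    unfolding bernoulli_fps_mult by simp
  hence d: "fps_deriv ?B * (?e - 1) + ?B * ?e = 1"
    by (simp add: algebra_simps)
  have "(?e - 1) * (?X * fps_deriv ?B + ?B * ?B * ?e - ?B) =
      ?X * (fps_deriv ?B * (?e - 1)) + (?B * (?e - 1)) * (?B * ?e) - ?B * (?e - 1)"
    by (simp add: algebra_simps)
  also have "\<dots> = ?X * (fps_deriv ?B * (?e - 1) + ?B * ?e) - ?X"
    unfolding bernoulli_fps_mult by (simp add: algebra_simps)
  also have "\<dots> = 0" unfolding d by simp
  finally have 1: "?X * fps_deriv ?B + ?B * ?B * ?e - ?B = 0" using e by simp
  have 2: "?B * ?e = ?B + ?X" using bernoulli_fps_mult by (simp add: algebra_simps)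
  have "?B * ?B * ?e = ?B * ?B + ?B * ?X"
    unfolding mult.assoc 2 by (simp add: algebra_simps)
  with 1 have 3: "?X * fps_deriv ?B = ?B - ?B * ?B - ?B * ?X" by (simp add: algebra_simps)
  have h: "fps_const (1/2) + fps_const (1/2) = (1 :: complex fps)" "fps_const (1/2) * fps_const (1/2) = (fps_const (1/4) :: complex fps)"
    by (simp_all add: fps_const_add)
  define H where "H = (fps_const (1/2) :: complex fps)"
  define Q where "Q = (fps_const (1/4) :: complex fps)"
  have HQ: "H + H = 1" "H * H = Q" unfolding H_def Q_def by (rule h)+
  have "?X * fps_deriv b = ?X * fps_deriv ?B + H * ?X"
    unfolding b_def H_def by (simp add: algebra_simps)
  also have "\<dots> = (?B + H * ?X) - (?B * ?B + (H + H) * (?B * ?X) + (H * H) * (?X * ?X)) + Q * ?X ^ 2"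
    unfolding 3 HQ by (simp add: algebra_simps power2_eq_square)
  also have "\<dots> = b - b * b + Q * ?X ^ 2"
    unfolding b_def H_def[symmetric] by (simp add: algebra_simps)
  finally show ?thesis unfolding Q_def .
qed

text \<open>\<open>eisenstein\<close> divides by this number. Were it 0, division by zero would
  erase the q-series and B_2j E_2j could not be matched with a Taylor coefficient.\<close>

lemma bernoulli_fps_even_nonzero:
  assumes "j \<ge> 1"
  shows "fps_nth bernoulli_fps (2 * j) \<noteq> 0"
proof -
  define b where "b = bernoulli_fps + fps_const (1/2) * fps_X"
  have b0: "fps_nth b 0 = 1" by (simp add: b_def bernoulli_fps_nth_0)
  have rec: "of_nat (n + 1) * fps_nth b n =
      -(\<Sum>i\<in>{0<..<n}. fps_nth b i * fps_nth b (n - i)) + (if n = 2 then 1/4 else 0)" if n: "n \<ge> 1" for n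
  proof -
    have "fps_nth (fps_X * fps_deriv b) n = of_nat n * fps_nth b n"
      using n by (cases n) auto
    moreover have "fps_nth (fps_const (1/4) * fps_X ^ 2 :: complex fps) n = (if n = 2 then 1/4 else 0)"
      by (auto simp: fps_X_power_nth)
    ultimately have "of_nat n * fps_nth b n = fps_nth b n - fps_nth (b * b) n + (if n = 2 then 1/4 else 0)"
      using arg_cong[OF bernoulli_fps_riccati, of "\<lambda>f. fps_nth f n"] unfolding b_def[symmetric] by simp
    moreover have "fps_nth (b * b) n = 2 * fps_nth b n + (\<Sum>i\<in>{0<..<n}. fps_nth b i * fps_nth b (n - i))"
    proof -
      have "{0..n} = insert 0 (insert n {0<..<n})" using n by auto
      thus ?thesis using n by (simp add: fps_mult_nth b0)
    qed
    ultimately show ?thesis by (simp add: algebra_simps)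
  qed
  \<comment> \<open>Multiplying by i^n passes from (t/2) coth (t/2) to (t/2) cot (t/2), whose
    coefficients after the first are -r_n. The recursion becomes (n + 1) r_n = (sum of r_i r_(n-i)),
    plus 1/4 if n = 2, with no cancellation.\<close>
  have claim: "n \<ge> 1 \<longrightarrow> (\<exists>r\<ge>0. fps_nth b n * \<i> ^ n = - complex_of_real r \<and> (even n \<longrightarrow> r > 0))" for n
  proof (induction n rule: less_induct)
    case (less n)
    show ?case
    proof (intro impI)
      assume n: "n \<ge> 1"
      obtain r where r: "\<And>i. i \<ge> 1 \<Longrightarrow> i < n \<Longrightarrow> r i \<ge> 0 \<and> fps_nth b i * \<i> ^ i = - complex_of_real (r i) \<and> (even i \<longrightarrow> r i > 0)"
        using less.IH by metis
      define s where "s = ((\<Sum>i\<in>{0<..<n}. r i * r (n - i)) + (if n = 2 then 1/4 else 0)) / (n + 1)"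
      have sum_nonneg: "(\<Sum>i\<in>{0<..<n}. r i * r (n - i)) \<ge> 0"
        by (intro sum_nonneg mult_nonneg_nonneg) (use r in auto)
      have "of_nat (n + 1) * (fps_nth b n * \<i> ^ n) =
          -((\<Sum>i\<in>{0<..<n}. fps_nth b i * fps_nth b (n - i)) * \<i> ^ n) + (if n = 2 then 1/4 else 0) * \<i> ^ n"
        unfolding mult.assoc[symmetric] rec[OF n] by (simp add: algebra_simps)
      also have "(\<Sum>i\<in>{0<..<n}. fps_nth b i * fps_nth b (n - i)) * \<i> ^ n =
          (\<Sum>i\<in>{0<..<n}. (fps_nth b i * \<i> ^ i) * (fps_nth b (n - i) * \<i> ^ (n - i)))"
        unfolding sum_distrib_right
      proof (intro sum.cong refl)
        fix i assume "i \<in> {0<..<n}"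
        hence "\<i> ^ n = \<i> ^ i * \<i> ^ (n - i)" by (simp flip: power_add)
        thus "fps_nth b i * fps_nth b (n - i) * \<i> ^ n = (fps_nth b i * \<i> ^ i) * (fps_nth b (n - i) * \<i> ^ (n - i))"
          by simp
      qed
      also have "\<dots> = (\<Sum>i\<in>{0<..<n}. complex_of_real (r i * r (n - i)))"
        by (intro sum.cong refl) (use r in auto)
      also have "(if n = 2 then 1/4 else 0) * \<i> ^ n = - complex_of_real (if n = 2 then 1/4 else 0)"
        by auto
      finally have "of_nat (n + 1) * (fps_nth b n * \<i> ^ n) =
          - complex_of_real ((\<Sum>i\<in>{0<..<n}. r i * r (n - i)) + (if n = 2 then 1/4 else 0))"
        by simp
      also have "(\<Sum>i\<in>{0<..<n}. r i * r (n - i)) + (if n = 2 then 1/4 else 0) = real (n + 1) * s"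
        unfolding s_def by simp
      finally have "of_nat (n + 1) * (fps_nth b n * \<i> ^ n) = of_nat (n + 1) * (- complex_of_real s)"
        by simp
      moreover have "of_nat (n + 1) \<noteq> (0 :: complex)" by (simp only: of_nat_eq_0_iff)
      ultimately have eq: "fps_nth b n * \<i> ^ n = - complex_of_real s"
        using mult_left_cancel by blast
      have "s \<ge> 0" unfolding s_def using sum_nonneg by simp
      moreover have "s > 0" if "even n"
      proof (cases "n = 2")
        case True
        thus ?thesis using sum_nonneg by (simp add: s_def)
      next
        case False
        with n that have n4: "n \<ge> 4" by (auto elim!: evenE)
        \<comment> \<open>The value r_2 is positive by the extra 1/4; from there a single product
          r_2 r_(n-2) keeps the even terms positive.\<close>
        have "0 < r 2 * r (n - 2)" using r[of 2] r[of "n - 2"] n4 that by (intro mult_pos_pos) auto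
        also have "\<dots> \<le> (\<Sum>i\<in>{0<..<n}. r i * r (n - i))"
          by (rule member_le_sum) (use r n4 in \<open>auto intro!: mult_nonneg_nonneg\<close>)
        finally show ?thesis using False by (simp add: s_def)
      qed
      ultimately show "\<exists>r\<ge>0. fps_nth b n * \<i> ^ n = - complex_of_real r \<and> (even n \<longrightarrow> r > 0)"
        using eq by blast
    qed
  qed
  from claim[of "2 * j"] assms have "fps_nth b (2 * j) \<noteq> 0" by auto
  moreover have "fps_nth b (2 * j) = fps_nth bernoulli_fps (2 * j)"
    using assms by (cases j) (auto simp: b_def)
  ultimately show ?thesis by simp
qed

section \<open>Lambert series\<close>

lemma summable_power_mult_geometric:
  assumes "0 \<le> x" "x < (1::real)"
  shows "summable (\<lambda>n. real n ^ k * x ^ n)"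
proof (cases "x = 0")
  case True
  thus ?thesis
    by (intro summable_finite[of "{0}"]) auto
next
  case False
  \<comment> \<open>Writing x = exp (-2 \<delta>) splits x^n into two equal factors: one absorbs
    n^k, the other remains geometric.\<close>
  define \<delta> where "\<delta> = -ln x / 2"
  have \<delta>: "\<delta> > 0" using assms False by (simp add: \<delta>_def)
  have x: "x = exp (-2 * \<delta>)" using assms False by (simp add: \<delta>_def)
  show ?thesis
  proof (rule summable_comparison_test')
    show "summable (\<lambda>n. (real k ^ k / \<delta> ^ k) * exp (-\<delta>) ^ n)"
      using \<delta> by (intro summable_mult summable_geometric) simp
    fix n :: nat assume "n \<ge> 0"
    have xn: "x ^ n = exp (-2 * \<delta> * real n)"
      unfolding x by (rule exp_of_nat2_mult[symmetric])
    have "(\<delta> * real n) ^ k \<le> real k ^ k * exp (\<delta> * real n)"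
      using \<delta> by (intro power_le_exp_mult) simp
    hence "real n ^ k \<le> (real k ^ k / \<delta> ^ k) * exp (\<delta> * real n)"
      using \<delta> by (simp add: power_mult_distrib field_simps)
    hence "real n ^ k * x ^ n \<le> ((real k ^ k / \<delta> ^ k) * exp (\<delta> * real n)) * exp (-2 * \<delta> * real n)"
      unfolding xn using \<delta> by (intro mult_mono) auto
    also have "\<dots> = (real k ^ k / \<delta> ^ k) * exp (-\<delta>) ^ n"
      by (simp add: exp_of_nat2_mult[symmetric] algebra_simps flip: exp_add)
    finally show "norm (real n ^ k * x ^ n) \<le> (real k ^ k / \<delta> ^ k) * exp (-\<delta>) ^ n"
      using assms by simp
  qed
qed

text \<open>Both series are the absolutely convergent double sum of r^k q^(r s) over r, s \<ge> 1.
  Summing over s first gives geometric series; grouping by l = r s gives the divisor sums.\<close>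

lemma lambert_series:
  fixes q :: complex
  assumes q: "norm q < 1"
  shows "((\<lambda>l. of_nat (divisor_sigma k l) * q ^ l) has_sum
          (\<Sum>\<^sub>\<infinity>r\<in>{1..}. of_nat r ^ k * q ^ r / (1 - q ^ r))) {1..}"
    and "(\<lambda>l. norm (of_nat (divisor_sigma k l) * q ^ l)) summable_on {1..}"
proof -
  define f where "f = (\<lambda>(r, s). of_nat r ^ k * q ^ (r * s))"
  let ?A = "{1..} :: nat set"
  have geo: "((\<lambda>s. x ^ s) has_sum x / (1 - x)) ?A" if "norm x < 1" for x :: "'b :: {banach, real_normed_field}"
  proof -
    have "(\<lambda>s. norm (x ^ s)) summable_on UNIV"
      using that by (intro norm_summable_imp_summable_on) (simp add: norm_power summable_geometric)
    hence "((\<lambda>s. x ^ s) has_sum (\<Sum>s. x ^ s)) UNIV"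
      using that by (intro norm_summable_imp_has_sum summable_sums summable_geometric)
        (simp_all add: norm_power summable_geometric)
    hence "((\<lambda>s. x ^ s) has_sum 1 / (1 - x)) UNIV"
      using suminf_geometric[OF that] by simp
    moreover have "((\<lambda>s. x ^ s) has_sum 1) {0::nat}"
      using has_sum_finite[of "{0}" "\<lambda>s. x ^ s"] by simp
    ultimately have "((\<lambda>s. x ^ s) has_sum 1 / (1 - x) - 1) (UNIV - {0::nat})"
      by (intro has_sum_Diff) auto
    moreover have "1 - x \<noteq> 0" using that by auto
    hence "1 / (1 - x) - 1 = x / (1 - x)" by (simp add: field_simps)
    moreover have "UNIV - {0::nat} = ?A" by auto
    ultimately show ?thesis by simp
  qed
  have norm_qr: "norm (q ^ r) < 1" "norm q ^ r \<le> norm q" if "r \<in> ?A" for r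
  proof -
    show *: "norm q ^ r \<le> norm q"
      using power_decreasing[of 1 r "norm q"] that q by simp
    thus "norm (q ^ r) < 1" using q by (simp add: norm_power)
  qed
  have "(\<lambda>x. norm (f x)) summable_on (SIGMA r:?A. ?A)"
  proof (rule summable_on_SigmaI)
    fix r assume r: "r \<in> ?A"
    show "((\<lambda>s. norm (f (r, s))) has_sum real r ^ k * (norm (q ^ r) / (1 - norm (q ^ r)))) ?A"
      using has_sum_cmult_right[OF geo[of "norm (q ^ r)"], of "real r ^ k"] norm_qr(1)[OF r]
      by (simp add: f_def norm_mult norm_power power_mult)
  next
    have "(\<lambda>r. real r ^ k * norm q ^ r / (1 - norm q)) summable_on UNIV"
    proof (intro norm_summable_imp_summable_on)
      have "summable (\<lambda>r. real r ^ k * norm q ^ r)"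
        using q by (intro summable_power_mult_geometric) auto
      hence "summable (\<lambda>r. real r ^ k * norm q ^ r / (1 - norm q))"
        by (rule summable_divide)
      thus "summable (\<lambda>r. norm (real r ^ k * norm q ^ r / (1 - norm q)))"
        using q by simp
    qed
    hence "(\<lambda>r. real r ^ k * norm q ^ r / (1 - norm q)) summable_on ?A"
      by (rule summable_on_subset_banach) auto
    thus "(\<lambda>r. real r ^ k * (norm (q ^ r) / (1 - norm (q ^ r)))) summable_on ?A"
    proof (rule summable_on_comparison_test)
      fix r assume r: "r \<in> ?A"
      have "norm q ^ r / (1 - norm q ^ r) \<le> norm q ^ r / (1 - norm q)"
        using norm_qr(2)[OF r] q by (intro divide_left_mono mult_pos_pos) auto
      hence "real r ^ k * (norm q ^ r / (1 - norm q ^ r)) \<le> real r ^ k * (norm q ^ r / (1 - norm q))"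
        by (intro mult_left_mono) auto
      thus "real r ^ k * (norm (q ^ r) / (1 - norm (q ^ r))) \<le> real r ^ k * norm q ^ r / (1 - norm q)"
        by (simp add: norm_power)
      show "0 \<le> real r ^ k * (norm (q ^ r) / (1 - norm (q ^ r)))"
        using norm_qr(1)[OF r] by simp
    qed
  qed auto
  hence abs: "(\<lambda>x. norm (f x)) summable_on ?A \<times> ?A" by simp
  hence sm: "f summable_on ?A \<times> ?A" by (rule abs_summable_summable)
  have rows: "infsum f (?A \<times> ?A) = (\<Sum>\<^sub>\<infinity>r\<in>?A. of_nat r ^ k * q ^ r / (1 - q ^ r))"
  proof -
    have "infsum f (?A \<times> ?A) = (\<Sum>\<^sub>\<infinity>r\<in>?A. \<Sum>\<^sub>\<infinity>s\<in>?A. f (r, s))"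
      using infsum_Sigma'_banach[of "\<lambda>r s. f (r, s)" ?A "\<lambda>_. ?A"] sm by simp
    also have "\<dots> = (\<Sum>\<^sub>\<infinity>r\<in>?A. of_nat r ^ k * q ^ r / (1 - q ^ r))"
    proof (rule infsum_cong)
      fix r assume r: "r \<in> ?A"
      have "((\<lambda>s. f (r, s)) has_sum of_nat r ^ k * (q ^ r / (1 - q ^ r))) ?A"
        using has_sum_cmult_right[OF geo[OF norm_qr(1)[OF r]], of "of_nat r ^ k"]
        by (simp add: f_def power_mult)
      thus "(\<Sum>\<^sub>\<infinity>s\<in>?A. f (r, s)) = of_nat r ^ k * q ^ r / (1 - q ^ r)"
        by (simp add: infsumI)
    qed
    finally show ?thesis .
  qed
  define D where "D = (\<lambda>l::nat. {r. r dvd l})"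
  define g where "g = (\<lambda>(l, r). (of_nat r ^ k * q ^ l :: complex))"
  have bij: "bij_betw (\<lambda>(l, r). (r, l div r)) (SIGMA l:?A. D l) (?A \<times> ?A)"
  proof (rule bij_betwI[where g = "\<lambda>(r, s). (r * s, r)"])
    show "(\<lambda>(l, r). (r, l div r)) \<in> (SIGMA l:?A. D l) \<rightarrow> ?A \<times> ?A"
      by (auto simp: D_def Suc_le_eq elim!: dvdE)
  qed (auto simp: D_def Suc_le_eq)
  have fg: "f (case x of (l, r) \<Rightarrow> (r, l div r)) = g x" if "x \<in> (SIGMA l:?A. D l)" for x
    using that by (auto simp: f_def g_def D_def)
  have "((\<lambda>x. f (case x of (l, r) \<Rightarrow> (r, l div r))) has_sum infsum f (?A \<times> ?A)) (SIGMA l:?A. D l)"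
    using has_sum_reindex_bij_betw[OF bij, of f] has_sum_infsum[OF sm] by blast
  hence hs: "(g has_sum infsum f (?A \<times> ?A)) (SIGMA l:?A. D l)"
    using has_sum_cong[of "SIGMA l:?A. D l" "\<lambda>x. f (case x of (l, r) \<Rightarrow> (r, l div r))" g] fg by blast
  have "(\<lambda>x. norm (f (case x of (l, r) \<Rightarrow> (r, l div r)))) summable_on (SIGMA l:?A. D l)"
    using summable_on_reindex_bij_betw[OF bij, of "\<lambda>x. norm (f x)"] abs by blast
  hence ghs: "(\<lambda>x. norm (g x)) summable_on (SIGMA l:?A. D l)"
    using summable_on_cong[of "SIGMA l:?A. D l" "\<lambda>x. norm (f (case x of (l, r) \<Rightarrow> (r, l div r)))" "\<lambda>x. norm (g x)"] fg
    by simp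
  have fin: "finite (D l)" if "l \<in> ?A" for l using that by (auto simp: D_def)
  have col: "((\<lambda>r. g (l, r)) has_sum of_nat (divisor_sigma k l) * q ^ l) (D l)" if "l \<in> ?A" for l
    using has_sum_finite[OF fin[OF that], of "\<lambda>r. g (l, r)"]
    by (simp add: g_def divisor_sigma_def D_def sum_distrib_right)
  show "((\<lambda>l. of_nat (divisor_sigma k l) * q ^ l) has_sum
          (\<Sum>\<^sub>\<infinity>r\<in>{1..}. of_nat r ^ k * q ^ r / (1 - q ^ r))) {1..}"
    using has_sum_SigmaD[OF hs col] rows by simp
  have coln: "((\<lambda>r. norm (g (l, r))) has_sum norm (of_nat (divisor_sigma k l) * q ^ l)) (D l)" if "l \<in> ?A" for l
  proof -
    have "norm (of_nat (divisor_sigma k l) * q ^ l) = (\<Sum>r\<in>D l. norm (g (l, r)))"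
      unfolding norm_mult norm_of_nat by (simp add: g_def divisor_sigma_def D_def sum_distrib_right norm_mult norm_power)
    thus ?thesis using has_sum_finite[OF fin[OF that], of "\<lambda>r. norm (g (l, r))"] by simp
  qed
  have "((\<lambda>x. norm (g x)) has_sum infsum (\<lambda>x. norm (g x)) (SIGMA l:?A. D l)) (SIGMA l:?A. D l)"
    using ghs by (rule has_sum_infsum)
  from has_sum_SigmaD[OF this coln] show "(\<lambda>l. norm (of_nat (divisor_sigma k l) * q ^ l)) summable_on {1..}"
    using has_sum_imp_summable by blast
qed

section \<open>Laurent coefficients and the Eisenstein series\<close>

text \<open>With k = 1/(c\<tau> + d) this turns a transformation law in z into laws for the Laurent
  coefficients; with k = -1 it turns evenness into the vanishing of odd coefficients.\<close>

lemma has_laurent_expansion_scale: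
  assumes "f has_laurent_expansion F" "k \<noteq> (0 :: complex)"
  obtains G where "(\<lambda>z. f (k * z)) has_laurent_expansion G" "\<And>n. fls_nth G n = k powi n * fls_nth F n"
proof
  have "(\<lambda>z. k * z) has_laurent_expansion fps_to_fls (fps_const k * fps_X)"
    by (intro has_laurent_expansion_fps fps_expansion_intros)
  moreover have "fps_const k * fps_X \<noteq> (0 :: complex fps)" using assms(2) by simp
  ultimately show "(\<lambda>z. f (k * z)) has_laurent_expansion fls_compose_fps F (fps_const k * fps_X)"
    using has_laurent_expansion_compose[OF assms(1)] by (fastforce simp: o_def)
  show "fls_nth (fls_compose_fps F (fps_const k * fps_X)) n = k powi n * fls_nth F n" for n
    using fls_nth_fls_compose_fps_linear[OF assms(2)] by simp
qed

lemma laurent_inverse_exp_minus_1: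
  assumes c: "c \<noteq> (0 :: complex)"
  defines "B \<equiv> fps_compose bernoulli_fps (fps_const c * fps_X)"
  shows "(\<lambda>z. 1 / (exp (c * z) - 1)) has_laurent_expansion fls_const (1 / c) * fls_shift 1 (fps_to_fls B)"
proof -
  define F where "F = fls_const (1 / c) * fls_shift 1 (fps_to_fls B)"
  have "B * (fps_exp c - 1) = fps_compose (bernoulli_fps * (fps_exp 1 - 1)) (fps_const c * fps_X)"
    unfolding B_def by (simp add: fps_compose_mult_distrib fps_compose_sub_distrib)
  also have "\<dots> = fps_const c * fps_X"
    unfolding bernoulli_fps_mult by (simp add: fps_X_fps_compose_startby0)
  finally have B: "B * (fps_exp c - 1) = fps_const c * fps_X" .
  have "F * fps_to_fls (fps_exp c - 1) = fls_const (1 / c) * fls_shift 1 (fps_to_fls (B * (fps_exp c - 1)))"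
    unfolding F_def by (simp only: mult.assoc fls_shifted_times_simps fls_times_fps_to_fls)
  also have "\<dots> = 1"
    unfolding B by (rule fls_eqI) (use c in \<open>auto simp: fls_times_fps_to_fls nat_eq_iff\<close>)
  finally have *: "F * fps_to_fls (fps_exp c - 1) = 1" .
  hence "F = 1 / fps_to_fls (fps_exp c - 1)"
    by (metis mult_zero_right nonzero_eq_divide_eq zero_neq_one)
  moreover have "(\<lambda>z. 1 / (exp (c * z) - 1)) has_laurent_expansion 1 / fps_to_fls (fps_exp c - 1)"
    by (intro laurent_expansion_intros has_laurent_expansion_fps fps_expansion_intros)
  ultimately show ?thesis by (simp add: F_def)
qed

text \<open>The function is -1/c times the derivative of 1/(exp (c z) - 1), whose expansion is the
  Bernoulli series in c z divided by c z. Differentiation produces the factor n + 1, which removes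
  the coefficient at n = -1.\<close>

lemma laurent_exp_over_square:
  assumes c: "c \<noteq> (0 :: complex)"
  obtains G where "(\<lambda>z. exp (c * z) / (1 - exp (c * z))\<^sup>2) has_laurent_expansion G"
    "\<And>n. fls_nth G n = (if n < -2 then 0 else -of_int (n + 1) * c powi n * fps_nth bernoulli_fps (nat (n + 2)))"
proof -
  define F where "F = fls_const (1 / c) * fls_shift 1 (fps_to_fls (fps_compose bernoulli_fps (fps_const c * fps_X)))"
  have F: "(\<lambda>z. 1 / (exp (c * z) - 1)) has_laurent_expansion F"
    unfolding F_def by (rule laurent_inverse_exp_minus_1[OF c])
  have ev: "eventually (\<lambda>z. exp (c * z) \<noteq> 1) (at 0)"
  proof -
    have "F \<noteq> 0"
    proof
      assume "F = 0"
      hence "fls_nth F (-1) = 0" by simp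
      thus False using c by (simp add: F_def bernoulli_fps_nth_0)
    qed
    from has_laurent_expansion_nonzero_imp_eventually_nonzero[OF F this]
    show ?thesis by eventually_elim auto
  qed
  then obtain A where A: "open A" "0 \<in> A" "\<And>z. z \<in> A - {0} \<Longrightarrow> exp (c * z) \<noteq> 1"
    by (auto simp: eventually_at_topological)
  have "(\<lambda>z. - c * exp (c * z) / (exp (c * z) - 1)\<^sup>2) has_laurent_expansion fls_deriv F"
  proof (rule has_laurent_expansion_deriv'[OF F A(1,2)])
    fix z assume z: "z \<in> A - {0}"
    show "((\<lambda>z. 1 / (exp (c * z) - 1)) has_field_derivative - c * exp (c * z) / (exp (c * z) - 1)\<^sup>2) (at z)"
      using A(3)[OF z] by (auto intro!: derivative_eq_intros simp: power2_eq_square)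
  qed
  from has_laurent_expansion_cmult_left[OF this, of "-1/c"]
  have "(\<lambda>z. (-1/c) * (- c * exp (c * z) / (exp (c * z) - 1)\<^sup>2)) has_laurent_expansion fls_const (-1/c) * fls_deriv F" .
  also have "(\<lambda>z. (-1/c) * (- c * exp (c * z) / (exp (c * z) - 1)\<^sup>2)) = (\<lambda>z. exp (c * z) / (1 - exp (c * z))\<^sup>2)"
    using c by (simp add: fun_eq_iff power2_commute)
  finally show ?thesis
  proof (rule that)
    fix n :: int
    show "fls_nth (fls_const (-1/c) * fls_deriv F) n =
        (if n < -2 then 0 else -of_int (n + 1) * c powi n * fps_nth bernoulli_fps (nat (n + 2)))"
    proof (cases "n < -2")
      case False
      hence "c ^ nat (n + 2) = c powi (n + 2)" by (simp add: power_int_def)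
      also have "\<dots> = c powi n * c\<^sup>2" using c by (simp add: power_int_add)
      finally have "c ^ nat (n + 2) = c powi n * c\<^sup>2" .
      moreover have "fls_nth F (n + 1) = c ^ nat (n + 2) * fps_nth bernoulli_fps (nat (n + 2)) / c"
        using False by (simp add: F_def add.commute)
      ultimately show ?thesis using c False
        by (simp add: power2_eq_square field_simps)
    qed (simp add: F_def)
  qed
qed

text \<open>At 0 both exponentials equal 1, and in even order their derivatives have the same sign,
  hence the factor 2. The 1/r in \<open>lambert_coeff\<close> lowers the power of r to 2 m - 1, and
  a Lambert series remains.\<close>

lemma theta_log_taylor_even:
  assumes \<tau>: "Im \<tau> > 0" and m: "m \<ge> 1"
  shows "(deriv ^^ (2 * m)) (\<lambda>z. theta_log z \<tau>) 0 =
    2 * (tpi) ^ (2 * m) * (\<Sum>\<^sub>\<infinity>l\<in>{1..}. of_nat (divisor_sigma (2 * m - 1) l) * exp (tpi * \<tau>) ^ l)"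
proof -
  define q where "q = exp (tpi * \<tau>)"
  define c where "c = tpi"
  have "0 \<in> strip \<tau>" using \<tau> by (simp add: strip_def)
  from theta_log_higher_deriv[OF \<tau> this, of "2 * m"]
  have "((\<lambda>r. lambert_coeff r \<tau> * ((c * of_nat r) ^ (2 * m) + (-(c * of_nat r)) ^ (2 * m))) has_sum
      (deriv ^^ (2 * m)) (\<lambda>z. theta_log z \<tau>) 0) UNIV" by (simp add: c_def)
  also have "(\<lambda>r. lambert_coeff r \<tau> * ((c * of_nat r) ^ (2 * m) + (-(c * of_nat r)) ^ (2 * m))) =
      (\<lambda>r. 2 * c ^ (2 * m) * (of_nat r ^ (2 * m - 1) * q ^ r / (1 - q ^ r)))"
  proof
    fix r
    show "lambert_coeff r \<tau> * ((c * of_nat r) ^ (2 * m) + (-(c * of_nat r)) ^ (2 * m)) =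
        2 * c ^ (2 * m) * (of_nat r ^ (2 * m - 1) * q ^ r / (1 - q ^ r))"
    proof (cases "r = 0")
      case True
      thus ?thesis using m by (simp add: power_0_left)
    next
      case False
      have "2 * m = Suc (2 * m - 1)" using m by simp
      hence "(of_nat r :: complex) ^ (2 * m) = of_nat r * of_nat r ^ (2 * m - 1)" by (metis power_Suc)
      thus ?thesis using False
        unfolding lambert_coeff_def q_def[symmetric] power_mult_distrib by (simp add: power_mult_distrib)
    qed
  qed
  finally have "((\<lambda>r. 2 * c ^ (2 * m) * (of_nat r ^ (2 * m - 1) * q ^ r / (1 - q ^ r))) has_sum
      (deriv ^^ (2 * m)) (\<lambda>z. theta_log z \<tau>) 0) UNIV" .
  hence "(deriv ^^ (2 * m)) (\<lambda>z. theta_log z \<tau>) 0 =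
      (\<Sum>\<^sub>\<infinity>r. 2 * c ^ (2 * m) * (of_nat r ^ (2 * m - 1) * q ^ r / (1 - q ^ r)))"
    by (simp add: infsumI)
  also have "\<dots> = 2 * c ^ (2 * m) * (\<Sum>\<^sub>\<infinity>r. of_nat r ^ (2 * m - 1) * q ^ r / (1 - q ^ r))"
    by (rule infsum_cmult_right')
  also have "(\<Sum>\<^sub>\<infinity>r. of_nat r ^ (2 * m - 1) * q ^ r / (1 - q ^ r)) =
      (\<Sum>\<^sub>\<infinity>r\<in>{1..}. of_nat r ^ (2 * m - 1) * q ^ r / (1 - q ^ r))"
    by (rule infsum_cong_neutral) (auto simp: Suc_le_eq)
  also have "\<dots> = (\<Sum>\<^sub>\<infinity>l\<in>{1..}. of_nat (divisor_sigma (2 * m - 1) l) * q ^ l)"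
    using infsumI[OF lambert_series(1)[of q "2 * m - 1"]] norm_q_less_1[OF \<tau>] by (simp add: q_def)
  finally show ?thesis by (simp only: q_def c_def)
qed

text \<open>The factor B_2j cancels the one in the denominator of the Eisenstein series. In this
  form the product is recognised as a Taylor coefficient and its analytic properties are those of
  the divisor series.\<close>

lemma bernoulli_eisenstein:
  assumes "j \<ge> 1"
  shows "bernoulli_num (2 * j) / fact (2 * j) * eisenstein (2 * j) \<tau> = fps_nth bernoulli_fps (2 * j) -
    2 / fact (2 * j - 1) * (\<Sum>\<^sub>\<infinity>l\<in>{1..}. of_nat (divisor_sigma (2 * j - 1) l) * exp (tpi * \<tau>) ^ l)"
proof -
  define S where "S = (\<Sum>\<^sub>\<infinity>l\<in>{1..}. of_nat (divisor_sigma (2 * j - 1) l) * exp (tpi * \<tau>) ^ l)"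
  define B where "B = fps_nth bernoulli_fps (2 * j)"
  have "B \<noteq> 0" unfolding B_def by (rule bernoulli_fps_even_nonzero[OF assms])
  have f: "fact (2 * j) = (of_nat (2 * j) * fact (2 * j - 1) :: complex)"
    using assms fact_reduce[of "2 * j"] by simp
  have j: "of_nat (2 * j) \<noteq> (0 :: complex)" using assms by simp
  have k: "of_nat (2 * (2 * j)) = 2 * (of_nat (2 * j) :: complex)" by simp
  show ?thesis
    unfolding eisenstein_def bernoulli_num_altdef S_def[symmetric] B_def[symmetric] f k
    using \<open>B \<noteq> 0\<close> j by (simp add: field_simps del: of_nat_mult)
qed

definition wp_laurent :: "complex \<Rightarrow> complex fls" where
  "wp_laurent \<tau> = laurent_expansion (\<lambda>z. theta_wp z \<tau>) 0"

text \<open>The coefficient of z^(2j-2) has two sources: \<zeta>/(1 - \<zeta>)^2 supplies the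
  Bernoulli number and the second derivative of \<open>theta_log\<close> supplies the divisor sums.
  These are the constant term and the q-series of E_2j.\<close>

lemma
  assumes \<tau>: "Im \<tau> > 0"
  shows has_laurent_theta_wp: "(\<lambda>z. theta_wp z \<tau>) has_laurent_expansion wp_laurent \<tau>"
    and wp_laurent_minus2: "fls_nth (wp_laurent \<tau>) (-2) = 1 / (tpi)\<^sup>2"
    and wp_laurent_neg: "n < 0 \<Longrightarrow> n \<noteq> -2 \<Longrightarrow> fls_nth (wp_laurent \<tau>) n = 0"
    and wp_laurent_even: "j \<ge> 1 \<Longrightarrow> fls_nth (wp_laurent \<tau>) (2 * int j - 2) =
      -of_nat (2 * j - 1) * (tpi) ^ (2 * j - 2) *
        (bernoulli_num (2 * j) / fact (2 * j) * eisenstein (2 * j) \<tau>)"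
proof -
  define c where "c = tpi"
  have c: "c \<noteq> 0" by (simp add: c_def)
  obtain G where G: "(\<lambda>z. exp (c * z) / (1 - exp (c * z))\<^sup>2) has_laurent_expansion G"
    "\<And>n. fls_nth G n = (if n < -2 then 0 else -of_int (n + 1) * c powi n * fps_nth bernoulli_fps (nat (n + 2)))"
    using laurent_exp_over_square[OF c] by blast
  define L where "L = (\<lambda>z. theta_log z \<tau>)"
  have "0 \<in> strip \<tau>" using \<tau> by (simp add: strip_def)
  have "(deriv ^^ 2) L holomorphic_on strip \<tau>"
    unfolding L_def by (intro holomorphic_higher_deriv theta_log_holomorphic[OF \<tau>] open_strip)
  hence H: "(deriv ^^ 2) L has_fps_expansion fps_expansion ((deriv ^^ 2) L) 0"
    by (rule has_fps_expansion_fps_expansion[OF open_strip \<open>0 \<in> strip \<tau>\<close>])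
  define H where "H = fps_expansion ((deriv ^^ 2) L) 0"
  have H_nth: "fps_nth H n = (deriv ^^ (n + 2)) L 0 / fact n" for n
  proof -
    have "(deriv ^^ (n + 2)) L = (deriv ^^ n) ((deriv ^^ 2) L)"
      by (simp only: funpow_add o_apply)
    thus ?thesis by (simp only: H_def fps_expansion_def fps_nth_Abs_fps)
  qed
  define W where "W = G + fps_to_fls H * fls_const (1 / c\<^sup>2)"
  have W0: "(\<lambda>z. exp (c * z) / (1 - exp (c * z))\<^sup>2 + (deriv ^^ 2) L z * (1 / c\<^sup>2)) has_laurent_expansion W"
    unfolding W_def by (intro laurent_expansion_intros G has_laurent_expansion_fps H[folded H_def])
  have "eventually (\<lambda>z. z \<in> ball 0 (min 1 (Im \<tau>)) - {0}) (at 0)"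
    using \<tau> by (intro eventually_at_in_open) auto
  hence "eventually (\<lambda>z. exp (c * z) / (1 - exp (c * z))\<^sup>2 + (deriv ^^ 2) L z * (1 / c\<^sup>2) = theta_wp z \<tau>) (at 0)"
  proof eventually_elim
    case (elim z)
    hence "z \<in> strip \<tau> - \<int>" using punctured_ball_subset_strip[of 0 "min 1 (Im \<tau>)" \<tau>] by auto
    thus ?case using theta_wp_strip[OF \<tau>] by (simp add: c_def L_def)
  qed
  from iffD1[OF has_laurent_expansion_cong[OF this refl] W0]
  have W: "(\<lambda>z. theta_wp z \<tau>) has_laurent_expansion W" .
  hence W_eq: "wp_laurent \<tau> = W"
    unfolding wp_laurent_def by (rule laurent_expansion_0_eqI)
  show "(\<lambda>z. theta_wp z \<tau>) has_laurent_expansion wp_laurent \<tau>" using W W_eq by simp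
  show "fls_nth (wp_laurent \<tau>) (-2) = 1 / (tpi)\<^sup>2"
    unfolding W_eq c_def[symmetric]
    by (simp add: W_def G(2) bernoulli_fps_nth_0 power_int_minus divide_inverse)
  show "fls_nth (wp_laurent \<tau>) n = 0" if "n < 0" "n \<noteq> -2"
  proof (cases "n = -1")
    case False
    hence "n < -2" using that by simp
    thus ?thesis unfolding W_eq by (simp add: W_def G(2))
  qed (simp add: W_eq W_def G(2))
  show "fls_nth (wp_laurent \<tau>) (2 * int j - 2) = -of_nat (2 * j - 1) * (tpi) ^ (2 * j - 2) *
        (bernoulli_num (2 * j) / fact (2 * j) * eisenstein (2 * j) \<tau>)" if j: "j \<ge> 1"
  proof -
    define S where "S = (\<Sum>\<^sub>\<infinity>l\<in>{1..}. of_nat (divisor_sigma (2 * j - 1) l) * exp (tpi * \<tau>) ^ l)"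
    define C where "C = c ^ (2 * j - 2)"
    define f where "f = (fact (2 * j - 2) :: complex)"
    define k where "k = (of_nat (2 * j - 1) :: complex)"
    have n: "nat (2 * int j - 2 + 2) = 2 * j" "nat (2 * int j - 2) = 2 * j - 2" "2 * j - 2 + 2 = 2 * j" "nat (2 * int j) = 2 * j"
      using j by auto
    have nz: "f \<noteq> 0" "k \<noteq> 0"
      unfolding f_def k_def of_nat_eq_0_iff using j by auto
    have fact: "fact (2 * j - 1) = k * f"
    proof -
      have "0 < 2 * j - 1" using j by simp
      from fact_reduce[OF this, where 'a = complex] show ?thesis
        unfolding k_def f_def by (simp only: diff_diff_left one_add_one)
    qed
    have cp: "c ^ (2 * j) = C * c\<^sup>2" unfolding C_def power_add[symmetric] n(3) ..
    have "c powi (2 * int j - 2) = C" using j by (simp add: C_def power_int_def n)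
    moreover have "of_int (2 * int j - 2 + 1) = k" using j by (simp add: k_def of_nat_diff)
    ultimately have 1: "fls_nth G (2 * int j - 2) = -k * C * fps_nth bernoulli_fps (2 * j)"
      using j unfolding G(2) by (simp add: n)
    have 2: "fps_nth H (2 * j - 2) = 2 * (C * c\<^sup>2) * S / f"
      unfolding H_nth n(3) L_def theta_log_taylor_even[OF \<tau> j] S_def[symmetric]
      unfolding c_def[symmetric] cp f_def ..
    have "fls_nth W (2 * int j - 2) = -k * C * fps_nth bernoulli_fps (2 * j) + (2 * (C * c\<^sup>2) * S / f) * (1 / c\<^sup>2)"
      using j unfolding W_def by (simp add: 1 2 n)
    also have "\<dots> = -k * C * (fps_nth bernoulli_fps (2 * j) - 2 / (k * f) * S)"
      using nz c by (simp add: field_simps)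
    finally show ?thesis
      unfolding W_eq bernoulli_eisenstein[OF j] fact S_def[symmetric]
      unfolding c_def[symmetric] C_def[symmetric] k_def[symmetric] .
  qed
qed

text \<open>Comparison of the coefficients of z^(2j-2) in the transformation law of
  \<open>theta_wp\<close>. The correction there is independent of z, so it reaches only the constant
  term, j = 1; this is the defect of E_2.\<close>

lemma bernoulli_eisenstein_modular:
  fixes a b c d :: int
  assumes det: "a * d - b * c = 1" and \<tau>: "Im \<tau> > 0" and j: "j \<ge> 1"
  defines "s \<equiv> of_int c * \<tau> + of_int d"
  defines "\<tau>' \<equiv> (of_int a * \<tau> + of_int b) / s"
  shows "bernoulli_num (2 * j) / fact (2 * j) * eisenstein (2 * j) \<tau>' =
    s ^ (2 * j) * (bernoulli_num (2 * j) / fact (2 * j) * eisenstein (2 * j) \<tau> +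
      (if j = 1 then of_int c / (tpi * s) else 0))"
proof -
  let ?b = "\<lambda>\<tau>. bernoulli_num (2 * j) / fact (2 * j) * eisenstein (2 * j) \<tau>"
  have s: "s \<noteq> 0" unfolding s_def by (rule autfac_nonzero[OF det \<tau>])
  have \<tau>': "Im \<tau>' > 0"
    unfolding \<tau>'_def s_def Im_moebius[OF det \<tau>] using \<tau> s by (simp add: s_def)
  obtain G where G: "(\<lambda>z. theta_wp ((1 / s) * z) \<tau>') has_laurent_expansion G"
    "\<And>n. fls_nth G n = (1 / s) powi n * fls_nth (wp_laurent \<tau>') n"
    using has_laurent_expansion_scale[OF has_laurent_theta_wp[OF \<tau>'], of "1 / s"] s by auto
  have "eventually (\<lambda>z. z \<in> ball 0 (min 1 (Im \<tau>)) - {0}) (at 0)"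
    using \<tau> by (intro eventually_at_in_open) auto
  hence "eventually (\<lambda>z. theta_wp ((1 / s) * z) \<tau>' = s\<^sup>2 * (theta_wp z \<tau> - of_int c / (tpi * s))) (at 0)"
  proof eventually_elim
    case (elim z)
    hence "z \<in> strip \<tau> - \<int>" using punctured_ball_subset_strip[of 0 "min 1 (Im \<tau>)" \<tau>] by auto
    hence "jtheta z \<tau> \<noteq> 0" using jtheta_eq_0_iff_strip[OF \<tau>] by auto
    from theta_wp_modular[OF det \<tau> this] show ?case by (simp add: s_def \<tau>'_def)
  qed
  from iffD1[OF has_laurent_expansion_cong[OF this refl] G(1)]
  have "(\<lambda>z. s\<^sup>2 * (theta_wp z \<tau> - of_int c / (tpi * s))) has_laurent_expansion G" .
  moreover have "(\<lambda>z. s\<^sup>2 * (theta_wp z \<tau> - of_int c / (tpi * s))) has_laurent_expansion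
      fls_const (s\<^sup>2) * (wp_laurent \<tau> - fls_const (of_int c / (tpi * s)))"
    by (intro laurent_expansion_intros has_laurent_theta_wp[OF \<tau>])
  ultimately have "G = fls_const (s\<^sup>2) * (wp_laurent \<tau> - fls_const (of_int c / (tpi * s)))"
    by (rule has_laurent_expansion_unique)
  hence "(1 / s) powi (2 * int j - 2) * fls_nth (wp_laurent \<tau>') (2 * int j - 2) =
      s\<^sup>2 * (fls_nth (wp_laurent \<tau>) (2 * int j - 2) -
        (if j = 1 then of_int c / (tpi * s) else 0))"
    using G(2)[of "2 * int j - 2"] j by (auto simp: fls_const_nth)
  hence eq: "(1 / s) powi (2 * int j - 2) * (-of_nat (2 * j - 1) * (tpi) ^ (2 * j - 2) * ?b \<tau>') =
      s\<^sup>2 * (-of_nat (2 * j - 1) * (tpi) ^ (2 * j - 2) * ?b \<tau> -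
        (if j = 1 then of_int c / (tpi * s) else 0))"
    by (simp only: wp_laurent_even[OF \<tau> j] wp_laurent_even[OF \<tau>' j])
  define N where "N = (of_nat (2 * j - 1) * (tpi) ^ (2 * j - 2) :: complex)"
  define e where "e = (if j = 1 then of_int c / (tpi * s) else 0)"
  have N: "N \<noteq> 0" using j unfolding N_def by (auto simp: of_nat_eq_0_iff simp del: of_nat_diff)
  have "(1 / s) powi (2 * int j - 2) = inverse (s ^ (2 * j - 2))"
    using j by (simp add: power_int_def nat_diff_distrib nat_mult_distrib divide_inverse power_inverse)
  with eq have "inverse (s ^ (2 * j - 2)) * (-N * ?b \<tau>') = s\<^sup>2 * (-N * ?b \<tau> - e)"
    by (simp add: N_def e_def)
  hence "s ^ (2 * j - 2) * (inverse (s ^ (2 * j - 2)) * (-N * ?b \<tau>')) = s ^ (2 * j - 2) * (s\<^sup>2 * (-N * ?b \<tau> - e))"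
    by (rule arg_cong)
  moreover have "2 * j - 2 + 2 = 2 * j" using j by simp
  hence "s ^ (2 * j) = s ^ (2 * j - 2) * s\<^sup>2" by (metis power_add)
  moreover have "s ^ (2 * j - 2) * (inverse (s ^ (2 * j - 2)) * x) = x" for x
    using s by simp
  ultimately have "-N * ?b \<tau>' = s ^ (2 * j) * (-N * ?b \<tau> - e)"
    by (simp only: mult.assoc)
  moreover have "N * X = N * (S * (Y + e))" if h: "-N * X = S * (-N * Y - e)" for X Y S
  proof -
    \<comment> \<open>Either j = 1, and then N = 1, or j > 1, and then e = 0.\<close>
    have e: "e = N * e" by (simp add: e_def N_def)
    have "N * X = - (-N * X)" by simp
    also have "\<dots> = S * (N * Y + e)" unfolding h by (simp add: algebra_simps)
    also have "\<dots> = S * (N * Y + N * e)" using e by simp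
    finally show ?thesis by (simp add: algebra_simps)
  qed
  ultimately have "N * ?b \<tau>' = N * (s ^ (2 * j) * (?b \<tau> + e))" by blast
  hence "?b \<tau>' = s ^ (2 * j) * (?b \<tau> + e)" using mult_left_cancel[OF N] by blast
  thus ?thesis unfolding e_def .
qed

section \<open>Transformation laws of phi\<close>

text \<open>Numerator and denominator acquire the same factor except for a sign (-1)^l caused by the
  half-period, and the even power m removes it.\<close>

lemma phi_lattice_shift:
  assumes "even m"
  shows "phi m (z + of_int l * \<tau> + of_int k) \<tau> = phi m z \<tau>"
proof -
  have "z + of_int l * \<tau> + of_int k + 1/2 = (z + 1/2) + of_int l * \<tau> + of_int k"
    by (simp add: algebra_simps)
  hence 1: "jtheta (z + of_int l * \<tau> + of_int k + 1/2) \<tau> = (-1) powi (l + k) *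
      exp (-of_real pi * \<i> * (of_int l ^ 2 * \<tau> + 2 * of_int l * (z + 1/2))) * jtheta (z + 1/2) \<tau>"
    by (simp only: jtheta_lattice_shift)
  have 2: "exp (-of_real pi * \<i> * (of_int l ^ 2 * \<tau> + 2 * of_int l * (z + 1/2))) =
      (-1) powi (-l) * exp (-of_real pi * \<i> * (of_int l ^ 2 * \<tau> + 2 * of_int l * z))"
    unfolding exp_pi_i_int[symmetric] exp_add[symmetric]
    by (rule arg_cong[where f = exp]) (simp add: algebra_simps)
  have "phi m (z + of_int l * \<tau> + of_int k) \<tau> = ((-1) powi (-l) * (jtheta (z + 1/2) \<tau> / jtheta z \<tau>)) ^ m"
    unfolding phi_def 1 2 jtheta_lattice_shift by simp
  also have "\<dots> = ((-1) powi (-l)) ^ m * phi m z \<tau>"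
    by (simp only: power_mult_distrib phi_def)
  also have "((-1) powi (-l)) ^ m = (1 :: complex)"
    using assms by (simp add: power_int_minus_left)
  finally show ?thesis by simp
qed

lemma phi_minus:
  assumes "even m"
  shows "phi m (-z) \<tau> = phi m z \<tau>"
proof -
  have "jtheta (-z + 1/2) \<tau> = jtheta (z + 1/2) \<tau>"
    using jtheta_minus[of "z - 1/2" \<tau>] jtheta_plus_1[of "z - 1/2" \<tau>] by (simp add: add.commute)
  thus ?thesis using assms by (simp add: phi_def jtheta_minus)
qed

text \<open>The half-period 1/2 at \<tau>' pulls back to s/2 at \<tau>, and (z + s/2)^2/s - z^2/s =
  z + s/4; the remaining factors cancel. Stated for the full modular group, it serves the character
  on \<Gamma>_0(2) as well as the bounds at all cusps.\<close>

lemma phi_modular: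
  fixes a b c d :: int
  assumes det: "a * d - b * c = 1" and \<tau>: "Im \<tau> > 0"
  defines "s \<equiv> of_int c * \<tau> + of_int d"
  defines "\<tau>' \<equiv> (of_int a * \<tau> + of_int b) / s"
  shows "phi m (z / s) \<tau>' =
    (exp (of_real pi * \<i> * of_int c * (z + s / 4)) * jtheta (z + s / 2) \<tau> / jtheta z \<tau>) ^ m"
proof -
  have s: "s \<noteq> 0" unfolding s_def by (rule autfac_nonzero[OF det \<tau>])
  obtain \<eta> where \<eta>: "\<eta> \<noteq> 0"
    "\<And>z. jtheta (z / s) \<tau>' = \<eta> * exp (of_real pi * \<i> * of_int c * z\<^sup>2 / s) * jtheta z \<tau>"
    using jtheta_modular[OF det \<tau>] unfolding s_def \<tau>'_def by blast
  have "z / s + 1/2 = (z + s / 2) / s" using s by (simp add: field_simps)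
  hence 1: "jtheta (z / s + 1/2) \<tau>' =
      \<eta> * exp (of_real pi * \<i> * of_int c * (z + s / 2)\<^sup>2 / s) * jtheta (z + s / 2) \<tau>"
    by (simp only: \<eta>(2))
  have "(z + s / 2)\<^sup>2 / s = (z + s / 4) + z\<^sup>2 / s"
    using s by (simp add: field_simps power2_eq_square)
  hence "of_real pi * \<i> * of_int c * ((z + s / 2)\<^sup>2 / s) = of_real pi * \<i> * of_int c * ((z + s / 4) + z\<^sup>2 / s)"
    by (rule arg_cong)
  hence "exp (of_real pi * \<i> * of_int c * (z + s / 2)\<^sup>2 / s) =
      exp (of_real pi * \<i> * of_int c * (z + s / 4)) * exp (of_real pi * \<i> * of_int c * z\<^sup>2 / s)"
    unfolding exp_add[symmetric] by (intro arg_cong[where f = exp]) (simp add: ring_distribs)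
  hence 2: "jtheta (z / s + 1/2) \<tau>' = (\<eta> * exp (of_real pi * \<i> * of_int c * z\<^sup>2 / s)) *
      (exp (of_real pi * \<i> * of_int c * (z + s / 4)) * jtheta (z + s / 2) \<tau>)"
    unfolding 1 by (simp only: mult_ac)
  show ?thesis
    unfolding phi_def 2 \<eta>(2) using \<eta>(1) by (subst mult_divide_mult_cancel_left) auto
qed

text \<open>For c = 2 c' and d = 2 d' + 1 the shift s/2 is 1/2 plus the lattice vector c' \<tau> +
  d', so \<phi> returns to itself. The leftover phase exp (pi i c' (d - 2)/2) has m-th power (-1)^(m
  c'/2), as d is odd: the value of \<open>psi\<close>.\<close>

lemma phi_modular_Gamma0:
  fixes a b c d :: int
  assumes det: "a * d - b * c = 1" and c: "even c" and m: "even m" and \<tau>: "Im \<tau> > 0"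
  defines "s \<equiv> of_int c * \<tau> + of_int d"
  defines "\<tau>' \<equiv> (of_int a * \<tau> + of_int b) / s"
  shows "phi m (z / s) \<tau>' = psi m (a, b, c, d) * phi m z \<tau>"
proof -
  obtain c' where c': "c = 2 * c'" using c by blast
  have "odd d" using det c by (metis dvd_diff dvd_mult dvd_mult2 odd_one)
  then obtain d' where d': "d = 2 * d' + 1" by (elim oddE)
  obtain n where n: "m = 2 * n" using m by blast
  have "z + s / 2 = (z + 1/2) + of_int c' * \<tau> + of_int d'"
    by (simp add: s_def c' d' field_simps)
  hence "jtheta (z + s / 2) \<tau> = (-1) powi (c' + d') *
      exp (-of_real pi * \<i> * (of_int c' ^ 2 * \<tau> + 2 * of_int c' * (z + 1/2))) * jtheta (z + 1/2) \<tau>"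
    by (simp only: jtheta_lattice_shift)
  hence "exp (of_real pi * \<i> * of_int c * (z + s / 4)) * jtheta (z + s / 2) \<tau> =
      (-1) powi (c' + d') * (exp (of_real pi * \<i> * of_int c * (z + s / 4)) *
      exp (-of_real pi * \<i> * (of_int c' ^ 2 * \<tau> + 2 * of_int c' * (z + 1/2)))) * jtheta (z + 1/2) \<tau>"
    by (simp only: mult_ac)
  also have "exp (of_real pi * \<i> * of_int c * (z + s / 4)) *
      exp (-of_real pi * \<i> * (of_int c' ^ 2 * \<tau> + 2 * of_int c' * (z + 1/2))) =
      exp (of_real pi * \<i> * (of_int (c' * (d - 2)) / 2))"
    unfolding exp_add[symmetric]
    by (rule arg_cong[where f = exp]) (simp add: s_def c' field_simps power2_eq_square)
  finally have e: "exp (of_real pi * \<i> * of_int c * (z + s / 4)) * jtheta (z + s / 2) \<tau> / jtheta z \<tau> =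
      ((-1) powi (c' + d') * exp (of_real pi * \<i> * (of_int (c' * (d - 2)) / 2))) * (jtheta (z + 1/2) \<tau> / jtheta z \<tau>)"
    by simp
  have "phi m (z / s) \<tau>' =
      (((-1) powi (c' + d')) ^ m * exp (of_real pi * \<i> * (of_int (c' * (d - 2)) / 2)) ^ m) * phi m z \<tau>"
    unfolding phi_modular[OF det \<tau>, folded s_def, folded \<tau>'_def] e
    by (simp only: power_mult_distrib phi_def)
  also have "((-1) powi (c' + d')) ^ m = (1 :: complex)"
    using m by (simp add: power_int_minus_left)
  also have "exp (of_real pi * \<i> * (of_int (c' * (d - 2)) / 2)) ^ m = exp (of_real pi * \<i> * of_int (int n * c' * (d - 2)))"
    unfolding exp_of_nat2_mult[symmetric] by (rule arg_cong[where f = exp]) (simp add: n)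
  also have "\<dots> = (-1) powi (int n * c' * (d - 2))" by (rule exp_pi_i_int)
  also have "\<dots> = (-1) powi (int n * c')"
    using \<open>odd d\<close> by (simp add: power_int_minus_left)
  also have "\<dots> = psi m (a, b, c, d)"
  proof -
    have "int m * c = 4 * (int n * c')" by (simp add: n c')
    thus ?thesis by (simp add: psi_def)
  qed
  finally show ?thesis by simp
qed

section \<open>The Laurent coefficients of phi\<close>

definition theta_fps :: "complex \<Rightarrow> complex \<Rightarrow> complex fps" where
  "theta_fps w \<tau> = Abs_fps (\<lambda>n. (deriv ^^ n) (\<lambda>z. jtheta z \<tau>) w / fact n)"

text \<open>The power series of z^m \<phi>(z; \<tau>): the shift divides theta by its simple zero at
  0, so that what remains is invertible.\<close>

definition phi_fps :: "nat \<Rightarrow> complex \<Rightarrow> complex fps" where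
  "phi_fps m \<tau> = (theta_fps (1/2) \<tau> * inverse (fps_shift 1 (theta_fps 0 \<tau>))) ^ m"

lemma has_fps_expansion_jtheta:
  assumes "Im \<tau> > 0"
  shows "(\<lambda>z. jtheta (w + z) \<tau>) has_fps_expansion theta_fps w \<tau>"
proof -
  have "(\<lambda>z. jtheta z \<tau>) analytic_on {w}"
    using jtheta_holomorphic[OF assms] analytic_on_open[OF open_UNIV] analytic_on_subset by blast
  hence "(\<lambda>z. jtheta (w + z) \<tau>) has_fps_expansion fps_expansion (\<lambda>z. jtheta z \<tau>) w"
    by (rule analytic_at_imp_has_fps_expansion)
  thus ?thesis by (simp add: fps_expansion_def theta_fps_def)
qed

lemma jtheta_deriv_0_nonzero:
  assumes "Im \<tau> > 0"
  shows "deriv (\<lambda>z. jtheta z \<tau>) 0 \<noteq> 0"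
proof -
  obtain C where C: "C \<noteq> 0" "\<And>z. z \<in> strip \<tau> \<Longrightarrow> jtheta z \<tau> = C * theta_prod z \<tau>"
    using jtheta_eq_theta_prod[OF assms] by blast
  have "((\<lambda>z. C * theta_prod z \<tau>) has_field_derivative C * (of_real pi * exp (-theta_log 0 \<tau>))) (at 0)"
    by (intro DERIV_cmult theta_prod_deriv_0[OF assms])
  hence "((\<lambda>z. jtheta z \<tau>) has_field_derivative C * (of_real pi * exp (-theta_log 0 \<tau>))) (at 0)"
    by (rule has_field_derivative_transform_within_open[OF _ open_strip[of \<tau>]])
      (use C assms in \<open>auto simp: strip_def\<close>)
  thus ?thesis using C(1) by (simp add: DERIV_imp_deriv)
qed

lemma theta_fps_0_nth:
  "fps_nth (theta_fps 0 \<tau>) 0 = 0"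
  "Im \<tau> > 0 \<Longrightarrow> fps_nth (fps_shift 1 (theta_fps 0 \<tau>)) 0 \<noteq> 0"
  using jtheta_deriv_0_nonzero[of \<tau>] by (simp_all add: theta_fps_def)

lemma
  assumes \<tau>: "Im \<tau> > 0"
  shows has_laurent_phi: "(\<lambda>z. phi m z \<tau>) has_laurent_expansion laurent_expansion (\<lambda>z. phi m z \<tau>) 0"
    and phi_laurent_nth: "fls_nth (laurent_expansion (\<lambda>z. phi m z \<tau>) 0) n =
      (if n < -int m then 0 else fps_nth (phi_fps m \<tau>) (nat (n + int m)))"
proof -
  define A where "A = theta_fps (1/2) \<tau>"
  define B where "B = theta_fps 0 \<tau>"
  define B1 where "B1 = fps_shift 1 B"
  have A: "(\<lambda>z. jtheta (z + 1/2) \<tau>) has_fps_expansion A"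
    using has_fps_expansion_jtheta[OF \<tau>, of "1/2"] by (simp add: A_def add.commute)
  have B: "(\<lambda>z. jtheta z \<tau>) has_fps_expansion B"
    using has_fps_expansion_jtheta[OF \<tau>, of 0] by (simp add: B_def)
  have B1: "fps_nth B1 0 \<noteq> 0" unfolding B1_def B_def by (rule theta_fps_0_nth(2)[OF \<tau>])
  have BX: "B = B1 * fps_X"
    unfolding B1_def using theta_fps_0_nth(1)[of \<tau>]
    by (intro fps_ext) (simp add: B_def fps_X_mult_right_nth)
  define \<Phi> where "\<Phi> = (fps_to_fls A / fps_to_fls B) ^ m"
  have \<Phi>: "(\<lambda>z. phi m z \<tau>) has_laurent_expansion \<Phi>"
    unfolding phi_def \<Phi>_def by (intro laurent_expansion_intros has_laurent_expansion_fps A B)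
  hence eq: "laurent_expansion (\<lambda>z. phi m z \<tau>) 0 = \<Phi>" by (rule laurent_expansion_0_eqI)
  show "(\<lambda>z. phi m z \<tau>) has_laurent_expansion laurent_expansion (\<lambda>z. phi m z \<tau>) 0"
    using \<Phi> eq by simp
  have B1f: "fps_to_fls B1 \<noteq> 0" using B1 by auto
  have inv: "fps_to_fls (inverse B1) * fps_to_fls B1 = 1"
    using inverse_mult_eq_1[OF B1] by (simp flip: fls_times_fps_to_fls)
  define Y where "Y = A * inverse B1"
  have AB: "fps_to_fls A / fps_to_fls B = fps_to_fls Y * fls_X_inv"
    unfolding Y_def
  proof -
    have "fps_to_fls (A * inverse B1) * fls_X_inv * fps_to_fls B =
        fps_to_fls A * (fps_to_fls (inverse B1) * fps_to_fls B1) * (fls_X_inv * fls_X)"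
      unfolding BX by (simp add: fls_times_fps_to_fls mult_ac)
    also have "\<dots> = fps_to_fls A" unfolding inv by (simp flip: fls_inverse_X)
    finally have "fps_to_fls A = fps_to_fls (A * inverse B1) * fls_X_inv * fps_to_fls B" ..
    moreover have "fps_to_fls B \<noteq> 0" using B1 BX by auto
    ultimately show "fps_to_fls A / fps_to_fls B = fps_to_fls (A * inverse B1) * fls_X_inv"
      by (intro iffD2[OF nonzero_divide_eq_eq])
  qed
  have "\<Phi> = fps_to_fls (Y ^ m) * fls_X_inv ^ m"
    unfolding \<Phi>_def AB power_mult_distrib fps_to_fls_power ..
  also have "Y ^ m = phi_fps m \<tau>"
    unfolding phi_fps_def Y_def A_def B1_def B_def ..
  finally have "\<Phi> = fls_shift (int m) (fps_to_fls (phi_fps m \<tau>))"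
    by (simp only: fls_X_inv_power_times_conv_shift)
  thus "fls_nth (laurent_expansion (\<lambda>z. phi m z \<tau>) 0) n =
      (if n < -int m then 0 else fps_nth (phi_fps m \<tau>) (nat (n + int m)))"
    unfolding eq by simp
qed

lemma phi_laurent_odd:
  assumes \<tau>: "Im \<tau> > 0" and "even m" "odd n"
  shows "fls_nth (laurent_expansion (\<lambda>z. phi m z \<tau>) 0) n = 0"
proof -
  let ?F = "laurent_expansion (\<lambda>z. phi m z \<tau>) 0"
  obtain G where G: "(\<lambda>z. phi m (-1 * z) \<tau>) has_laurent_expansion G" "\<And>n. fls_nth G n = (-1) powi n * fls_nth ?F n"
    using has_laurent_expansion_scale[OF has_laurent_phi[OF \<tau>, of m], of "-1"] by auto
  have "(\<lambda>z. phi m (-1 * z) \<tau>) = (\<lambda>z. phi m z \<tau>)" using phi_minus[OF assms(2)] by auto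
  with G(1) have "G = ?F" using has_laurent_expansion_unique has_laurent_phi[OF \<tau>] by metis
  with G(2)[of n] assms(3) show ?thesis by (simp add: power_int_minus_left)
qed

lemma Dcoeff_altdef:
  assumes "Im \<tau> > 0" "k \<le> m"
  shows "Dcoeff m k \<tau> = (tpi) ^ k * fps_nth (phi_fps m \<tau>) (m - k)"
  using assms by (simp add: Dcoeff_def phi_laurent_nth nat_diff_distrib flip: of_nat_diff)

section \<open>Holomorphic dependence of the Laurent coefficients on \<tau>\<close>

lemma fps_inverse_nth_holomorphic:
  assumes F: "\<And>n. (\<lambda>\<tau>. fps_nth (F \<tau>) n) holomorphic_on A"
    and nz: "\<And>\<tau>. \<tau> \<in> A \<Longrightarrow> fps_nth (F \<tau>) 0 \<noteq> (0 :: complex)"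
  shows "(\<lambda>\<tau>. fps_nth (inverse (F \<tau>)) n) holomorphic_on A"
proof (induction n rule: less_induct)
  case (less n)
  show ?case
  proof (cases n)
    case 0
    have "(\<lambda>\<tau>. inverse (fps_nth (F \<tau>) 0)) holomorphic_on A"
      by (intro holomorphic_intros F nz)
    thus ?thesis by (simp add: 0)
  next
    case (Suc k)
    have "(\<lambda>\<tau>. - inverse (fps_nth (F \<tau>) 0) * (\<Sum>i = 1..n. fps_nth (F \<tau>) i * fps_nth (inverse (F \<tau>)) (n - i))) holomorphic_on A"
      by (intro holomorphic_intros F nz less.IH) auto
    also have "?this \<longleftrightarrow> ?thesis"
    proof (rule holomorphic_cong[OF refl])
      fix \<tau> assume "\<tau> \<in> A"
      have "fps_nth (F \<tau> * inverse (F \<tau>)) n = 0"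
        using inverse_mult_eq_1'[OF nz[OF \<open>\<tau> \<in> A\<close>]] Suc by simp
      moreover have "{0..n} = insert 0 {1..n}" by auto
      ultimately have "fps_nth (F \<tau>) 0 * fps_nth (inverse (F \<tau>)) n +
          (\<Sum>i = 1..n. fps_nth (F \<tau>) i * fps_nth (inverse (F \<tau>)) (n - i)) = 0"
        unfolding fps_mult_nth by simp
      thus "- inverse (fps_nth (F \<tau>) 0) * (\<Sum>i = 1..n. fps_nth (F \<tau>) i * fps_nth (inverse (F \<tau>)) (n - i)) =
          fps_nth (inverse (F \<tau>)) n"
        using nz[OF \<open>\<tau> \<in> A\<close>] by (simp add: field_simps add_eq_0_iff)
    qed
    finally show ?thesis .
  qed
qed

lemma fps_mult_nth_holomorphic:
  assumes "\<And>n. (\<lambda>\<tau>. fps_nth (F \<tau>) n) holomorphic_on A" "\<And>n. (\<lambda>\<tau>. fps_nth (G \<tau>) n) holomorphic_on A"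
  shows "(\<lambda>\<tau>. fps_nth (F \<tau> * G \<tau> :: complex fps) n) holomorphic_on A"
  unfolding fps_mult_nth by (intro holomorphic_intros assms)

lemma fps_power_nth_holomorphic:
  assumes "\<And>n. (\<lambda>\<tau>. fps_nth (F \<tau>) n) holomorphic_on A"
  shows "(\<lambda>\<tau>. fps_nth (F \<tau> ^ m :: complex fps) n) holomorphic_on A"
proof (induction m arbitrary: n)
  case (Suc m)
  show ?case unfolding power_Suc by (intro fps_mult_nth_holomorphic assms Suc)
qed (auto intro: holomorphic_intros)

text \<open>D_k arises from Taylor coefficients of theta at 0 and 1/2 by sums, products and the
  inverse of a power series whose constant term is the nonvanishing derivative of theta at
  0.\<close>

lemma Dcoeff_holomorphic:
  assumes "k \<le> m"
  shows "Dcoeff m k holomorphic_on upper_half_plane"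
proof -
  have t: "(\<lambda>\<tau>. fps_nth (theta_fps w \<tau>) n) holomorphic_on upper_half_plane" for w n
    unfolding theta_fps_def fps_nth_Abs_fps
    by (intro holomorphic_on_divide jtheta_taylor_holomorphic) (auto intro: holomorphic_intros)
  have "(\<lambda>\<tau>. fps_nth (phi_fps m \<tau>) n) holomorphic_on upper_half_plane" for n
    unfolding phi_fps_def
  proof (intro fps_power_nth_holomorphic fps_mult_nth_holomorphic fps_inverse_nth_holomorphic t)
    show "(\<lambda>\<tau>. fps_nth (fps_shift 1 (theta_fps 0 \<tau>)) n) holomorphic_on upper_half_plane" for n
      using t[of 0 "n + 1"] by simp
  qed (rule theta_fps_0_nth(2), simp add: upper_half_plane_def)
  hence "(\<lambda>\<tau>. (tpi) ^ k * fps_nth (phi_fps m \<tau>) (m - k)) holomorphic_on upper_half_plane"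
    by (intro holomorphic_intros)
  thus ?thesis
    by (rule holomorphic_transform) (use assms in \<open>simp add: Dcoeff_altdef upper_half_plane_def\<close>)
qed

text \<open>Beyond the constant term the next exponent would be 1, but \<phi> is even in z, so the
  remainder begins with z^2.\<close>

lemma phi_principal_part:
  assumes \<tau>: "Im \<tau> > 0" and m: "even m"
  shows "(\<lambda>z. phi m z \<tau> - (\<Sum>j=0..m div 2. Dcoeff m (2*j) \<tau> / (tpi * z) ^ (2*j)))
          \<in> O[at 0](\<lambda>z. z^2)"
proof -
  define c where "c = tpi"
  have c: "c \<noteq> 0" by (simp add: c_def)
  define F where "F = laurent_expansion (\<lambda>z. phi m z \<tau>) 0"
  define G where "G = (\<Sum>j=0..m div 2. fls_const (Dcoeff m (2*j) \<tau> / c ^ (2 * j)) * fls_X_intpow (-int (2 * j)))"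
  have "(\<lambda>z. phi m z \<tau> - (\<Sum>j=0..m div 2. Dcoeff m (2*j) \<tau> / c ^ (2 * j) * z powi (-int (2 * j)))) has_laurent_expansion F - G"
    unfolding F_def G_def
    by (intro laurent_expansion_intros has_laurent_phi[OF \<tau>])
  also have "(\<lambda>z. phi m z \<tau> - (\<Sum>j=0..m div 2. Dcoeff m (2*j) \<tau> / c ^ (2 * j) * z powi (-int (2 * j)))) =
      (\<lambda>z. phi m z \<tau> - (\<Sum>j=0..m div 2. Dcoeff m (2*j) \<tau> / (c * z) ^ (2*j)))"
    by (intro ext arg_cong2[where f = "(-)"] refl sum.cong)
      (simp add: power_int_minus power_mult_distrib divide_inverse del: of_nat_mult)
  finally have L: "(\<lambda>z. phi m z \<tau> - (\<Sum>j=0..m div 2. Dcoeff m (2*j) \<tau> / (c * z) ^ (2*j))) has_laurent_expansion F - G" .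
  have G_nth: "fls_nth G n = (if n \<le> 0 \<and> -int m \<le> n \<and> even n then fls_nth F n else 0)" for n
  proof -
    have "fls_nth G n = (\<Sum>j=0..m div 2. if n = -int (2 * j) then Dcoeff m (2*j) \<tau> / c ^ (2 * j) else 0)"
      unfolding G_def fls_nth_sum by (intro sum.cong refl) auto
    also have "\<dots> = (\<Sum>j=0..m div 2. if n = -int (2 * j) then fls_nth F n else 0)"
      by (intro sum.cong refl) (use c in \<open>auto simp: Dcoeff_def F_def c_def\<close>)
    also have "\<dots> = (if n \<le> 0 \<and> -int m \<le> n \<and> even n then fls_nth F n else 0)"
    proof (cases "n \<le> 0 \<and> -int m \<le> n \<and> even n")
      case True
      define j where "j = nat (-n) div 2"
      have "even (nat (-n))" using True by (simp add: even_nat_iff)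
      hence j: "n = -int (2 * j)" using True by (simp add: j_def)
      moreover have "j \<le> m div 2" using True j m by auto
      moreover have "n = -int (2 * i) \<longleftrightarrow> i = j" for i using j by auto
      ultimately show ?thesis using True by (simp add: sum.delta)
    next
      case False
      have "n \<noteq> -int (2 * j)" if "j \<in> {0..m div 2}" for j using False that m by auto
      hence "(\<Sum>j=0..m div 2. if n = -int (2 * j) then fls_nth F n else 0) = 0"
        by (intro sum.neutral ballI) auto
      thus ?thesis unfolding if_not_P[OF False] .
    qed
    finally show ?thesis .
  qed
  have FG: "fls_nth (F - G) n = 0" if "n < 2" for n
  proof (cases "odd n \<or> n < -int m")
    case True
    moreover have "fls_nth F n = 0"
      using True phi_laurent_odd[OF \<tau> m] phi_laurent_nth[OF \<tau>, of m n] by (auto simp: F_def)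
    ultimately show ?thesis by (simp add: G_nth)
  next
    case False
    have "n \<noteq> 1" using False by auto
    with that have "n \<le> 0" by simp
    thus ?thesis using False by (simp add: G_nth)
  qed
  have "(\<lambda>z. (phi m z \<tau> - (\<Sum>j=0..m div 2. Dcoeff m (2*j) \<tau> / (c * z) ^ (2*j))) * z powi (-2))
      has_laurent_expansion fls_shift 2 (F - G)"
    using has_laurent_expansion_shift'[OF L, of 2] by simp
  moreover have "0 \<le> fls_subdegree (fls_shift 2 (F - G))"
    by (rule fls_subdegree_ge0I) (simp only: fls_shift_nth, rule FG, simp)
  ultimately have "((\<lambda>z. (phi m z \<tau> - (\<Sum>j=0..m div 2. Dcoeff m (2*j) \<tau> / (c * z) ^ (2*j))) * z powi (-2)) \<longlongrightarrow>
      fls_nth (fls_shift 2 (F - G)) 0) (at 0)"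
    by (rule has_laurent_expansion_imp_tendsto_0)
  hence "((\<lambda>z. (phi m z \<tau> - (\<Sum>j=0..m div 2. Dcoeff m (2*j) \<tau> / (c * z) ^ (2*j))) / z ^ 2) \<longlongrightarrow>
      fls_nth (fls_shift 2 (F - G)) 0) (at 0)"
    by (simp add: power_int_minus divide_inverse)
  moreover have "eventually (\<lambda>z. z\<^sup>2 \<noteq> (0 :: complex)) (at 0)"
    by (auto simp: eventually_at_filter)
  ultimately show ?thesis
    unfolding c_def by (intro bigoI_tendsto)
qed

text \<open>On \<Gamma>_0(2) the coefficient D_k has weight -k, since z scales by 1/(c\<tau> + d).
  This balances the weight 2j of E_2j in \<phi>^F.\<close>

lemma Dcoeff_modular:
  fixes a b c d :: int
  assumes det: "a * d - b * c = 1" and c: "even c" and m: "even m" and \<tau>: "Im \<tau> > 0"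
  defines "s \<equiv> of_int c * \<tau> + of_int d"
  defines "\<tau>' \<equiv> (of_int a * \<tau> + of_int b) / s"
  shows "s ^ k * Dcoeff m k \<tau>' = psi m (a, b, c, d) * Dcoeff m k \<tau>"
proof -
  have s: "s \<noteq> 0" unfolding s_def by (rule autfac_nonzero[OF det \<tau>])
  have \<tau>': "Im \<tau>' > 0"
    unfolding \<tau>'_def s_def Im_moebius[OF det \<tau>] using \<tau> s by (simp add: s_def)
  let ?F = "\<lambda>\<tau>. laurent_expansion (\<lambda>z. phi m z \<tau>) 0"
  obtain G where G: "(\<lambda>z. phi m ((1 / s) * z) \<tau>') has_laurent_expansion G"
    "\<And>n. fls_nth G n = (1 / s) powi n * fls_nth (?F \<tau>') n"
    using has_laurent_expansion_scale[OF has_laurent_phi[OF \<tau>'], of "1 / s"] s by auto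
  have "(\<lambda>z. phi m ((1 / s) * z) \<tau>') = (\<lambda>z. psi m (a, b, c, d) * phi m z \<tau>)"
    using phi_modular_Gamma0[OF det c m \<tau>] by (simp add: s_def \<tau>'_def)
  with G(1) have "(\<lambda>z. psi m (a, b, c, d) * phi m z \<tau>) has_laurent_expansion G" by simp
  moreover have "(\<lambda>z. psi m (a, b, c, d) * phi m z \<tau>) has_laurent_expansion fls_const (psi m (a, b, c, d)) * ?F \<tau>"
    by (intro laurent_expansion_intros has_laurent_phi[OF \<tau>])
  ultimately have "G = fls_const (psi m (a, b, c, d)) * ?F \<tau>" by (rule has_laurent_expansion_unique)
  with G(2)[of "-int k"] have "s ^ k * fls_nth (?F \<tau>') (-int k) = psi m (a, b, c, d) * fls_nth (?F \<tau>) (-int k)"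
    by (simp add: power_int_minus power_divide)
  thus ?thesis unfolding Dcoeff_def by (simp add: mult_ac)
qed

section \<open>The decomposition of phi\<close>

lemma higher_deriv_shift:
  assumes f: "f holomorphic_on A" and A: "open A" and inv: "\<And>z. z \<in> A \<Longrightarrow> z + p \<in> A \<and> f (z + p) = f z"
    and z: "z \<in> A"
  shows "(deriv ^^ n) f (z + p) = (deriv ^^ n) f z"
proof -
  have "(deriv ^^ n) f z = (deriv ^^ n) (\<lambda>w. f (1 * w + p)) z"
  proof (rule higher_deriv_transform_within_open[OF f _ A z])
    show "(\<lambda>w. f (1 * w + p)) holomorphic_on A"
      by (rule holomorphic_transform[OF f]) (use inv in \<open>auto simp: add.commute\<close>)
  qed (use inv in auto)
  also have "\<dots> = 1 ^ n * (deriv ^^ n) f (1 * z + p)"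
    by (rule higher_deriv_compose_linear'[OF f A A z]) (use inv in auto)
  finally show ?thesis by simp
qed

lemma fls_higher_deriv_nth:
  "fls_nth ((fls_deriv ^^ n) F) k = pochhammer (of_int (k + 1)) n * fls_nth (F :: complex fls) (k + int n)"
proof (induction n arbitrary: k)
  case (Suc n)
  have "fls_nth ((fls_deriv ^^ Suc n) F) k = of_int (k + 1) * (pochhammer (of_int (k + 1) + 1) n * fls_nth F (k + 1 + int n))"
    using Suc[of "k + 1"] by (simp add: add_ac)
  thus ?case by (simp add: pochhammer_rec add_ac mult_ac)
qed auto

lemma has_laurent_expansion_higher_deriv:
  "f has_laurent_expansion F \<Longrightarrow> (deriv ^^ n) f has_laurent_expansion (fls_deriv ^^ n) F"
  by (induction n) (auto intro: has_laurent_expansion_deriv)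

text \<open>Differentiating z^(-2) exactly 2j - 2 times yields this coefficient in front of z^(-2j);
  the number of sign changes is even.\<close>

lemma pochhammer_odd_neg:
  assumes "j \<ge> 1"
  shows "pochhammer (of_int (-2 * int j + 1)) (2 * j - 2) = (fact (2 * j - 1) :: complex)"
proof -
  have "pochhammer (-of_nat (2 * j - 1)) (2 * j - 2) =
      (-1) ^ (2 * j - 2) * pochhammer (of_nat (2 * j - 1) - of_nat (2 * j - 2) + 1 :: complex) (2 * j - 2)"
    by (rule pochhammer_minus)
  also have "(-1) ^ (2 * j - 2) = (1 :: complex)" using assms by simp
  also have "of_nat (2 * j - 1) - of_nat (2 * j - 2) + 1 = (2 :: complex)"
    using assms by (simp add: of_nat_diff)
  also have "pochhammer (2 :: complex) (2 * j - 2) = fact (2 * j - 1)"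
  proof -
    have e: "2 * j - 1 = Suc (2 * j - 2)" using assms by simp
    have "fact (2 * j - 1) = pochhammer (1 :: complex) (Suc (2 * j - 2))"
      unfolding e by (rule pochhammer_fact)
    also have "\<dots> = pochhammer (2 :: complex) (2 * j - 2)"
      by (subst pochhammer_rec) (simp del: One_nat_def)
    finally show ?thesis ..
  qed
  also have "-of_nat (2 * j - 1) = (of_int (-2 * int j + 1) :: complex)"
    using assms by (simp add: of_nat_diff)
  finally show ?thesis by simp
qed

text \<open>The derivative of order 2j - 2 with respect to 2 pi i z. In this normalisation the pole
  at 0 is (2j - 1)!/(2 pi i z)^(2j), so the weights D_2j/(2j - 1)! reproduce the principal part of
  \<phi>.\<close>

definition wp_deriv :: "nat \<Rightarrow> complex \<Rightarrow> complex \<Rightarrow> complex" where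
  "wp_deriv j z \<tau> = (deriv ^^ (2 * j - 2)) (\<lambda>z. theta_wp z \<tau>) z / (tpi) ^ (2 * j - 2)"

lemma wp_deriv_holomorphic:
  assumes "Im \<tau> > 0"
  shows "(\<lambda>z. wp_deriv j z \<tau>) holomorphic_on {z. jtheta z \<tau> \<noteq> 0}"
  unfolding wp_deriv_def
  by (intro holomorphic_on_divide holomorphic_higher_deriv theta_wp_holomorphic open_jtheta_nonzero assms)
    (auto intro: holomorphic_intros)

lemma
  assumes \<tau>: "Im \<tau> > 0" and z: "jtheta z \<tau> \<noteq> 0"
  shows wp_deriv_plus_1: "wp_deriv j (z + 1) \<tau> = wp_deriv j z \<tau>"
    and wp_deriv_plus_tau: "wp_deriv j (z + \<tau>) \<tau> = wp_deriv j z \<tau>"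
proof -
  have 1: "jtheta (w + 1) \<tau> \<noteq> 0" "jtheta (w + \<tau>) \<tau> \<noteq> 0" if "jtheta w \<tau> \<noteq> 0" for w
    using that by (simp_all add: jtheta_plus_1 jtheta_plus_tau)
  show "wp_deriv j (z + 1) \<tau> = wp_deriv j z \<tau>" "wp_deriv j (z + \<tau>) \<tau> = wp_deriv j z \<tau>"
    unfolding wp_deriv_def
    by (subst higher_deriv_shift[OF theta_wp_holomorphic[OF \<tau>] open_jtheta_nonzero[OF \<tau>]],
        use 1 z theta_wp_plus_1[OF \<tau>] theta_wp_plus_tau[OF \<tau>] in auto)+
qed

text \<open>The constant term explains the summands of \<phi>^F: weighted by D_2j/(2j - 1)! it is
  -D_2j B_2j E_2j/(2j)!, and subtraction from \<phi> reverses the sign.\<close>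

lemma wp_deriv_laurent:
  assumes \<tau>: "Im \<tau> > 0" and j: "j \<ge> 1"
  obtains W where "(\<lambda>z. wp_deriv j z \<tau>) has_laurent_expansion W"
    "\<And>k. k < 0 \<Longrightarrow> fls_nth W k = (if k = -2 * int j then fact (2 * j - 1) / (tpi) ^ (2 * j) else 0)"
    "fls_nth W 0 = -fact (2 * j - 1) * (bernoulli_num (2 * j) / fact (2 * j) * eisenstein (2 * j) \<tau>)"
proof -
  define c where "c = tpi"
  have c: "c \<noteq> 0" by (simp add: c_def)
  define n where "n = 2 * j - 2"
  have n: "int n = 2 * int j - 2" using j by (simp add: n_def)
  have c2: "c ^ (2 * j) = c ^ n * c\<^sup>2"
  proof -
    have "2 * j = n + 2" using j by (simp add: n_def)
    thus ?thesis by (simp only: power_add)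
  qed
  define W where "W = fls_const (1 / c ^ n) * (fls_deriv ^^ n) (wp_laurent \<tau>)"
  have W_nth: "fls_nth W k = 1 / c ^ n * (pochhammer (of_int (k + 1)) n * fls_nth (wp_laurent \<tau>) (k + int n))" for k
    unfolding W_def fls_mult_const_nth fls_higher_deriv_nth ..
  have "(\<lambda>z. 1 / c ^ n * (deriv ^^ n) (\<lambda>z. theta_wp z \<tau>) z) has_laurent_expansion W"
    unfolding W_def
    by (intro has_laurent_expansion_cmult_left has_laurent_expansion_higher_deriv has_laurent_theta_wp[OF \<tau>])
  hence 1: "(\<lambda>z. wp_deriv j z \<tau>) has_laurent_expansion W"
    by (simp add: wp_deriv_def n_def c_def)
  have 2: "fls_nth W k = (if k = -2 * int j then fact (2 * j - 1) / c ^ (2 * j) else 0)" if k: "k < 0" for k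
  proof -
    consider "k = -2 * int j" | "k + int n \<ge> 0" | "k + int n < 0" "k + int n \<noteq> -2"
      using n by linarith
    thus ?thesis
    proof cases
      case 1
      have "k + int n = -2" using 1 n by simp
      moreover have "pochhammer (of_int (k + 1)) n = (fact (2 * j - 1) :: complex)"
        unfolding 1 n_def by (rule pochhammer_odd_neg[OF j])
      ultimately have "fls_nth W k = 1 / c ^ n * (fact (2 * j - 1) * (1 / c\<^sup>2))"
        unfolding W_nth by (simp add: wp_laurent_minus2[OF \<tau>] c_def)
      also have "\<dots> = fact (2 * j - 1) / c ^ (2 * j)" unfolding c2 by simp
      finally show ?thesis using 1 by simp
    next
      case 2
      \<comment> \<open>The term comes from a power z^(k+n) with 0 \<le> k + n < n, which n
        differentiations annihilate; the Pochhammer product contains a zero factor.\<close>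
      have "\<exists>i<n. (of_int (k + 1) :: complex) = -of_nat i"
      proof (intro exI conjI)
        show "nat (-(k + 1)) < n" using k 2 by linarith
        have "of_nat (nat (-(k + 1))) = (of_int (-(k + 1)) :: complex)" using k by simp
        thus "of_int (k + 1) = -(of_nat (nat (-(k + 1))) :: complex)" by simp
      qed
      hence "pochhammer (of_int (k + 1) :: complex) n = 0" by (simp only: pochhammer_eq_0_iff)
      moreover have "k \<noteq> -2 * int j" using 2 n by linarith
      ultimately show ?thesis unfolding W_nth by simp
    next
      case 3
      hence "k \<noteq> -2 * int j" using n by linarith
      thus ?thesis unfolding W_nth using wp_laurent_neg[OF \<tau> 3] by simp
    qed
  qed
  have 3: "fls_nth W 0 = -fact (2 * j - 1) * (bernoulli_num (2 * j) / fact (2 * j) * eisenstein (2 * j) \<tau>)"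
  proof -
    have "pochhammer (of_int (0 + 1)) n = (fact n :: complex)" by (simp add: pochhammer_fact)
    moreover have "fls_nth (wp_laurent \<tau>) (0 + int n) = -of_nat (2 * j - 1) * c ^ n *
        (bernoulli_num (2 * j) / fact (2 * j) * eisenstein (2 * j) \<tau>)"
      using wp_laurent_even[OF \<tau> j] n by (simp add: c_def n_def)
    moreover have "(fact (2 * j - 1) :: complex) = of_nat (2 * j - 1) * fact n"
    proof -
      have "0 < 2 * j - 1" using j by simp
      from fact_reduce[OF this, where 'a = complex] show ?thesis
        unfolding n_def by (simp only: diff_diff_left one_add_one)
    qed
    moreover have "1 / c ^ n * (f * (- k * c ^ n * x)) = - (k * f) * x" for f k x
      using c by simp
    ultimately show ?thesis unfolding W_nth by (simp only:)
  qed
  show ?thesis using that 1 2 3 by (simp add: c_def)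
qed

lemma phi_holomorphic:
  assumes "Im \<tau> > 0"
  shows "(\<lambda>z. phi m z \<tau>) holomorphic_on {z. jtheta z \<tau> \<noteq> 0}"
proof -
  have "((\<lambda>z. jtheta z \<tau>) \<circ> (\<lambda>z. z + 1/2)) holomorphic_on UNIV"
    by (rule holomorphic_on_compose_gen[OF _ jtheta_holomorphic[OF assms]]) (auto intro!: holomorphic_intros)
  hence "(\<lambda>z. jtheta (z + 1/2) \<tau>) holomorphic_on UNIV" by (simp add: o_def)
  thus ?thesis unfolding phi_def
    by (intro holomorphic_on_power holomorphic_on_divide holomorphic_on_subset[OF jtheta_holomorphic[OF assms]])
      (auto elim: holomorphic_on_subset)
qed

text \<open>All negative Laurent coefficients of the difference g cancel, so g has a limit at 0, and
  this limit is its constant coefficient: D_0 minus the constant terms of the weighted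
  derivatives.\<close>

lemma phi_eq_phiF_plus_wp:
  assumes \<tau>: "Im \<tau> > 0" and m: "even m" and z: "z \<in> strip \<tau> - \<int>"
  shows "phi m z \<tau> = phiF m \<tau> + (\<Sum>j=1..m div 2. Dcoeff m (2*j) \<tau> / fact (2*j - 1) * wp_deriv j z \<tau>)"
proof -
  define c where "c = tpi"
  have c: "c \<noteq> 0" by (simp add: c_def)
  define g where "g = (\<lambda>z. phi m z \<tau> - (\<Sum>j=1..m div 2. Dcoeff m (2*j) \<tau> / fact (2*j - 1) * wp_deriv j z \<tau>))"
  have nz: "jtheta w \<tau> \<noteq> 0" if "w \<in> strip \<tau> - \<int>" for w
    using that jtheta_eq_0_iff_strip[OF \<tau>] by auto
  have "\<forall>j\<in>{1..m div 2}. \<exists>W. (\<lambda>z. wp_deriv j z \<tau>) has_laurent_expansion W \<and>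
    (\<forall>k<0. fls_nth W k = (if k = -2 * int j then fact (2 * j - 1) / c ^ (2 * j) else 0)) \<and>
    fls_nth W 0 = -fact (2 * j - 1) * (bernoulli_num (2 * j) / fact (2 * j) * eisenstein (2 * j) \<tau>)"
    unfolding c_def using wp_deriv_laurent[OF \<tau>] by (metis atLeastAtMost_iff)
  then obtain W where W: "\<And>j. j \<in> {1..m div 2} \<Longrightarrow> (\<lambda>z. wp_deriv j z \<tau>) has_laurent_expansion W j"
    "\<And>j k. j \<in> {1..m div 2} \<Longrightarrow> k < 0 \<Longrightarrow> fls_nth (W j) k = (if k = -2 * int j then fact (2 * j - 1) / c ^ (2 * j) else 0)"
    "\<And>j. j \<in> {1..m div 2} \<Longrightarrow> fls_nth (W j) 0 = -fact (2 * j - 1) * (bernoulli_num (2 * j) / fact (2 * j) * eisenstein (2 * j) \<tau>)"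
    by (subst (asm) bchoice_iff) blast
  define F where "F = laurent_expansion (\<lambda>z. phi m z \<tau>) 0"
  define G where "G = F - (\<Sum>j=1..m div 2. fls_const (Dcoeff m (2*j) \<tau> / fact (2*j - 1)) * W j)"
  have G: "g has_laurent_expansion G"
    unfolding g_def G_def F_def
    by (intro has_laurent_expansion_diff has_laurent_expansion_sum has_laurent_expansion_cmult_left
        has_laurent_phi[OF \<tau>] W(1))
  have neg: "fls_nth G k = 0" if k: "k < 0" for k
  proof -
    have "fls_nth (\<Sum>j=1..m div 2. fls_const (Dcoeff m (2*j) \<tau> / fact (2*j - 1)) * W j) k =
        (\<Sum>j=1..m div 2. if k = -2 * int j then fls_nth F k else 0)"
      unfolding fls_nth_sum
    proof (intro sum.cong refl)
      fix j assume j: "j \<in> {1..m div 2}"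
      show "fls_nth (fls_const (Dcoeff m (2*j) \<tau> / fact (2*j - 1)) * W j) k = (if k = -2 * int j then fls_nth F k else 0)"
        using W(2)[OF j k] c by (auto simp: Dcoeff_def c_def F_def)
    qed
    also have "\<dots> = fls_nth F k"
    proof (cases "even k \<and> -int m \<le> k")
      case True
      define j where "j = nat (-k) div 2"
      obtain i where "k = 2 * i" using True by blast
      hence j: "k = -2 * int j" using k by (simp add: j_def)
      moreover have "j \<in> {1..m div 2}" using True k j m by auto
      moreover have "k = -2 * int i \<longleftrightarrow> i = j" for i using j by auto
      ultimately show ?thesis by (simp add: sum.delta)
    next
      case False
      hence 0: "fls_nth F k = 0"
        using phi_laurent_odd[OF \<tau> m] phi_laurent_nth[OF \<tau>, of m k] by (auto simp: F_def)
      show ?thesis unfolding 0 if_cancel sum.neutral_const ..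
    qed
    finally show ?thesis by (simp add: G_def)
  qed
  have G0: "fls_nth G 0 = phiF m \<tau>"
  proof -
    have "fls_nth (\<Sum>j=1..m div 2. fls_const (Dcoeff m (2*j) \<tau> / fact (2*j - 1)) * W j) 0 =
        (\<Sum>j=1..m div 2. -(bernoulli_num (2*j) / fact (2*j) * Dcoeff m (2*j) \<tau> * eisenstein (2*j) \<tau>))"
      unfolding fls_nth_sum
    proof (intro sum.cong refl)
      fix j assume j: "j \<in> {1..m div 2}"
      have "D / f * (- f * x) = -(D * x)" if "f \<noteq> (0 :: complex)" for D f x using that by simp
      from this[of "fact (2 * j - 1)"] show "fls_nth (fls_const (Dcoeff m (2*j) \<tau> / fact (2*j - 1)) * W j) 0 =
          -(bernoulli_num (2*j) / fact (2*j) * Dcoeff m (2*j) \<tau> * eisenstein (2*j) \<tau>)"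
        unfolding fls_mult_const_nth W(3)[OF j] by (simp add: mult_ac)
    qed
    thus ?thesis by (simp add: G_def phiF_def Dcoeff_def F_def sum_negf)
  qed
  have "g z = phiF m \<tau>"
  proof (rule elliptic_removable_constant[OF \<tau> _ _ _ _ z])
    have "strip \<tau> - \<int> \<subseteq> {z. jtheta z \<tau> \<noteq> 0}" using nz by auto
    thus "g holomorphic_on strip \<tau> - \<int>"
      unfolding g_def
      by (intro holomorphic_on_diff holomorphic_on_sum holomorphic_on_mult holomorphic_on_const
          holomorphic_on_subset[OF phi_holomorphic[OF \<tau>]] holomorphic_on_subset[OF wp_deriv_holomorphic[OF \<tau>]])
    show "g \<midarrow>0\<rightarrow> phiF m \<tau>"
      using has_laurent_expansion_imp_tendsto_0[OF G] neg fls_subdegree_ge0I[of G] by (simp add: G0)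
    show "g (z + 1) = g z" if "z \<in> strip \<tau> - \<int>" for z
      unfolding g_def using wp_deriv_plus_1[OF \<tau> nz[OF that]] phi_lattice_shift[OF m, of z 0 \<tau> 1] by simp
    show "g (z + \<tau>) = g z" if "z \<in> strip \<tau> - \<int>" for z
      unfolding g_def using wp_deriv_plus_tau[OF \<tau> nz[OF that]] phi_lattice_shift[OF m, of z 1 \<tau> 0] by simp
  qed
  thus ?thesis by (simp add: g_def algebra_simps)
qed

section \<open>Fourier expansion for 0 < Im z < Im \<tau>\<close>

lemma geometric_derivative_series:
  assumes "Im z > 0"
  shows "((\<lambda>r. (tpi) ^ n * of_nat r ^ (n + 1) * exp (tpi * of_nat r * z)) has_sum
    (deriv ^^ n) (\<lambda>z. exp (tpi * z) / (1 - exp (tpi * z))\<^sup>2) z) UNIV"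
proof -
  define \<epsilon> where "\<epsilon> = Im z / 2"
  have \<epsilon>: "\<epsilon> > 0" using assms by (simp add: \<epsilon>_def)
  let ?S = "{z. Im z > \<epsilon>}"
  have S: "open ?S" by (rule open_halfspace_Im_gt)
  have zS: "z \<in> ?S" using assms by (simp add: \<epsilon>_def)
  define t where "t = (\<lambda>(r::nat) z. of_nat r * exp (tpi * of_nat r * z))"
  have norm_lt: "norm (exp (tpi * w)) < exp (-2 * pi * \<epsilon>)" if "w \<in> ?S" for w
    using that by (simp add: norm_exp_2pi)
  have bd: "norm (t r w) \<le> real r ^ 1 * exp (-2 * pi * \<epsilon>) ^ r" if "w \<in> ?S" for r w
    unfolding t_def norm_mult exp_2pi_of_nat norm_power using norm_lt[OF that]
    by (intro mult_mono power_mono) auto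
  have e1: "exp (-2 * pi * \<epsilon>) < 1" using \<epsilon> by simp
  have sm: "(\<lambda>r::nat. real r ^ 1 * exp (-2 * pi * \<epsilon>) ^ r) summable_on UNIV"
    using summable_power_mult_geometric[of "exp (-2 * pi * \<epsilon>)" 1] e1
    by (intro norm_summable_imp_summable_on) (simp add: abs_mult)
  have hol: "t r holomorphic_on ?S" for r unfolding t_def by (intro holomorphic_intros)
  have val: "(\<Sum>\<^sub>\<infinity>r. t r w) = exp (tpi * w) / (1 - exp (tpi * w))\<^sup>2" if "w \<in> ?S" for w
  proof -
    define x where "x = exp (tpi * w)"
    have x: "norm x < 1" unfolding x_def by (rule less_trans[OF norm_lt[OF that] e1])
    have "(\<lambda>r. t r w) summable_on UNIV"
      by (rule abs_summable_summable, rule summable_on_comparison_test[OF sm]) (use bd[OF that] in auto)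
    hence "(\<lambda>r. t r w) sums (\<Sum>\<^sub>\<infinity>r. t r w)" by (intro has_sum_imp_sums has_sum_infsum)
    hence "(\<lambda>r. of_nat r * x ^ r) sums (\<Sum>\<^sub>\<infinity>r. t r w)" by (simp add: t_def exp_2pi_of_nat x_def)
    \<comment> \<open>The derivative of the geometric series, shifted by one index; it needs
      |\<zeta>| < 1, which is the source of the condition Im z > 0.\<close>
    moreover have "(\<lambda>r. x * (of_nat (Suc r) * x ^ r)) sums (x * (1 / (1 - x)\<^sup>2))"
      by (intro sums_mult geometric_deriv_sums x)
    hence "(\<lambda>r. of_nat (Suc r) * x ^ Suc r) sums (x / (1 - x)\<^sup>2)" by (simp add: mult_ac)
    hence "(\<lambda>r. of_nat r * x ^ r) sums (x / (1 - x)\<^sup>2)"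
      by (subst (asm) sums_Suc_iff) simp
    ultimately show ?thesis unfolding x_def by (rule sums_unique2)
  qed
  have der: "(deriv ^^ n) (t r) z = (tpi) ^ n * of_nat r ^ (n + 1) * exp (tpi * of_nat r * z)" for r
  proof -
    have "(deriv ^^ n) (t r) z = of_nat r * (deriv ^^ n) (\<lambda>z. exp (tpi * of_nat r * z)) z"
      unfolding t_def by (rule higher_deriv_cmult[where A = UNIV]) (auto intro!: holomorphic_intros)
    also have "(deriv ^^ n) (\<lambda>z. exp (tpi * of_nat r * z)) z =
        (tpi * of_nat r) ^ n * exp (tpi * of_nat r * z)"
      using higher_deriv_exp_linear[of n 0 "tpi * of_nat r" z] by simp
    finally show ?thesis by (simp add: power_mult_distrib mult_ac)
  qed
  have "((\<lambda>r. (deriv ^^ n) (t r) z) has_sum (deriv ^^ n) (\<lambda>z. \<Sum>\<^sub>\<infinity>r. t r z) z) UNIV"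
    by (rule has_sum_higher_deriv[OF S hol bd sm zS])
  moreover have "(deriv ^^ n) (\<lambda>z. \<Sum>\<^sub>\<infinity>r. t r z) z =
      (deriv ^^ n) (\<lambda>z. exp (tpi * z) / (1 - exp (tpi * z))\<^sup>2) z"
  proof (rule higher_deriv_transform_within_open[OF _ _ S zS])
    show h: "(\<lambda>z. \<Sum>\<^sub>\<infinity>r. t r z) holomorphic_on ?S"
      by (rule holomorphic_on_infsum[OF S hol bd sm])
    show "(\<lambda>z. exp (tpi * z) / (1 - exp (tpi * z))\<^sup>2) holomorphic_on ?S"
      by (rule holomorphic_transform[OF h val])
  qed (use val in auto)
  ultimately show ?thesis by (simp only: der)
qed

text \<open>For r > 0 the coefficient 1 from \<zeta>/(1 - \<zeta>)^2 and q^r/(1 - q^r) from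
  \<open>theta_log\<close> add up to 1/(1 - q^r). The terms in \<zeta>^(-r) carry q^r/(1 - q^r) =
  -1/(1 - q^(-r)), and the odd power of -r accounts for the sign, so one formula covers all nonzero
  integers.\<close>

lemma wp_deriv_series:
  assumes z: "0 < Im z" "Im z < Im \<tau>" and j: "j \<ge> 1"
  shows "(\<Sum>\<^sub>\<infinity>r\<in>UNIV - {0::int}. of_int r ^ (2*j - 1) / (1 - exp (tpi * \<tau>) powi r) *
        exp (tpi * z) powi r) = wp_deriv j z \<tau>"
proof -
  have \<tau>: "Im \<tau> > 0" using z by simp
  define c where "c = tpi"
  have c: "c \<noteq> 0" by (simp add: c_def)
  define n where "n = 2 * j - 2"
  have n: "2 * j - 1 = n + 1" "2 * j = n + 2" using j by (simp_all add: n_def)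
  have evn: "even n" by (simp add: n_def)
  define q where "q = exp (c * \<tau>)"
  define x where "x = exp (c * z)"
  have xq: "x \<noteq> 0" "q \<noteq> 0" by (simp_all add: x_def q_def)
  have q1: "norm q < 1" using norm_q_less_1[OF \<tau>] by (simp add: q_def c_def)
  have qr: "1 - q ^ r \<noteq> 0" if "r > 0" for r
    using norm_one_minus_q_power[OF q1 that] q1 by auto
  have zS: "z \<in> strip \<tau> - \<int>" using z by (auto simp: strip_def elim!: Ints_cases)
  define L where "L = (\<lambda>z. theta_log z \<tau>)"
  define E where "E = (\<lambda>z. exp (c * z) / (1 - exp (c * z))\<^sup>2)"
  define U where "U = {z. Im z > 0} \<inter> {z. Im z < Im \<tau>}"
  have U: "open U" unfolding U_def by (intro open_Int open_halfspace_Im_gt open_halfspace_Im_lt)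
  have zU: "z \<in> U" using z by (simp add: U_def)
  have U_sub: "w \<in> strip \<tau> - \<int>" if "w \<in> U" for w
    using that by (auto simp: strip_def U_def elim!: Ints_cases)
  have holE: "E holomorphic_on U"
  proof -
    have "exp (c * w) \<noteq> 1" if "w \<in> U" for w
    proof -
      have "norm (exp (tpi * w)) < 1" using that by (simp add: norm_exp_2pi U_def)
      thus ?thesis unfolding c_def by (metis less_irrefl norm_one)
    qed
    thus ?thesis unfolding E_def by (intro holomorphic_intros) (auto simp: eq_commute[of 1])
  qed
  have holL: "(deriv ^^ 2) L holomorphic_on U"
    by (rule holomorphic_on_subset[of _ "strip \<tau>"])
      (use U_sub in \<open>auto simp: L_def intro!: holomorphic_higher_deriv theta_log_holomorphic[OF \<tau>]\<close>)
  have "(deriv ^^ n) (\<lambda>z. theta_wp z \<tau>) z = (deriv ^^ n) (\<lambda>z. E z + (1 / c\<^sup>2) * (deriv ^^ 2) L z) z"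
  proof (rule higher_deriv_transform_within_open[OF _ _ U zU])
    show h: "(\<lambda>z. E z + (1 / c\<^sup>2) * (deriv ^^ 2) L z) holomorphic_on U"
      by (intro holomorphic_on_add holomorphic_on_mult holE holL holomorphic_on_const)
    show eq: "theta_wp w \<tau> = E w + (1 / c\<^sup>2) * (deriv ^^ 2) L w" if "w \<in> U" for w
      using theta_wp_strip[OF \<tau> U_sub[OF that]] by (simp add: E_def L_def c_def)
    show "(\<lambda>z. theta_wp z \<tau>) holomorphic_on U"
      by (rule holomorphic_transform[OF h eq[symmetric]])
  qed
  also have "\<dots> = (deriv ^^ n) E z + (deriv ^^ n) (\<lambda>z. (1 / c\<^sup>2) * (deriv ^^ 2) L z) z"
    by (rule higher_deriv_add[OF holE _ U zU]) (intro holomorphic_on_mult holL holomorphic_on_const)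
  also have "(deriv ^^ n) (\<lambda>z. (1 / c\<^sup>2) * (deriv ^^ 2) L z) z = (1 / c\<^sup>2) * (deriv ^^ n) ((deriv ^^ 2) L) z"
    by (rule higher_deriv_cmult[OF holL zU U])
  also have "(deriv ^^ n) ((deriv ^^ 2) L) z = (deriv ^^ (n + 2)) L z"
    by (simp only: funpow_add o_apply)
  finally have wp: "(deriv ^^ n) (\<lambda>z. theta_wp z \<tau>) z = (deriv ^^ n) E z + (1 / c\<^sup>2) * (deriv ^^ (n + 2)) L z" .
  have cn: "c ^ (n + 2) = c ^ n * c\<^sup>2" by (rule power_add)
  have exps: "exp (tpi * of_nat r * z) = x ^ r" "exp (-(tpi * of_nat r) * z) = inverse x ^ r" for r
  proof -
    show 1: "exp (tpi * of_nat r * z) = x ^ r"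
      by (simp only: exp_2pi_of_nat x_def c_def)
    show "exp (-(tpi * of_nat r) * z) = inverse x ^ r"
      using 1 by (simp add: exp_minus power_inverse)
  qed
  define f where "f = (\<lambda>r::nat. of_nat r ^ (n + 1) / (1 - q ^ r) * x ^ r)"
  define g where "g = (\<lambda>r::nat. of_nat r ^ (n + 1) * q ^ r / (1 - q ^ r) * inverse x ^ r)"
  have s1: "((\<lambda>r. c ^ n * of_nat r ^ (n + 1) * x ^ r) has_sum (deriv ^^ n) E z) UNIV"
    using geometric_derivative_series[OF z(1), of n] unfolding exps E_def by (simp add: c_def)
  have "((\<lambda>r. lambert_coeff r \<tau> * ((c * of_nat r) ^ (n + 2) * x ^ r + (-(c * of_nat r)) ^ (n + 2) * inverse x ^ r)) has_sum
      (deriv ^^ (n + 2)) L z) UNIV"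
    using theta_log_higher_deriv[OF \<tau>, of z "n + 2"] zS unfolding exps L_def by (simp add: c_def)
  hence "((\<lambda>r. (1 / c\<^sup>2) * (lambert_coeff r \<tau> * ((c * of_nat r) ^ (n + 2) * x ^ r + (-(c * of_nat r)) ^ (n + 2) * inverse x ^ r))) has_sum
      (1 / c\<^sup>2) * (deriv ^^ (n + 2)) L z) UNIV"
    by (rule has_sum_cmult_right)
  from has_sum_add[OF s1 this]
  have "((\<lambda>r. c ^ n * of_nat r ^ (n + 1) * x ^ r +
      (1 / c\<^sup>2) * (lambert_coeff r \<tau> * ((c * of_nat r) ^ (n + 2) * x ^ r + (-(c * of_nat r)) ^ (n + 2) * inverse x ^ r))) has_sum
      (deriv ^^ n) (\<lambda>z. theta_wp z \<tau>) z) UNIV" unfolding wp .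
  hence "((\<lambda>r. 1 / c ^ n * (c ^ n * of_nat r ^ (n + 1) * x ^ r +
      (1 / c\<^sup>2) * (lambert_coeff r \<tau> * ((c * of_nat r) ^ (n + 2) * x ^ r + (-(c * of_nat r)) ^ (n + 2) * inverse x ^ r)))) has_sum
      1 / c ^ n * (deriv ^^ n) (\<lambda>z. theta_wp z \<tau>) z) UNIV"
    by (rule has_sum_cmult_right)
  also have "1 / c ^ n * (deriv ^^ n) (\<lambda>z. theta_wp z \<tau>) z = wp_deriv j z \<tau>"
    by (simp add: wp_deriv_def c_def n_def)
  also have "(\<lambda>r. 1 / c ^ n * (c ^ n * of_nat r ^ (n + 1) * x ^ r +
      (1 / c\<^sup>2) * (lambert_coeff r \<tau> * ((c * of_nat r) ^ (n + 2) * x ^ r + (-(c * of_nat r)) ^ (n + 2) * inverse x ^ r)))) =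
      (\<lambda>r. f r + g r)"
  proof
    fix r :: nat
    show "1 / c ^ n * (c ^ n * of_nat r ^ (n + 1) * x ^ r +
      (1 / c\<^sup>2) * (lambert_coeff r \<tau> * ((c * of_nat r) ^ (n + 2) * x ^ r + (-(c * of_nat r)) ^ (n + 2) * inverse x ^ r))) = f r + g r"
    proof (cases "r = 0")
      case True
      thus ?thesis by (simp add: f_def g_def)
    next
      case False
      define R where "R = (of_nat r :: complex) ^ (n + 1)"
      define Q where "Q = q ^ r"
      define X where "X = x ^ r"
      define Y where "Y = inverse x ^ r"
      define C where "C = c ^ n"
      define N where "N = (of_nat r :: complex)"
      have nz: "C \<noteq> 0" "c\<^sup>2 \<noteq> 0" "N \<noteq> 0" "1 - Q \<noteq> 0"
        using c qr[of r] False by (auto simp: C_def N_def Q_def)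
      have p: "(c * of_nat r) ^ (n + 2) = C * c\<^sup>2 * (N * R)" "(-(c * of_nat r)) ^ (n + 2) = C * c\<^sup>2 * (N * R)"
        using evn by (simp_all add: power_mult_distrib C_def R_def N_def power2_eq_square)
      have lam: "lambert_coeff r \<tau> = Q / (N * (1 - Q))"
        by (simp add: lambert_coeff_def Q_def N_def q_def c_def)
      have "1 / C * (C * R * X + 1 / c\<^sup>2 * (Q / (N * (1 - Q)) * (C * c\<^sup>2 * (N * R) * X + C * c\<^sup>2 * (N * R) * Y))) =
          R * X + Q / (1 - Q) * (R * X + R * Y)"
      proof -
        have "1 / c\<^sup>2 * (Q / (N * (1 - Q)) * (C * c\<^sup>2 * (N * R) * X + C * c\<^sup>2 * (N * R) * Y)) =
            C * (Q / (1 - Q) * (R * X + R * Y))" using nz by (simp add: field_simps)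
        thus ?thesis using nz by (simp add: field_simps)
      qed
      also have "\<dots> = R / (1 - Q) * X + R * Q / (1 - Q) * Y"
      proof -
        define u where "u = inverse (1 - Q)"
        have "u * (1 - Q) = 1" using nz by (simp add: u_def)
        thus ?thesis unfolding divide_inverse u_def[symmetric] by algebra
      qed
      finally show ?thesis
        unfolding p lam f_def g_def R_def[symmetric] Q_def[symmetric] X_def[symmetric] Y_def[symmetric] C_def[symmetric] .
    qed
  qed
  finally have fg: "((\<lambda>r. f r + g r) has_sum wp_deriv j z \<tau>) UNIV" .
  \<comment> \<open>The expansion gives only the sum of f + g. To rearrange it over the integers
    each half must be summable: g is dominated through |q/\<zeta>| < 1, and f then follows by
    subtraction.\<close>
  have g_sum: "g summable_on UNIV"
  proof (rule abs_summable_summable, rule summable_on_comparison_test)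
    define y where "y = norm (q * inverse x)"
    have "q * inverse x = exp (tpi * (\<tau> - z))"
      by (simp add: q_def x_def c_def ring_distribs exp_diff divide_inverse)
    hence y: "0 \<le> y" "y < 1" using z by (simp_all add: y_def norm_exp_2pi del: norm_mult)
    have "summable (\<lambda>r. real r ^ (n + 1) * y ^ r / (1 - norm q))"
      by (intro summable_divide summable_power_mult_geometric y)
    thus "(\<lambda>r. real r ^ (n + 1) * y ^ r / (1 - norm q)) summable_on UNIV"
      using q1 y by (intro norm_summable_imp_summable_on) (simp add: abs_mult)
    fix r :: nat
    show "norm (g r) \<le> real r ^ (n + 1) * y ^ r / (1 - norm q)"
    proof (cases "r = 0")
      case False
      have "norm (g r) = real r ^ (n + 1) * y ^ r / norm (1 - q ^ r)"
        by (simp add: g_def y_def norm_mult norm_divide norm_power norm_inverse power_mult_distrib power_inverse)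
      also have "\<dots> \<le> real r ^ (n + 1) * y ^ r / (1 - norm q)"
        using norm_one_minus_q_power[OF q1, of r] False q1 y qr[of r]
        by (intro divide_left_mono mult_nonneg_nonneg mult_pos_pos) auto
      finally show ?thesis .
    qed (simp add: g_def)
  qed auto
  define F where "F = (\<lambda>r::int. of_int r ^ (2*j - 1) / (1 - q powi r) * x powi r)"
  have f_eq: "F (int r) = f r" for r by (simp add: F_def f_def n)
  have g_eq: "F (- int r) = g r" for r
  proof (cases "r = 0")
    case True
    thus ?thesis by (simp add: F_def g_def n)
  next
    case False
    have "odd (n + 1)" using evn by simp
    hence "(of_int (- int r) :: complex) ^ (n + 1) = -(of_nat r ^ (n + 1))" by simp
    moreover have "q powi (- int r) = inverse (q ^ r)" "x powi (- int r) = inverse x ^ r"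
      by (simp_all add: power_int_minus power_inverse)
    moreover have "- R / (1 - inverse Q) * Y = R * Q / (1 - Q) * Y" if "Q \<noteq> 0" "1 - Q \<noteq> 0" for R Q Y :: complex
    proof -
      define D where "D = 1 - Q"
      have D: "1 - inverse Q = - D / Q" "D \<noteq> 0" using that by (simp_all add: D_def field_simps)
      thus ?thesis unfolding D(1) D_def[symmetric] using that(1) by simp
    qed
    ultimately show ?thesis
      using qr[of r] xq False unfolding F_def g_def n by simp
  qed
  have F0: "F 0 = 0" by (simp add: F_def n)
  have f_sum: "f summable_on UNIV"
  proof -
    have "(\<lambda>r. (f r + g r) + - g r) summable_on UNIV"
      by (intro summable_on_add has_sum_imp_summable[OF fg]) (simp add: summable_on_uminus g_sum)
    thus ?thesis by simp
  qed
  have gS: "(\<lambda>r. F (-1 - int r)) summable_on UNIV" and gI: "(\<Sum>\<^sub>\<infinity>r. F (-1 - int r)) = (\<Sum>\<^sub>\<infinity>r. g r)"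
  proof -
    have e: "F (-1 - int r) = g (Suc r)" for r using g_eq[of "Suc r"] by simp
    have b: "bij_betw Suc UNIV {1..}" by (rule bij_betwI[of _ _ _ "\<lambda>n. n - 1"]) auto
    have "g summable_on {1..}" by (rule summable_on_subset_banach[OF g_sum]) auto
    thus "(\<lambda>r. F (-1 - int r)) summable_on UNIV"
      unfolding e using summable_on_reindex_bij_betw[OF b, of g] by simp
    have "(\<Sum>\<^sub>\<infinity>r. g (Suc r)) = (\<Sum>\<^sub>\<infinity>r\<in>{1..}. g r)" by (rule infsum_reindex_bij_betw[OF b])
    also have "\<dots> = (\<Sum>\<^sub>\<infinity>r. g r)"
      by (rule infsum_cong_neutral) (auto simp: g_def not_le)
    finally show "(\<Sum>\<^sub>\<infinity>r. F (-1 - int r)) = (\<Sum>\<^sub>\<infinity>r. g r)" unfolding e .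
  qed
  have "(\<Sum>\<^sub>\<infinity>r\<in>UNIV - {0}. F r) = (\<Sum>\<^sub>\<infinity>r. F r)"
    by (rule infsum_cong_neutral) (auto simp: F0)
  also have "\<dots> = (\<Sum>\<^sub>\<infinity>r. F (int r)) + (\<Sum>\<^sub>\<infinity>r. F (-1 - int r))"
    by (rule infsum_int_split) (use f_sum gS in \<open>simp_all add: f_eq\<close>)
  also have "\<dots> = (\<Sum>\<^sub>\<infinity>r. f r) + (\<Sum>\<^sub>\<infinity>r. g r)" by (simp add: f_eq gI)
  also have "\<dots> = (\<Sum>\<^sub>\<infinity>r. f r + g r)" by (rule infsum_add[symmetric, OF f_sum g_sum])
  also have "\<dots> = wp_deriv j z \<tau>" by (rule infsumI[OF fg])
  finally show ?thesis unfolding F_def q_def x_def c_def .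
qed

lemma phi_decomposition:
  assumes "even m" "0 < Im z" "Im z < Im \<tau>"
  shows "phi m z \<tau> = phiF_hat m \<tau> + phiP_hat m z \<tau>"
proof -
  have \<tau>: "Im \<tau> > 0" using assms by simp
  have "z \<in> strip \<tau> - \<int>" using assms by (auto simp: strip_def elim!: Ints_cases)
  from phi_eq_phiF_plus_wp[OF \<tau> assms(1) this]
  have "phi m z \<tau> = phiF m \<tau> + phiP m z \<tau>"
    unfolding phiP_def using wp_deriv_series[OF assms(2,3)] by simp
  thus ?thesis by (simp add: phiF_hat_def phiP_hat_def)
qed

section \<open>Modularity of the finite part\<close>

text \<open>The products s^k D_k(\<tau>') are left intact, even for k = 0, because they are the
  quantities controlled later: by the character on \<Gamma>_0(2) and by Cauchy's formula for general
  \<gamma>. The last summand is the defect of E_2.\<close>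

lemma phiF_moebius:
  fixes a b c d :: int
  assumes det: "a * d - b * c = 1" and \<tau>: "Im \<tau> > 0" and m: "m \<ge> 2"
  defines "s \<equiv> of_int c * \<tau> + of_int d"
  defines "\<tau>' \<equiv> (of_int a * \<tau> + of_int b) / s"
  shows "phiF m \<tau>' = s ^ 0 * Dcoeff m 0 \<tau>' +
    (\<Sum>j=1..m div 2. (bernoulli_num (2*j) / fact (2*j) * eisenstein (2*j) \<tau>) * (s ^ (2*j) * Dcoeff m (2*j) \<tau>')) +
    s ^ 2 * Dcoeff m 2 \<tau>' * (of_int c / (tpi * s))"
proof -
  define e where "e = of_int c / (tpi * s)"
  have "(\<Sum>j=1..m div 2. bernoulli_num (2*j) / fact (2*j) * Dcoeff m (2*j) \<tau>' * eisenstein (2*j) \<tau>') =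
      (\<Sum>j=1..m div 2. (bernoulli_num (2*j) / fact (2*j) * eisenstein (2*j) \<tau>) * (s ^ (2*j) * Dcoeff m (2*j) \<tau>') +
        (if j = 1 then s ^ 2 * Dcoeff m 2 \<tau>' * e else 0))"
  proof (intro sum.cong refl)
    fix j assume "j \<in> {1..m div 2}"
    hence j: "j \<ge> 1" by simp
    have "bernoulli_num (2*j) / fact (2*j) * Dcoeff m (2*j) \<tau>' * eisenstein (2*j) \<tau>' =
        (bernoulli_num (2*j) / fact (2*j) * eisenstein (2*j) \<tau>') * Dcoeff m (2*j) \<tau>'" by simp
    also have "\<dots> = (bernoulli_num (2*j) / fact (2*j) * eisenstein (2*j) \<tau> + (if j = 1 then e else 0)) *
        (s ^ (2*j) * Dcoeff m (2*j) \<tau>')"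
      unfolding bernoulli_eisenstein_modular[OF det \<tau> j, folded s_def, folded \<tau>'_def e_def] by simp
    also have "\<dots> = (bernoulli_num (2*j) / fact (2*j) * eisenstein (2*j) \<tau>) * (s ^ (2*j) * Dcoeff m (2*j) \<tau>') +
        (if j = 1 then s ^ 2 * Dcoeff m 2 \<tau>' * e else 0)"
    proof (cases "j = 1")
      case True
      show ?thesis unfolding True mult_1_right by (simp add: algebra_simps)
    qed simp
    finally show "bernoulli_num (2*j) / fact (2*j) * Dcoeff m (2*j) \<tau>' * eisenstein (2*j) \<tau>' = \<dots>" .
  qed
  also have "\<dots> = (\<Sum>j=1..m div 2. (bernoulli_num (2*j) / fact (2*j) * eisenstein (2*j) \<tau>) * (s ^ (2*j) * Dcoeff m (2*j) \<tau>')) +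
      s ^ 2 * Dcoeff m 2 \<tau>' * e"
  proof -
    have "1 \<in> {1..m div 2}" using m by simp
    thus ?thesis by (simp add: sum.distrib)
  qed
  finally show ?thesis by (simp add: phiF_def e_def)
qed

text \<open>Since Im \<tau>' = v/|s|^2, the correction changes by the factor cnj s/s after the
  weight of D_2 is removed. With cnj s = s - 2 i c v this creates the extra term c/(2 pi i s), which
  is exactly the defect of \<phi>^F.\<close>

lemma phiF_hat_modular:
  fixes a b c d :: int
  assumes det: "a * d - b * c = 1" and c: "even c" and m: "even m" "m > 0" and \<tau>: "Im \<tau> > 0"
  defines "s \<equiv> of_int c * \<tau> + of_int d"
  defines "\<tau>' \<equiv> (of_int a * \<tau> + of_int b) / s"
  shows "phiF_hat m \<tau>' = psi m (a, b, c, d) * phiF_hat m \<tau>"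
proof -
  define p where "p = psi m (a, b, c, d)"
  define v where "v = Im \<tau>"
  define D where "D = Dcoeff m 2 \<tau>"
  have m2: "m \<ge> 2" using m by (auto elim!: evenE)
  have s: "s \<noteq> 0" unfolding s_def by (rule autfac_nonzero[OF det \<tau>])
  have DL: "s ^ k * Dcoeff m k \<tau>' = p * Dcoeff m k \<tau>" for k
    using Dcoeff_modular[OF det c m(1) \<tau>] by (simp add: s_def \<tau>'_def p_def)
  have 1: "phiF m \<tau>' = p * (phiF m \<tau> + D * (of_int c / (tpi * s)))"
    unfolding phiF_moebius[OF det \<tau> m2, folded s_def, folded \<tau>'_def] DL
    unfolding phiF_def D_def by (simp add: algebra_simps sum_distrib_left)
  have "Im \<tau>' = v / (norm s)\<^sup>2"
    unfolding \<tau>'_def s_def v_def by (rule Im_moebius[OF det \<tau>])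
  hence "complex_of_real (4 * pi * Im \<tau>') = 4 * of_real pi * of_real v / (s * cnj s)"
    by (simp add: complex_norm_square[symmetric])
  hence "Dcoeff m 2 \<tau>' / complex_of_real (4 * pi * Im \<tau>') = (s ^ 2 * Dcoeff m 2 \<tau>') * (cnj s / s) / (4 * of_real pi * of_real v)"
    using s by (simp add: power2_eq_square)
  also have "\<dots> = p * D * (cnj s / s / (4 * of_real pi * of_real v))"
    unfolding DL D_def by simp
  also have "cnj s / s / (4 * of_real pi * of_real v) =
      1 / (4 * of_real pi * of_real v) + of_int c / (tpi * s)"
  proof -
    have "s - cnj s = 2 * \<i> * of_int c * of_real v"
      by (simp add: s_def v_def complex_eq_iff)
    hence cnj: "cnj s = s - 2 * \<i> * of_int c * of_real v" by (simp add: algebra_simps)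
    have "v \<noteq> 0" using \<tau> by (simp add: v_def)
    thus ?thesis unfolding cnj using s by (simp add: field_simps)
  qed
  finally have 2: "Dcoeff m 2 \<tau>' / complex_of_real (4 * pi * Im \<tau>') =
      p * D * (1 / (4 * of_real pi * of_real v) + of_int c / (tpi * s))" .
  have "phiF_hat m \<tau>' = p * (phiF m \<tau> - D / (4 * of_real pi * of_real v))"
    unfolding phiF_hat_def 1 2 by (simp add: algebra_simps)
  thus ?thesis by (simp add: phiF_hat_def D_def v_def p_def)
qed

lemma bernoulli_eisenstein_holomorphic:
  assumes j: "j \<ge> 1"
  shows "(\<lambda>\<tau>. bernoulli_num (2*j) / fact (2*j) * eisenstein (2*j) \<tau>) holomorphic_on upper_half_plane"
proof -
  let ?t = "\<lambda>l \<tau>. of_nat (divisor_sigma (2 * j - 1) l) * exp (tpi * \<tau>) ^ l"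
  show ?thesis
  proof (rule holomorphic_on_upper_half_planeI)
    fix \<epsilon> :: real assume \<epsilon>: "\<epsilon> > 0"
    have "(\<lambda>\<tau>. \<Sum>\<^sub>\<infinity>l\<in>{1..}. ?t l \<tau>) holomorphic_on {\<tau>. Im \<tau> > \<epsilon>}"
    proof (rule holomorphic_on_infsum)
      show "(\<lambda>l. norm (?t l (\<i> * of_real \<epsilon>))) summable_on {1..}"
        by (rule lambert_series(2)) (use \<epsilon> in \<open>simp add: norm_q_less_1\<close>)
      fix l \<tau> assume "\<tau> \<in> {\<tau>. Im \<tau> > \<epsilon>}"
      hence "norm (exp (tpi * \<tau>)) \<le> norm (exp (tpi * (\<i> * of_real \<epsilon>)))"
        unfolding norm_exp_2pi by simp
      thus "norm (?t l \<tau>) \<le> norm (?t l (\<i> * of_real \<epsilon>))"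
        unfolding norm_mult norm_power by (intro mult_left_mono power_mono) auto
    qed (auto intro!: holomorphic_intros open_halfspace_Im_gt)
    thus "(\<lambda>\<tau>. bernoulli_num (2*j) / fact (2*j) * eisenstein (2*j) \<tau>) holomorphic_on {\<tau>. Im \<tau> > \<epsilon>}"
      unfolding bernoulli_eisenstein[OF j] by (intro holomorphic_intros)
  qed
qed

lemma phiF_holomorphic: "phiF m holomorphic_on upper_half_plane"
proof -
  have "(\<lambda>\<tau>. Dcoeff m 0 \<tau> + (\<Sum>j=1..m div 2. Dcoeff m (2*j) \<tau> *
      (bernoulli_num (2*j) / fact (2*j) * eisenstein (2*j) \<tau>))) holomorphic_on upper_half_plane"
    by (intro holomorphic_on_add holomorphic_on_sum holomorphic_on_mult[OF Dcoeff_holomorphic]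
        bernoulli_eisenstein_holomorphic Dcoeff_holomorphic) auto
  thus ?thesis by (rule holomorphic_transform) (simp add: phiF_def mult_ac)
qed

section \<open>Growth at the cusps\<close>

text \<open>Completing the square bounds the exponent by pi M^2 v - pi v (|\<nu>| - M)^2, and v
  \<ge> 1 allows v to be replaced by 1 in the last term, so the remaining sum is independent of
  \<tau>. The band grows with Im \<tau> because the shift (c\<tau> + d)/2 does.\<close>

lemma jtheta_upper_bound:
  assumes "Im \<tau> \<ge> 1" "\<bar>Im z\<bar> \<le> M * Im \<tau>" "M \<ge> 0"
  shows "norm (jtheta z \<tau>) \<le> exp (pi * M\<^sup>2 * Im \<tau>) * (\<Sum>\<^sub>\<infinity>n. theta_maj 0 1 M n)"
proof -
  define v where "v = Im \<tau>"
  have le: "norm (theta_term n z \<tau>) \<le> exp (pi * M\<^sup>2 * v) * theta_maj 0 1 M n" for n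
  proof -
    define x where "x = 1/2 + real_of_int n"
    have "-(x * Im z) \<le> \<bar>x\<bar> * (M * v)"
    proof -
      have "-(x * Im z) \<le> \<bar>x\<bar> * \<bar>Im z\<bar>" by (simp flip: abs_mult)
      also have "\<dots> \<le> \<bar>x\<bar> * (M * v)" using assms by (intro mult_left_mono) (auto simp: v_def)
      finally show ?thesis .
    qed
    hence "2 * pi * (-(x * Im z)) \<le> 2 * pi * (\<bar>x\<bar> * (M * v))" by (intro mult_left_mono) auto
    hence "-pi * x\<^sup>2 * v - 2 * pi * x * Im z \<le> pi * M\<^sup>2 * v - v * (pi * (\<bar>x\<bar> - M)\<^sup>2)"
      by (simp add: power2_eq_square algebra_simps flip: abs_mult)
    also have "\<dots> \<le> pi * M\<^sup>2 * v - 1 * (pi * (\<bar>x\<bar> - M)\<^sup>2)"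
      using assms by (intro diff_left_mono mult_right_mono) (auto simp: v_def)
    also have "\<dots> \<le> pi * M\<^sup>2 * v + (2 * pi * M * \<bar>x\<bar> - pi * 1 * x\<^sup>2)"
      using assms(3) by (simp add: power2_eq_square algebra_simps flip: abs_mult)
    finally have "exp (-pi * x\<^sup>2 * v - 2 * pi * x * Im z) \<le>
        exp (pi * M\<^sup>2 * v) * exp (2 * pi * M * \<bar>x\<bar> - pi * 1 * x\<^sup>2)"
      by (simp flip: exp_add)
    thus ?thesis
      unfolding norm_theta_term theta_maj_def x_def[symmetric] v_def[symmetric] by simp
  qed
  have "norm (jtheta z \<tau>) \<le> (\<Sum>\<^sub>\<infinity>n. exp (pi * M\<^sup>2 * v) * theta_maj 0 1 M n)"
    unfolding jtheta_altdef
    by (rule norm_infsum_le[OF has_sum_infsum[OF theta_term_summable] has_sum_infsum])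
      (use assms le in \<open>auto intro!: summable_on_cmult_right theta_maj_summable\<close>)
  thus ?thesis by (simp add: infsum_cmult_right' v_def)
qed

text \<open>The pair \<nu> = 1/2, -1/2 has absolute value 2 exp (-pi v/4) |sin (pi z)|, and all
  other pairs together amount to at most half of it. Their Gaussian factors gain exp (-2 pi k)
  because (k + 1/2)^2 - 1/4 = k^2 + k \<ge> 2 k and v \<ge> 1.\<close>

lemma jtheta_lower_bound:
  assumes v: "Im \<tau> \<ge> 1" and z: "norm z = 1/4"
  shows "exp (-pi / 4 * Im \<tau>) * norm (sin (of_real pi * z)) \<le> norm (jtheta z \<tau>)"
proof -
  define v where "v = Im \<tau>"
  define X where "X = exp (of_real pi * \<i> * z)"
  define Y where "Y = inverse X"
  have X0: "X \<noteq> 0" by (simp add: X_def)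
  have XY: "X * Y = 1" using X0 by (simp add: Y_def)
  have Imz: "\<bar>Im z\<bar> \<le> 1/4" using abs_Im_le_cmod[of z] z by simp
  have nX: "norm X \<le> exp (pi / 4)" "norm Y \<le> exp (pi / 4)"
  proof -
    have "pi * (-Im z) \<le> pi * (1/4)" "pi * Im z \<le> pi * (1/4)" using Imz by (intro mult_left_mono; simp)+
    thus "norm X \<le> exp (pi / 4)" "norm Y \<le> exp (pi / 4)"
      by (simp_all add: X_def Y_def norm_exp_eq_Re flip: exp_minus)
  qed
  define t where "t = (\<lambda>n. theta_term (int n) z \<tau> - theta_term (int n) (-z) \<tau>)"
  define a where "a = (\<lambda>n::nat. exp (of_real pi * \<i> * (1/2 + of_int (int n))\<^sup>2 * \<tau> + of_real pi * \<i> * (1/2 + of_int (int n))))"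
  have na: "norm (a n) = exp (-pi * (1/2 + real n)\<^sup>2 * v)" for n
  proof -
    have "norm (theta_term (int n) (-1/2 + 1/2) \<tau>) = exp (-pi * (1/2 + real n)\<^sup>2 * v)"
      unfolding norm_theta_term by (simp add: v_def)
    moreover have "theta_term (int n) (-1/2 + 1/2) \<tau> = a n" by (simp add: theta_term_def a_def mult.assoc)
    ultimately show ?thesis by simp
  qed
  have t_eq: "t n = a n * (X ^ (2 * n + 1) - Y ^ (2 * n + 1))" for n
  proof -
    have p: "exp (of_real pi * \<i> * w) ^ (2 * n + 1) = exp (of_real pi * \<i> * w * of_nat (2 * n + 1))" for w
      by (rule exp_of_nat2_mult[symmetric])
    have theta: "theta_term (int n) w \<tau> = a n * exp (of_real pi * \<i> * w) ^ (2 * n + 1)" for w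
      unfolding theta_term_def a_def p exp_add[symmetric]
      by (rule arg_cong[where f = exp]) (simp add: field_simps)
    have "Y = exp (of_real pi * \<i> * (-z))" by (simp add: Y_def X_def exp_minus)
    thus ?thesis unfolding t_def theta X_def by (simp add: right_diff_distrib)
  qed
  have "(\<lambda>n. t n) summable_on UNIV"
    unfolding t_def diff_conv_add_uminus using v
    by (intro summable_on_add) (auto intro: jtheta_nat_split(1) simp: summable_on_uminus)
  moreover have j_eq: "jtheta z \<tau> = (\<Sum>\<^sub>\<infinity>n. t n)"
  proof -
    have "(\<Sum>\<^sub>\<infinity>n. t n) = (\<Sum>\<^sub>\<infinity>n. theta_term (int n) z \<tau>) + (\<Sum>\<^sub>\<infinity>n. - theta_term (int n) (-z) \<tau>)"
      unfolding t_def diff_conv_add_uminus using v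
      by (intro infsum_add) (auto intro: jtheta_nat_split(1) simp: summable_on_uminus)
    thus ?thesis using v by (simp add: jtheta_nat_split(2) infsum_uminus)
  qed
  ultimately have "t sums jtheta z \<tau>" by (metis has_sum_imp_sums has_sum_infsum)
  hence sums: "(\<lambda>n. t (Suc n)) sums (jtheta z \<tau> - t 0)" by (simp add: sums_Suc_iff)
  define N where "N = norm (t 0)"
  \<comment> \<open>In this ratio 3 accounts for the number of summands, 2 k + 1 \<le> 3^k, and exp
    (-3 pi/2) = exp (-2 pi) exp (pi/2) for the Gaussian decay against the powers of X and Y. With
    ratio 1/3 the tail sums to N/2.\<close>
  have x: "3 * exp (-3 * pi / 2) \<le> 1 / 3"
  proof -
    have "9 \<le> 1 + 3 * pi / 2 + (3 * pi / 2)\<^sup>2 / 2"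
    proof -
      have "(3 * 3 / 2)\<^sup>2 \<le> (3 * pi / 2)\<^sup>2" using pi_gt3 by (intro power_mono) auto
      thus ?thesis using pi_gt3 by (simp add: power2_eq_square)
    qed
    also have "\<dots> \<le> exp (3 * pi / 2)" by (rule exp_lower_Taylor_quadratic) simp
    finally show ?thesis by (simp add: exp_minus field_simps)
  qed
  have bound: "norm (t (Suc n)) \<le> N * (1 / 3) ^ Suc n" for n
  proof -
    define k where "k = Suc n"
    have k: "k \<ge> 1" by (simp add: k_def)
    have "norm (\<Sum>i<2*k+1. Y ^ (2 * k + 1 - Suc i) * X ^ i) \<le> (\<Sum>i<2*k+1. exp (pi / 4) ^ (2 * k))"
    proof (rule sum_norm_le)
      fix i assume "i \<in> {..<2*k+1}"
      hence e: "2 * k + 1 - Suc i + i = 2 * k" by auto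
      have "norm (Y ^ (2 * k + 1 - Suc i) * X ^ i) \<le> exp (pi / 4) ^ (2 * k + 1 - Suc i) * exp (pi / 4) ^ i"
        unfolding norm_mult norm_power by (intro mult_mono power_mono nX) auto
      also have "\<dots> = exp (pi / 4) ^ (2 * k)" by (simp only: power_add[symmetric] e)
      finally show "norm (Y ^ (2 * k + 1 - Suc i) * X ^ i) \<le> exp (pi / 4) ^ (2 * k)" .
    qed
    also have "\<dots> = (2 * real k + 1) * exp (real k * pi / 2)"
      by (simp add: exp_of_nat2_mult[symmetric] mult_ac)
    also have "\<dots> \<le> 3 ^ k * exp (real k * pi / 2)"
    proof (rule mult_right_mono)
      show "2 * real k + 1 \<le> 3 ^ k"
        using Bernoulli_inequality[of "2 :: real" k] by (simp add: mult.commute)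
    qed auto
    finally have S: "norm (\<Sum>i<2*k+1. Y ^ (2 * k + 1 - Suc i) * X ^ i) \<le> 3 ^ k * exp (real k * pi / 2)" .
    \<comment> \<open>Factoring out X - Y, a multiple of sin (pi z), compares every term with the
      leading one without any lower bound for the sine.\<close>
    have fac: "X ^ (2 * k + 1) - Y ^ (2 * k + 1) = (X - Y) * (\<Sum>i<2*k+1. Y ^ (2 * k + 1 - Suc i) * X ^ i)"
      by (rule power_diff_sumr2)
    have "norm (a k) \<le> norm (a 0) * exp (-2 * pi * real k)"
    proof -
      have "real k * 1 \<le> real k * real k" using k by (intro mult_left_mono) auto
      hence "2 * real k * 1 \<le> (real k * real k + real k) * v"
        using v by (intro mult_mono) (auto simp: v_def)
      hence "pi * (2 * real k) \<le> pi * ((real k * real k + real k) * v)" by (intro mult_left_mono) auto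
      thus ?thesis unfolding na by (simp add: power2_eq_square algebra_simps flip: exp_add)
    qed
    hence "norm (t k) \<le> (norm (a 0) * exp (-2 * pi * real k)) * (norm (X - Y) * (3 ^ k * exp (real k * pi / 2)))"
      unfolding t_eq fac norm_mult using S by (intro mult_mono mult_left_mono) auto
    also have "\<dots> = N * (3 ^ k * (exp (-2 * pi * real k) * exp (real k * pi / 2)))"
      by (simp add: N_def t_eq norm_mult)
    also have "exp (-2 * pi * real k) * exp (real k * pi / 2) = exp (-3 * pi / 2) ^ k"
      by (simp add: exp_of_nat2_mult[symmetric] field_simps flip: exp_add)
    also have "3 ^ k * exp (-3 * pi / 2) ^ k = (3 * exp (-3 * pi / 2)) ^ k" by (simp only: power_mult_distrib)
    also have "N * \<dots> \<le> N * (1 / 3) ^ k"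
      using x by (intro mult_left_mono power_mono) (auto simp: N_def)
    finally show ?thesis by (simp add: k_def)
  qed
  have "norm (jtheta z \<tau> - t 0) \<le> (\<Sum>n. N * (1 / 3) ^ Suc n)"
  proof -
    have sm: "summable (\<lambda>n. N * (1 / 3) ^ Suc n)"
      by (intro summable_mult summable_Suc_iff[THEN iffD2] summable_geometric) simp
    have "norm (\<Sum>n. t (Suc n)) \<le> (\<Sum>n. N * (1 / 3) ^ Suc n)"
      by (rule norm_suminf_le[OF bound sm])
    thus ?thesis using sums by (simp add: sums_iff)
  qed
  also have "(\<Sum>n. N * (1 / 3) ^ Suc n) = N / 2"
  proof -
    have "(\<lambda>n. (N / 3) * (1 / 3) ^ n) sums ((N / 3) * (1 / (1 - 1/3)))"
      by (intro sums_mult geometric_sums) simp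
    thus ?thesis by (simp add: sums_iff mult_ac)
  qed
  finally have "N - N / 2 \<le> norm (jtheta z \<tau>)"
    unfolding N_def using norm_triangle_ineq2[of "t 0" "t 0 - jtheta z \<tau>"] by (simp add: norm_minus_commute)
  moreover have "N = exp (-pi / 4 * v) * (2 * norm (sin (of_real pi * z)))"
  proof -
    have "X - Y = 2 * \<i> * sin (of_real pi * z)"
      by (simp add: sin_exp_eq X_def Y_def exp_minus mult_ac)
    thus ?thesis by (simp add: N_def t_eq norm_mult na power2_eq_square)
  qed
  ultimately show ?thesis by (simp add: v_def mult.commute)
qed

section \<open>Functions of at most exponential growth in Im \<tau>\<close>

definition exp_growth :: "(complex \<Rightarrow> complex) \<Rightarrow> bool" where
  "exp_growth f \<longleftrightarrow> (\<exists>A C :: real. \<forall>\<tau>. Im \<tau> \<ge> 1 \<longrightarrow> norm (f \<tau>) \<le> A * exp (C * Im \<tau>))"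

lemma exp_growth_mult: "exp_growth f \<Longrightarrow> exp_growth g \<Longrightarrow> exp_growth (\<lambda>\<tau>. f \<tau> * g \<tau>)"
proof -
  assume "exp_growth f" "exp_growth g"
  then obtain A C B D where h: "\<And>\<tau>. Im \<tau> \<ge> 1 \<Longrightarrow> norm (f \<tau>) \<le> A * exp (C * Im \<tau>)"
    "\<And>\<tau>. Im \<tau> \<ge> 1 \<Longrightarrow> norm (g \<tau>) \<le> B * exp (D * Im \<tau>)"
    unfolding exp_growth_def by metis
  have "norm (f \<tau> * g \<tau>) \<le> (A * B) * exp ((C + D) * Im \<tau>)" if "Im \<tau> \<ge> 1" for \<tau>
  proof -
    have "norm (f \<tau>) * norm (g \<tau>) \<le> (A * exp (C * Im \<tau>)) * (B * exp (D * Im \<tau>))"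
      using h[OF that] by (intro mult_mono order.trans[OF norm_ge_zero h(1)[OF that]]) auto
    also have "\<dots> = (A * B) * exp ((C + D) * Im \<tau>)" by (simp add: ring_distribs exp_add)
    finally show ?thesis by (simp add: norm_mult)
  qed
  thus ?thesis unfolding exp_growth_def by blast
qed

lemma exp_growth_bounded: "(\<And>\<tau>. Im \<tau> \<ge> 1 \<Longrightarrow> norm (f \<tau>) \<le> K) \<Longrightarrow> exp_growth f"
  unfolding exp_growth_def by (rule exI[of _ K], rule exI[of _ 0]) simp

lemma exp_growth_const: "exp_growth (\<lambda>_. c)"
  by (rule exp_growth_bounded[of _ "norm c"]) simp

lemma exp_growth_add: "exp_growth f \<Longrightarrow> exp_growth g \<Longrightarrow> exp_growth (\<lambda>\<tau>. f \<tau> + g \<tau>)"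
proof -
  assume "exp_growth f" "exp_growth g"
  then obtain A C B D where h: "\<And>\<tau>. Im \<tau> \<ge> 1 \<Longrightarrow> norm (f \<tau>) \<le> A * exp (C * Im \<tau>)"
    "\<And>\<tau>. Im \<tau> \<ge> 1 \<Longrightarrow> norm (g \<tau>) \<le> B * exp (D * Im \<tau>)"
    unfolding exp_growth_def by metis
  have "norm (f \<tau> + g \<tau>) \<le> (\<bar>A\<bar> + \<bar>B\<bar>) * exp (max C D * Im \<tau>)" if "Im \<tau> \<ge> 1" for \<tau>
  proof -
    have "norm (f \<tau>) \<le> \<bar>A\<bar> * exp (max C D * Im \<tau>)"
      using that by (intro order.trans[OF h(1)] mult_mono) (auto intro!: mult_right_mono)
    moreover have "norm (g \<tau>) \<le> \<bar>B\<bar> * exp (max C D * Im \<tau>)"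
      using that by (intro order.trans[OF h(2)] mult_mono) (auto intro!: mult_right_mono)
    ultimately show ?thesis using norm_triangle_ineq[of "f \<tau>" "g \<tau>"] by (simp add: ring_distribs)
  qed
  thus ?thesis unfolding exp_growth_def by blast
qed

lemma exp_growth_sum: "(\<And>i. i \<in> I \<Longrightarrow> exp_growth (f i)) \<Longrightarrow> exp_growth (\<lambda>\<tau>. \<Sum>i\<in>I. f i \<tau>)"
proof (induction I rule: infinite_finite_induct)
  case (insert x F)
  thus ?case by (simp add: exp_growth_add)
qed (auto intro: exp_growth_bounded[of _ 0])

lemma exp_growth_bernoulli_eisenstein:
  assumes j: "j \<ge> 1"
  shows "exp_growth (\<lambda>\<tau>. bernoulli_num (2*j) / fact (2*j) * eisenstein (2*j) \<tau>)"
proof -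
  let ?t = "\<lambda>l \<tau>. of_nat (divisor_sigma (2 * j - 1) l) * exp (tpi * \<tau>) ^ l"
  have sm: "(\<lambda>l. norm (?t l \<tau>)) summable_on {1..}" if "Im \<tau> > 0" for \<tau>
    by (rule lambert_series(2)[OF norm_q_less_1[OF that]])
  \<comment> \<open>For Im \<tau> \<ge> 1 every term is dominated by its absolute value at \<tau> =
    i, so the q-series is bounded.\<close>
  have bd: "norm (\<Sum>\<^sub>\<infinity>l\<in>{1..}. ?t l \<tau>) \<le> (\<Sum>\<^sub>\<infinity>l\<in>{1..}. norm (?t l \<i>))" if "Im \<tau> \<ge> 1" for \<tau>
  proof (rule norm_infsum_le[OF has_sum_infsum has_sum_infsum])
    show "(\<lambda>l. ?t l \<tau>) summable_on {1..}" by (rule abs_summable_summable[OF sm]) (use that in simp)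
    show "(\<lambda>l. norm (?t l \<i>)) summable_on {1..}" by (rule sm) simp
    fix l
    have "norm (exp (tpi * \<tau>)) \<le> norm (exp (tpi * \<i>))"
      unfolding norm_exp_2pi using that by simp
    thus "norm (?t l \<tau>) \<le> norm (?t l \<i>)"
      unfolding norm_mult norm_power by (intro mult_left_mono power_mono) auto
  qed
  have "exp_growth (\<lambda>\<tau>. fps_nth bernoulli_fps (2 * j) + (-2 / fact (2 * j - 1)) * (\<Sum>\<^sub>\<infinity>l\<in>{1..}. ?t l \<tau>))"
    by (intro exp_growth_add exp_growth_mult; (rule exp_growth_const | rule exp_growth_bounded[OF bd]))
  thus ?thesis unfolding bernoulli_eisenstein[OF j] by simp
qed

text \<open>
  Up to a constant, the function in question is a Laurent coefficient of \<open>z \<mapsto> \<phi>(z / (c\<tau> + d); \<gamma>\<tau>)\<close>, which Cauchy's formula on the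
  fixed circle \<open>\<bar>z\<bar> = 1/4\<close> bounds uniformly in \<open>\<tau>\<close>.
\<close>

lemma exp_growth_Dcoeff:
  fixes a b c d :: int
  assumes det: "a * d - b * c = 1"
  shows "exp_growth (\<lambda>\<tau>. (of_int c * \<tau> + of_int d) ^ k *
    Dcoeff m k ((of_int a * \<tau> + of_int b) / (of_int c * \<tau> + of_int d)))"
proof -
  obtain \<delta> where \<delta>: "\<delta> > 0" "\<And>z. norm z = 1/4 \<Longrightarrow> \<delta> \<le> norm (sin (of_real pi * z :: complex))"
  proof -
    have "\<exists>w\<in>sphere 0 (1/4). \<forall>z\<in>sphere 0 (1/4).
        norm (sin (of_real pi * w :: complex)) \<le> norm (sin (of_real pi * z :: complex))"
      by (intro continuous_attains_inf continuous_intros) auto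
    then obtain w :: complex where w: "norm w = 1/4" "\<And>z. norm z = 1/4 \<Longrightarrow> norm (sin (of_real pi * w)) \<le> norm (sin (of_real pi * z :: complex))"
      by auto
    have "norm w < 1" "w \<noteq> 0" using w(1) by auto
    hence "w \<in> strip \<i> - \<int>"
      using punctured_ball_subset_strip[of 0 1 \<i>] by auto
    hence "sin (of_real pi * w) \<noteq> 0" using theta_prod_eq_0_iff[of w \<i>] by (auto simp: theta_prod_def)
    thus ?thesis using that[of "norm (sin (of_real pi * w))"] w(2) by auto
  qed
  \<comment> \<open>This M bounds |c| as well as the imaginary parts of z + s/2 and z + s/4, divided
    by Im \<tau>, on the circle |z| = 1/4 when Im \<tau> \<ge> 1.\<close>
  define M where "M = \<bar>real_of_int c\<bar> + 1"
  define K where "K = (\<Sum>\<^sub>\<infinity>n. theta_maj 0 1 M n)"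
  have K: "K \<ge> 0" unfolding K_def by (intro infsum_nonneg) (simp add: theta_maj_def)
  \<comment> \<open>The three summands come from the exponential factor, the shifted theta in the
    numerator, and the lower bound for theta in the denominator.\<close>
  define C where "C = pi * M\<^sup>2 + pi * M\<^sup>2 + pi / 4"
  define B where "B = (\<lambda>\<tau>. (K / \<delta> * exp (C * Im \<tau>)) ^ m)"
  have main: "norm ((of_int c * \<tau> + of_int d) ^ k *
      Dcoeff m k ((of_int a * \<tau> + of_int b) / (of_int c * \<tau> + of_int d))) \<le>
      ((2 * pi) ^ k * (1/4) ^ k) * (K / \<delta>) ^ m * exp ((real m * C) * Im \<tau>)" if v1: "Im \<tau> \<ge> 1" for \<tau>
  proof -
    define s where "s = of_int c * \<tau> + of_int d"
    define \<tau>' where "\<tau>' = (of_int a * \<tau> + of_int b) / s"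
    define v where "v = Im \<tau>"
    have \<tau>: "Im \<tau> > 0" using v1 by simp
    have s: "s \<noteq> 0" unfolding s_def by (rule autfac_nonzero[OF det \<tau>])
    have \<tau>': "Im \<tau>' > 0"
      unfolding \<tau>'_def s_def Im_moebius[OF det \<tau>] using \<tau> s by (simp add: s_def)
    define f where "f = (\<lambda>z. phi m ((1 / s) * z) \<tau>')"
    have f_eq: "f z = (exp (of_real pi * \<i> * of_int c * (z + s / 4)) * jtheta (z + s / 2) \<tau> / jtheta z \<tau>) ^ m" for z
      using phi_modular[OF det \<tau>, of m z] by (simp add: f_def s_def \<tau>'_def)
    obtain G where G: "f has_laurent_expansion G"
      "\<And>n. fls_nth G n = (1 / s) powi n * fls_nth (laurent_expansion (\<lambda>z. phi m z \<tau>') 0) n"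
      using has_laurent_expansion_scale[OF has_laurent_phi[OF \<tau>'], of "1 / s"] s unfolding f_def by auto
    have nz: "jtheta z \<tau> \<noteq> 0" if "z \<in> ball 0 1 - {0}" for z
    proof -
      have "z \<in> strip \<tau> - \<int>" using punctured_ball_subset_strip[of 0 1 \<tau>] v1 that by auto
      thus ?thesis using jtheta_eq_0_iff_strip[OF \<tau>] by auto
    qed
    have hol: "f holomorphic_on ball 0 1 - {0}"
    proof -
      have "((\<lambda>z. jtheta z \<tau>) \<circ> (\<lambda>z. z + s / 2)) holomorphic_on UNIV"
        by (rule holomorphic_on_compose_gen[OF _ jtheta_holomorphic[OF \<tau>]]) (auto intro!: holomorphic_intros)
      hence h: "(\<lambda>z. jtheta (z + s / 2) \<tau>) holomorphic_on ball 0 1 - {0}"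
        by (auto simp: o_def intro: holomorphic_on_subset)
      have "(\<lambda>z. (exp (of_real pi * \<i> * of_int c * (z + s / 4)) * jtheta (z + s / 2) \<tau> / jtheta z \<tau>) ^ m)
          holomorphic_on ball 0 1 - {0}"
        by (intro holomorphic_intros h holomorphic_on_subset[OF jtheta_holomorphic[OF \<tau>]] nz) auto
      thus ?thesis using f_eq by presburger
    qed
    have f_bound: "norm (f z) \<le> B \<tau>" if z: "norm z = 1/4" for z
    proof -
      have Imz: "\<bar>Im z\<bar> \<le> 1/4" using abs_Im_le_cmod[of z] z by simp
      have M: "M \<ge> 1" by (simp add: M_def)
      have cM: "\<bar>real_of_int c\<bar> \<le> M" by (simp add: M_def)
      have v: "v \<ge> 1" using v1 by (simp add: v_def)
      have cv: "\<bar>real_of_int c * v\<bar> = \<bar>real_of_int c\<bar> * v" using v by (simp add: abs_mult)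
      have 1: "norm (jtheta (z + s / 2) \<tau>) \<le> exp (pi * M\<^sup>2 * v) * K"
        unfolding K_def v_def
      proof (rule jtheta_upper_bound[OF v1])
        have "\<bar>Im (z + s / 2)\<bar> \<le> \<bar>Im z\<bar> + \<bar>real_of_int c\<bar> * v / 2"
          using cv abs_triangle_ineq[of "Im z" "real_of_int c * v / 2"] by (simp add: s_def v_def)
        also have "\<dots> \<le> M * v" using Imz v cv by (simp add: M_def algebra_simps)
        finally show "\<bar>Im (z + s / 2)\<bar> \<le> M * Im \<tau>" by (simp add: v_def)
      qed (use M in auto)
      have 2: "norm (exp (of_real pi * \<i> * of_int c * (z + s / 4))) \<le> exp (pi * M\<^sup>2 * v)"
      proof -
        have "Im (z + s / 4) = Im z + real_of_int c * v / 4" by (simp add: s_def v_def)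
        hence "\<bar>Im (z + s / 4)\<bar> \<le> \<bar>Im z\<bar> + \<bar>real_of_int c\<bar> * v / 4"
          using cv abs_triangle_ineq[of "Im z" "real_of_int c * v / 4"] by simp
        also have "\<dots> \<le> M * v" using Imz v cv by (simp add: M_def algebra_simps)
        finally have i: "\<bar>Im (z + s / 4)\<bar> \<le> M * v" .
        have "-(real_of_int c * Im (z + s / 4)) \<le> \<bar>real_of_int c\<bar> * \<bar>Im (z + s / 4)\<bar>"
          unfolding abs_mult[symmetric] using abs_ge_minus_self by blast
        also have "\<dots> \<le> M * (M * v)" using cM i M by (intro mult_mono) auto
        finally have "pi * (-(real_of_int c * Im (z + s / 4))) \<le> pi * (M * (M * v))"
          by (intro mult_left_mono) auto
        moreover have "Re (of_real pi * \<i> * of_int c * (z + s / 4)) = pi * (-(real_of_int c * Im (z + s / 4)))"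
          by (simp add: algebra_simps)
        ultimately show ?thesis by (simp add: norm_exp_eq_Re power2_eq_square mult_ac)
      qed
      have 3: "exp (-pi / 4 * v) * \<delta> \<le> norm (jtheta z \<tau>)"
        using order.trans[OF mult_left_mono[OF \<delta>(2)[OF z]] jtheta_lower_bound[OF v1 z]] by (simp add: v_def)
      have "norm (exp (of_real pi * \<i> * of_int c * (z + s / 4)) * jtheta (z + s / 2) \<tau> / jtheta z \<tau>) \<le>
          (exp (pi * M\<^sup>2 * v) * (exp (pi * M\<^sup>2 * v) * K)) / (exp (-pi / 4 * v) * \<delta>)"
        unfolding norm_divide norm_mult using 1 2 3 \<delta>(1) K
        by (intro frac_le mult_mono mult_nonneg_nonneg) auto
      also have "\<dots> = K / \<delta> * (exp (pi * M\<^sup>2 * v) * exp (pi * M\<^sup>2 * v) * exp (pi / 4 * v))"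
        by (simp add: exp_minus field_simps)
      also have "exp (pi * M\<^sup>2 * v) * exp (pi * M\<^sup>2 * v) * exp (pi / 4 * v) = exp (C * Im \<tau>)"
        by (simp only: C_def v_def distrib_right exp_add[symmetric])
      finally show ?thesis unfolding f_eq B_def norm_power by (intro power_mono) auto
    qed
    have "((\<lambda>z. f z * z powi (-(-int k + 1))) has_contour_integral
            complex_of_real (2 * pi) * \<i> * fls_nth G (-int k)) (circlepath 0 (1/4))"
      by (rule fls_nth_as_contour_integral[OF G(1) hol]) auto
    moreover have "norm (f z * z powi (-(-int k + 1))) \<le> B \<tau> * (1/4) powi (int k - 1)" if "norm (z - 0) = 1/4" for z
    proof -
      have z: "norm z = 1/4" using that by simp
      have "-(-int k + 1) = int k - 1" by simp
      thus ?thesis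
        unfolding norm_mult norm_power_int z using f_bound[OF z] by (simp add: mult_right_mono)
    qed
    moreover have "0 \<le> B \<tau> * (1/4) powi (int k - 1)" using K \<delta> by (simp add: B_def)
    ultimately have "norm (complex_of_real (2 * pi) * \<i> * fls_nth G (-int k)) \<le>
        B \<tau> * (1/4) powi (int k - 1) * (2 * pi * (1/4))"
      by (intro has_contour_integral_bound_circlepath) auto
    hence "(2 * pi) * norm (fls_nth G (-int k)) \<le> (2 * pi) * (B \<tau> * ((1/4) powi (int k - 1) * (1/4)))"
      by (simp add: norm_mult)
    hence "norm (fls_nth G (-int k)) \<le> B \<tau> * ((1/4) powi (int k - 1) * (1/4))"
      by (subst (asm) mult_le_cancel_left_pos) auto
    also have "(1/4 :: real) powi (int k - 1) * (1/4) = (1/4) powi (int k - 1 + 1)"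
      by (subst power_int_add) auto
    also have "\<dots> = (1/4) ^ k" by simp
    finally have "norm (fls_nth G (-int k)) \<le> B \<tau> * (1/4) ^ k" .
    hence "(2 * pi) ^ k * norm (fls_nth G (-int k)) \<le> (2 * pi) ^ k * (B \<tau> * (1/4) ^ k)"
      by (intro mult_left_mono) auto
    moreover have "s ^ k * Dcoeff m k \<tau>' = (tpi) ^ k * fls_nth G (-int k)"
      unfolding G(2) Dcoeff_def by (simp add: power_int_minus power_divide)
    hence "norm (s ^ k * Dcoeff m k \<tau>') = (2 * pi) ^ k * norm (fls_nth G (-int k))"
      by (simp add: norm_mult norm_power)
    moreover have "B \<tau> = (K / \<delta>) ^ m * exp ((real m * C) * Im \<tau>)"
      unfolding B_def power_mult_distrib by (simp add: exp_of_nat_mult[symmetric] mult_ac)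
    ultimately show ?thesis unfolding s_def \<tau>'_def by (simp add: mult_ac)
  qed
  thus ?thesis unfolding exp_growth_def by blast
qed

lemma exp_growth_phiF:
  fixes a b c d :: int
  assumes det: "a * d - b * c = 1" and m: "m \<ge> 2"
  shows "exp_growth (\<lambda>\<tau>. phiF m ((of_int a * \<tau> + of_int b) / (of_int c * \<tau> + of_int d)))"
proof -
  let ?s = "\<lambda>\<tau>. of_int c * \<tau> + of_int d :: complex"
  let ?\<tau> = "\<lambda>\<tau>. (of_int a * \<tau> + of_int b) / ?s \<tau>"
  \<comment> \<open>The defect of E_2 stays bounded because |c\<tau> + d| \<ge> |c| Im \<tau> \<ge>
    |c|.\<close>
  have e: "exp_growth (\<lambda>\<tau>. of_int c / (tpi * ?s \<tau>))"
  proof (rule exp_growth_bounded)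
    fix \<tau> :: complex assume v: "Im \<tau> \<ge> 1"
    have "\<bar>real_of_int c\<bar> * 1 \<le> \<bar>real_of_int c\<bar> * Im \<tau>" using v by (intro mult_left_mono) auto
    also have "\<dots> = \<bar>Im (?s \<tau>)\<bar>" using v by (simp add: abs_mult)
    also have "\<dots> \<le> norm (?s \<tau>)" by (rule abs_Im_le_cmod)
    finally have "\<bar>real_of_int c\<bar> \<le> norm (?s \<tau>)" by simp
    hence "\<bar>real_of_int c\<bar> / norm (?s \<tau>) \<le> 1" by (simp add: divide_le_eq_1)
    hence "\<bar>real_of_int c\<bar> / norm (?s \<tau>) * (1 / (2 * pi)) \<le> 1 * (1 / (2 * pi))" by (intro mult_right_mono) auto
    moreover have "norm (of_int c / (tpi * S)) = \<bar>real_of_int c\<bar> / norm S * (1 / (2 * pi))" for S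
      by (simp add: norm_divide norm_mult)
    ultimately show "norm (of_int c / (tpi * ?s \<tau>)) \<le> 1 / (2 * pi)"
      by (simp only: mult_1_left)
  qed
  have "exp_growth (\<lambda>\<tau>. ?s \<tau> ^ 0 * Dcoeff m 0 (?\<tau> \<tau>) +
    (\<Sum>j=1..m div 2. (bernoulli_num (2*j) / fact (2*j) * eisenstein (2*j) \<tau>) * (?s \<tau> ^ (2*j) * Dcoeff m (2*j) (?\<tau> \<tau>))) +
    ?s \<tau> ^ 2 * Dcoeff m 2 (?\<tau> \<tau>) * (of_int c / (tpi * ?s \<tau>)))" (is "exp_growth ?f")
  proof (intro exp_growth_add exp_growth_sum)
    show "exp_growth (\<lambda>\<tau>. ?s \<tau> ^ 0 * Dcoeff m 0 (?\<tau> \<tau>))" by (rule exp_growth_Dcoeff[OF det])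
    show "exp_growth (\<lambda>\<tau>. ?s \<tau> ^ 2 * Dcoeff m 2 (?\<tau> \<tau>) * (of_int c / (tpi * ?s \<tau>)))"
      by (rule exp_growth_mult[OF exp_growth_Dcoeff[OF det] e])
    fix j assume "j \<in> {1..m div 2}"
    thus "exp_growth (\<lambda>\<tau>. (bernoulli_num (2*j) / fact (2*j) * eisenstein (2*j) \<tau>) * (?s \<tau> ^ (2*j) * Dcoeff m (2*j) (?\<tau> \<tau>)))"
      by (intro exp_growth_mult[OF exp_growth_bernoulli_eisenstein exp_growth_Dcoeff[OF det]]) simp
  qed
  moreover have "phiF m (?\<tau> \<tau>) = ?f \<tau>" if "Im \<tau> \<ge> 1" for \<tau>
    using that by (intro phiF_moebius[OF det _ m]) simp
  ultimately show ?thesis unfolding exp_growth_def by simp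
qed

section \<open>The modular form and the Jacobi form\<close>

lemma phiF_hat_almost_holomorphic:
  assumes m: "m > 0" "even m"
  shows "almost_holomorphic_modular_form 0 (Gamma0 2) (psi m) (phiF_hat m)"
  unfolding almost_holomorphic_modular_form_def
proof (intro conjI)
  have m2: "m \<ge> 2" using m by (auto elim!: evenE)
  \<comment> \<open>The polynomial in 1/v has degree 1, with leading coefficient -D_2/(4 pi); the
    weight 0 - 2 demanded of it is the weight of D_2.\<close>
  define g where "g = (\<lambda>(j::nat) \<tau>. if j = 0 then phiF m \<tau> else Dcoeff m 2 \<tau> * (-1 / (4 * of_real pi)))"
  have g: "g 0 = phiF m" "g (Suc 0) = (\<lambda>\<tau>. Dcoeff m 2 \<tau> * (-1 / (4 * of_real pi)))"
    by (simp_all add: g_def fun_eq_iff)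
  have hol: "g j holomorphic_on upper_half_plane" if "j \<le> 1" for j
  proof (cases "j = 0")
    case True
    show ?thesis unfolding True g by (rule phiF_holomorphic)
  next
    case False
    hence "j = Suc 0" using that by simp
    thus ?thesis using m2 by (simp only: g) (intro holomorphic_on_mult Dcoeff_holomorphic holomorphic_on_const)
  qed
  have cusp0: "at_most_poles_at_cusps 0 (phiF m)"
    unfolding at_most_poles_at_cusps_def
  proof
    fix \<gamma> assume "\<gamma> \<in> SL2Z"
    then obtain a b c d where \<gamma>: "\<gamma> = (a, b, c, d)" "a * d - b * c = 1" by (auto simp: SL2Z_def)
    show "\<exists>A C :: real. \<forall>\<tau>. Im \<tau> \<ge> 1 \<longrightarrow> norm (autfac \<gamma> \<tau> powi (-0) * phiF m (mob \<gamma> \<tau>)) \<le> A * exp (C * Im \<tau>)"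
      using exp_growth_phiF[OF \<gamma>(2) m2] by (simp add: exp_growth_def mob_def autfac_def \<gamma>(1))
  qed
  have cusp1: "at_most_poles_at_cusps (-2) (\<lambda>\<tau>. Dcoeff m 2 \<tau> * (-1 / (4 * of_real pi)))"
    unfolding at_most_poles_at_cusps_def
  proof
    fix \<gamma> assume "\<gamma> \<in> SL2Z"
    then obtain a b c d where \<gamma>: "\<gamma> = (a, b, c, d)" "a * d - b * c = 1" by (auto simp: SL2Z_def)
    show "\<exists>A C :: real. \<forall>\<tau>. Im \<tau> \<ge> 1 \<longrightarrow>
        norm (autfac \<gamma> \<tau> powi (-(-2)) * (Dcoeff m 2 (mob \<gamma> \<tau>) * (-1 / (4 * of_real pi)))) \<le> A * exp (C * Im \<tau>)"
      using exp_growth_mult[OF exp_growth_Dcoeff[OF \<gamma>(2), of 2 m] exp_growth_const[of "-1 / (4 * of_real pi)"]]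
      by (simp add: exp_growth_def mob_def autfac_def \<gamma>(1) mult.assoc)
  qed
  have "g j holomorphic_on upper_half_plane \<and> at_most_poles_at_cusps (0 - 2 * int j) (g j)" if "j \<le> 1" for j
    using hol[OF that] cusp0 cusp1 that by (cases j) (auto simp: g)
  moreover have "phiF_hat m \<tau> = (\<Sum>j\<le>1. g j \<tau> * (1 / complex_of_real (Im \<tau>)) ^ j)" for \<tau>
    by (simp add: phiF_hat_def g)
  ultimately show "\<exists>(n :: nat) (g :: nat \<Rightarrow> complex \<Rightarrow> complex).
        (\<forall>j\<le>n. g j holomorphic_on upper_half_plane \<and>
                at_most_poles_at_cusps (0 - 2 * int j) (g j)) \<and>
        (\<forall>\<tau>\<in>upper_half_plane. phiF_hat m \<tau> = (\<Sum>j\<le>n. g j \<tau> * (1 / complex_of_real (Im \<tau>)) ^ j))"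
    by blast
  show "\<forall>\<gamma>\<in>Gamma0 2. \<forall>\<tau>\<in>upper_half_plane. phiF_hat m (mob \<gamma> \<tau>) = psi m \<gamma> * autfac \<gamma> \<tau> powi 0 * phiF_hat m \<tau>"
  proof (intro ballI)
    fix \<gamma> \<tau> assume "\<gamma> \<in> Gamma0 2" and \<tau>: "\<tau> \<in> upper_half_plane"
    then obtain a b c d where \<gamma>: "\<gamma> = (a, b, c, d)" "a * d - b * c = 1" "even c"
      by (auto simp: Gamma0_def)
    show "phiF_hat m (mob \<gamma> \<tau>) = psi m \<gamma> * autfac \<gamma> \<tau> powi 0 * phiF_hat m \<tau>"
      using phiF_hat_modular[OF \<gamma>(2,3) m(2,1), of \<tau>] \<tau> by (simp add: \<gamma>(1) mob_def upper_half_plane_def)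
  qed
qed

text \<open>The decomposition leaves only \<phi> minus the completed finite part. The value at
  lattice points is set by hand: for m > 0 division by zero makes \<open>phi\<close> vanish there,
  so the bare difference would not have the value 0 that a pole must carry.\<close>

definition phiP_continuation :: "nat \<Rightarrow> complex \<Rightarrow> complex \<Rightarrow> complex" where
  "phiP_continuation m z \<tau> = (if jtheta z \<tau> = 0 then 0 else phi m z \<tau> - phiF_hat m \<tau>)"

text \<open>At a lattice point the numerator of \<phi> stays away from 0 while the denominator tends
  to 0, and subtracting a term constant in z preserves the pole. Elsewhere the function is
  holomorphic, so these are all the singularities.\<close>

lemma strip_continuation_phiP:
  assumes m: "m > 0" "even m"
  shows "strip_continuation (phiP_hat m) (phiP_continuation m)"
  unfolding strip_continuation_def
proof (intro ballI conjI allI impI)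
  fix \<tau> assume "\<tau> \<in> upper_half_plane"
  hence \<tau>: "Im \<tau> > 0" by (simp add: upper_half_plane_def)
  show "phiP_continuation m z \<tau> = phiP_hat m z \<tau>" if z: "0 < Im z \<and> Im z < Im \<tau>" for z
  proof -
    have "z \<in> strip \<tau> - \<int>" using z by (auto simp: strip_def elim!: Ints_cases)
    hence "jtheta z \<tau> \<noteq> 0" using jtheta_eq_0_iff_strip[OF \<tau>] by auto
    thus ?thesis using phi_decomposition[OF m(2)] z by (simp add: phiP_continuation_def)
  qed
  let ?P = "\<lambda>z. phiP_continuation m z \<tau>"
  have holP: "?P holomorphic_on {z. jtheta z \<tau> \<noteq> 0}"
  proof (rule holomorphic_transform)
    show "(\<lambda>z. phi m z \<tau> - phiF_hat m \<tau>) holomorphic_on {z. jtheta z \<tau> \<noteq> 0}"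
      by (intro holomorphic_intros phi_holomorphic[OF \<tau>])
  qed (simp add: phiP_continuation_def)
  have near: "\<exists>r>0. \<forall>w\<in>ball x r - {x}. jtheta w \<tau> \<noteq> 0" if x: "jtheta x \<tau> = 0" for x
  proof (intro exI conjI ballI)
    show "min 1 (Im \<tau>) > 0" using \<tau> by simp
    fix w assume w: "w \<in> ball x (min 1 (Im \<tau>)) - {x}"
    obtain l k where lk: "x = of_int l * \<tau> + of_int k" using x jtheta_eq_0_iff[OF \<tau>] by blast
    have "w - x \<in> ball 0 (min 1 (Im \<tau>)) - {0}" using w by (auto simp: dist_norm norm_minus_commute)
    hence "w - x \<in> strip \<tau> - \<int>" using punctured_ball_subset_strip[of 0 "min 1 (Im \<tau>)" \<tau>] by auto
    hence "jtheta (w - x) \<tau> \<noteq> 0" using jtheta_eq_0_iff_strip[OF \<tau>] by auto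
    moreover have "w = (w - x) + of_int l * \<tau> + of_int k" by (simp add: lk)
    ultimately show "jtheta w \<tau> \<noteq> 0" using jtheta_shift_eq_0_iff[of "w - x" l \<tau> k] by metis
  qed
  show "?P nicely_meromorphic_on UNIV"
  proof (rule nicely_meromorphic_onI_open[where pts = "{z. jtheta z \<tau> = 0}"])
    show "open (UNIV :: complex set)" by simp
    have "UNIV - {z. jtheta z \<tau> = 0} = {z. jtheta z \<tau> \<noteq> 0}" by auto
    thus "?P analytic_on UNIV - {z. jtheta z \<tau> = 0}"
      using holP open_jtheta_nonzero[OF \<tau>] by (simp add: analytic_on_open)
  next
    fix x assume "x \<in> {z. jtheta z \<tau> = 0}"
    hence x: "jtheta x \<tau> = 0" by simp
    obtain r where r: "r > 0" "\<forall>w\<in>ball x r - {x}. jtheta w \<tau> \<noteq> 0" using near[OF x] by blast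
    have ev: "eventually (\<lambda>w. jtheta w \<tau> \<noteq> 0) (at x)"
    proof -
      have "eventually (\<lambda>w. w \<in> ball x r - {x}) (at x)" using r by (intro eventually_at_in_open) auto
      thus ?thesis by eventually_elim (use r in auto)
    qed
    have cont: "isCont (\<lambda>w. jtheta w \<tau>) y" for y
      by (rule DERIV_isCont[OF jtheta_has_derivative[OF \<tau>]])
    have lim: "((\<lambda>w. jtheta (w + 1/2) \<tau> ^ m) \<longlongrightarrow> jtheta (x + 1/2) \<tau> ^ m) (at x)"
      by (intro tendsto_power isCont_tendsto_compose[OF cont] tendsto_intros)
    have "((\<lambda>w. jtheta w \<tau> ^ m) \<longlongrightarrow> jtheta x \<tau> ^ m) (at x)"
      by (intro tendsto_power isContD cont)
    hence "((\<lambda>w. jtheta w \<tau> ^ m) \<longlongrightarrow> 0) (at x)" using x m(1) by (simp add: zero_power)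
    moreover have "eventually (\<lambda>w. jtheta w \<tau> ^ m \<noteq> 0) (at x)"
      using ev by eventually_elim simp
    ultimately have "filterlim (\<lambda>w. jtheta w \<tau> ^ m) (at 0) (at x)" by (rule filterlim_atI)
    from filterlim_divide_at_infinity[OF lim this]
    have "filterlim (\<lambda>w. jtheta (w + 1/2) \<tau> ^ m / jtheta w \<tau> ^ m) at_infinity (at x)"
      using jtheta_half_nonzero[OF \<tau> x] by simp
    hence "filterlim (\<lambda>w. phi m w \<tau>) at_infinity (at x)" by (simp add: phi_def power_divide)
    hence "filterlim (\<lambda>w. - phiF_hat m \<tau> + phi m w \<tau>) at_infinity (at x)"
      by (intro tendsto_add_filterlim_at_infinity[OF tendsto_const])
    moreover have "eventually (\<lambda>w. - phiF_hat m \<tau> + phi m w \<tau> = ?P w) (at x)"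
      using ev by eventually_elim (simp add: phiP_continuation_def)
    ultimately have "filterlim ?P at_infinity (at x)"
      using filterlim_cong[OF refl refl] by fast
    thus "is_pole ?P x \<and> ?P x = 0" using x by (simp add: is_pole_def phiP_continuation_def)
  next
    fix x :: complex
    have "\<exists>r>0. \<forall>w\<in>ball x r - {x}. jtheta w \<tau> \<noteq> 0"
    proof (cases "jtheta x \<tau> = 0")
      case False
      then obtain r where "r > 0" "ball x r \<subseteq> {z. jtheta z \<tau> \<noteq> 0}"
        using open_jtheta_nonzero[OF \<tau>] openE by blast
      thus ?thesis by blast
    qed (rule near)
    then obtain r where r: "r > 0" "ball x r - {x} \<subseteq> {z. jtheta z \<tau> \<noteq> 0}" by blast
    show "isolated_singularity_at ?P x"
      by (rule isolated_singularity_at_holomorphic[OF holomorphic_on_subset[OF holP r(2)]]) (use r in auto)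
  qed
qed

text \<open>\<phi> and the completed finite part acquire the same character, and both are unchanged
  by lattice shifts of z. The case distinction is respected because theta vanishes at a point
  exactly when it vanishes at its image.\<close>

lemma phiP_continuation_jacobi:
  assumes m: "m > 0" "even m"
  shows "jacobi_form_weight0 (Gamma0 2) (psi m) (phiP_continuation m)"
  unfolding jacobi_form_weight0_def
proof (intro conjI ballI allI)
  fix \<gamma> \<tau> z assume "\<gamma> \<in> Gamma0 2" and "\<tau> \<in> upper_half_plane"
  then obtain a b c d where \<gamma>: "\<gamma> = (a, b, c, d)" "a * d - b * c = 1" "even c" and \<tau>: "Im \<tau> > 0"
    by (auto simp: Gamma0_def upper_half_plane_def)
  obtain \<eta> where \<eta>: "\<eta> \<noteq> 0" "\<And>z. jtheta (z / (of_int c * \<tau> + of_int d)) ((of_int a * \<tau> + of_int b) / (of_int c * \<tau> + of_int d)) =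
      \<eta> * exp (of_real pi * \<i> * of_int c * z\<^sup>2 / (of_int c * \<tau> + of_int d)) * jtheta z \<tau>"
    using jtheta_modular[OF \<gamma>(2) \<tau>] by blast
  show "phiP_continuation m (z / autfac \<gamma> \<tau>) (mob \<gamma> \<tau>) = psi m \<gamma> * phiP_continuation m z \<tau>"
    unfolding phiP_continuation_def \<gamma>(1) mob_def autfac_def prod.case \<eta>(2)
      phi_modular_Gamma0[OF \<gamma>(2,3) m(2) \<tau>] phiF_hat_modular[OF \<gamma>(2,3) m(2,1) \<tau>]
    using \<eta>(1) by (simp add: right_diff_distrib)
next
  fix \<tau> z :: complex and l k :: int
  show "phiP_continuation m (z + of_int l * \<tau> + of_int k) \<tau> = phiP_continuation m z \<tau>"
    unfolding phiP_continuation_def jtheta_shift_eq_0_iff phi_lattice_shift[OF m(2)] ..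
qed

text \<open>The first conjunct certifies that \<open>Dcoeff\<close> gives the prescribed expansion,
  with no odd terms. The Jacobi property is asserted of the continuation because lattice shifts and
  modular substitutions lead out of the strip of convergence.\<close>

theorem theorem1p2:
  fixes m :: nat
  assumes "m > 0" and "even m"
  shows
    "(\<forall>\<tau>\<in>upper_half_plane.
        (\<lambda>z. phi m z \<tau> - (\<Sum>j=0..m div 2. Dcoeff m (2*j) \<tau> / (2 * of_real pi * \<i> * z) ^ (2*j)))
          \<in> O[at 0](\<lambda>z. z^2)) \<and>
     (\<forall>\<tau>\<in>upper_half_plane. \<forall>z. 0 < Im z \<and> Im z < Im \<tau> \<longrightarrow>
        phi m z \<tau> = phiF_hat m \<tau> + phiP_hat m z \<tau>) \<and>
     almost_holomorphic_modular_form 0 (Gamma0 2) (psi m) (phiF_hat m) \<and>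
     (\<exists>P. strip_continuation (phiP_hat m) P \<and> jacobi_form_weight0 (Gamma0 2) (psi m) P)"
  using phi_principal_part[OF _ assms(2)] phi_decomposition[OF assms(2)]
    phiF_hat_almost_holomorphic[OF assms] strip_continuation_phiP[OF assms]
    phiP_continuation_jacobi[OF assms]
  unfolding upper_half_plane_def by blast

end
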